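(* Let $\varphi_0(x)=\sqrt2\,e^{-|x|}$. Suppose that $\psi(t)$ is any $H^1$ solution of $$i\partial_t\psi+\partial_x^2\psi+\delta|\psi|^2\psi=0,\qquad x\in\mathbb{R},$$ where $\delta=\delta(x)$ is the delta function at the origin, that blows up at some forward time $T_*>0$, $T_*<\infty$. Let $\mu(t)$ be any function such that $\lim_{t\nearrow T_*}\mu(t)=+\infty$. Then $$\liminf_{t\nearrow T_*}\int_{|x|\le\mu(t)\|\psi_x(t)\|_{L^2}^{-1}}|\psi(x,t)|^2\,dx\ \ge\ \|\varphi_0\|_{L^2}^2 .$$
   Context: Meaning of the equation: $i\partial_t\psi+\partial_x^2\psi=0$ for $x\ne0$, with $\psi(0,t)=\psi(0-,t)=\psi(0+,t)$ and $\partial_x\psi(0+,t)-\partial_x\psi(0-,t)=-|\psi(0,t)|^2\psi(0,t)$. $H^1$ solutions: for $\psi_0\in H^1(\mathbb{R})$ there is $T=T(\|\psi_0\|_{H^1})>0$ and a solution on $[0,T)$ with $\psi(0)=\psi_0$ such that $\psi\in C([0,T];H^1_x)$; $\psi\in L^q_{[0,T]}W^{1,r}_x$ for Strichartz admissible pairs $\frac2q+\frac1r=\frac12$; $\psi\in C(x\in\mathbb{R};H^{3/4}_{[0,T]})$; $\partial_x\psi\in C(x\in\mathbb{R}\setminus\{0\};H^{1/4}_{[0,T]})$; the one-sided limits $\partial_x\psi(0\pm,t)$ exist in $H^{1/4}_{[0,T]}$; and the derivative jump condition holds as an equality of $H^{1/4}_{[0,T]}$ functions. Such a solution is unique in this class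 and the data-to-solution map $H^1_x\to C([0,T];H^1_x)$ is continuous (known local well-posedness theory). The mass $M(\psi)=\|\psi(t)\|_{L^2}^2$ and energy $E(\psi)=\frac12\|\psi_x(t)\|_{L^2}^2-\frac14|\psi(0,t)|^4$ are independent of $t$. If the maximal forward time of existence $T_*>0$ is finite, then $\lim_{t\nearrow T_*}\|\psi_x(t)\|_{L^2}=+\infty$, and one says that $\psi$ blows up at time $T_*$. *)

theory Defs
  imports "HOL-Analysis.Analysis" "HOL-Probability.Essential_Supremum"
begin

(* A space-time function is written u :: real => real => complex with u t x = psi(x,t), so that
   u t is the time slice psi(t).  Elements of Lebesgue and Sobolev spaces are represented by
   Borel measurable functions. *)

definition L2 :: "(real \<Rightarrow> complex) \<Rightarrow> bool" where
  "L2 f \<longleftrightarrow> f \<in> borel_measurable lborel \<and> integrable lborel (\<lambda>x. (norm (f x))\<^sup>2)"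

definition L2_norm :: "(real \<Rightarrow> complex) \<Rightarrow> real" where
  "L2_norm f = sqrt (LINT x|lborel. (norm (f x))\<^sup>2)"

definition ennreal_powr :: "ennreal \<Rightarrow> real \<Rightarrow> ennreal" where
  "ennreal_powr y a = (if y = \<infinity> then \<infinity> else ennreal (enn2real y powr a))"

(* Only used for exponents 1 <= p <= infinity. *)
definition Lp_norm :: "ennreal \<Rightarrow> 'a measure \<Rightarrow> ('a \<Rightarrow> ennreal) \<Rightarrow> ennreal" where
  "Lp_norm p M f =
     (if p = \<infinity> then esssup M f
      else ennreal_powr (\<integral>\<^sup>+x. ennreal_powr (f x) (enn2real p) \<partial>M) (1 / enn2real p))"

definition test_function :: "(real \<Rightarrow> real) \<Rightarrow> bool" where
  "test_function \<phi> \<longleftrightarrow>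
     (\<forall>k x. (deriv ^^ k) \<phi> field_differentiable at x) \<and>
     (\<exists>K. compact K \<and> (\<forall>x. x \<notin> K \<longrightarrow> \<phi> x = 0))"

definition locally_integrable :: "(real \<Rightarrow> complex) \<Rightarrow> bool" where
  "locally_integrable f \<longleftrightarrow> (\<forall>K. compact K \<longrightarrow> set_integrable lborel K f)"

definition has_weak_deriv :: "(real \<Rightarrow> complex) \<Rightarrow> (real \<Rightarrow> complex) \<Rightarrow> bool" where
  "has_weak_deriv f g \<longleftrightarrow> locally_integrable f \<and> locally_integrable g \<and>
     (\<forall>\<phi>. test_function \<phi> \<longrightarrow>
        (LINT x|lborel. f x * of_real (deriv \<phi> x)) = - (LINT x|lborel. g x * of_real (\<phi> x)))"

(* Point values such as psi(0,t) are those of the continuous representative of an H^1 class,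
   and we work with that representative throughout; in particular psi(0-,t) = psi(0,t) = psi(0+,t). *)
definition H1 :: "(real \<Rightarrow> complex) \<Rightarrow> bool" where
  "H1 f \<longleftrightarrow> continuous_on UNIV f \<and> L2 f \<and> (\<exists>g. L2 g \<and> has_weak_deriv f g)"

(* Unique almost everywhere when H1 f. *)
definition weak_deriv :: "(real \<Rightarrow> complex) \<Rightarrow> (real \<Rightarrow> complex)" where
  "weak_deriv f = (SOME g. L2 g \<and> has_weak_deriv f g)"

definition H1_norm :: "(real \<Rightarrow> complex) \<Rightarrow> real" where
  "H1_norm f = sqrt ((L2_norm f)\<^sup>2 + (L2_norm (weak_deriv f))\<^sup>2)"

(* The norm of W^{1,r}(R), for functions that are already known to be in H^1. *)
definition W1_norm :: "ennreal \<Rightarrow> (real \<Rightarrow> complex) \<Rightarrow> ennreal" where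
  "W1_norm r f = Lp_norm r lborel (\<lambda>x. ennreal (norm (f x)))
               + Lp_norm r lborel (\<lambda>x. ennreal (norm (weak_deriv f x)))"

(* Square of the Sobolev-Slobodeckij (Gagliardo) norm of H^s on [0,T], for 0 < s < 1. *)
definition Hs_normsq :: "real \<Rightarrow> real \<Rightarrow> (real \<Rightarrow> complex) \<Rightarrow> ennreal" where
  "Hs_normsq s T f =
     (\<integral>\<^sup>+t\<in>{0..T}. ennreal ((norm (f t))\<^sup>2) \<partial>lborel) +
     (\<integral>\<^sup>+t\<in>{0..T}. (\<integral>\<^sup>+\<tau>\<in>{0..T}.
        ennreal ((norm (f t - f \<tau>))\<^sup>2 / \<bar>t - \<tau>\<bar> powr (1 + 2 * s)) \<partial>lborel) \<partial>lborel)"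

definition Hs :: "real \<Rightarrow> real \<Rightarrow> (real \<Rightarrow> complex) \<Rightarrow> bool" where
  "Hs s T f \<longleftrightarrow> f \<in> borel_measurable (restrict_space lborel {0..T}) \<and> Hs_normsq s T f < \<infinity>"

definition continuous_into_Hs :: "real \<Rightarrow> real \<Rightarrow> real set \<Rightarrow> (real \<Rightarrow> real \<Rightarrow> complex) \<Rightarrow> bool" where
  "continuous_into_Hs s T X w \<longleftrightarrow>
     (\<forall>x\<in>X. Hs s T (w x)) \<and>
     (\<forall>x\<in>X. ((\<lambda>y. Hs_normsq s T (\<lambda>t. w y t - w x t)) \<longlongrightarrow> 0) (at x within X))"

(* D j k is the partial derivative of order j in t and k in x. *)
definition test_function2 :: "(real \<times> real) set \<Rightarrow> (real \<Rightarrow> real \<Rightarrow> real) \<Rightarrow> bool" where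
  "test_function2 \<Omega> \<phi> \<longleftrightarrow>
     (\<exists>D :: nat \<Rightarrow> nat \<Rightarrow> real \<Rightarrow> real \<Rightarrow> real. D 0 0 = \<phi> \<and>
        (\<forall>j k. continuous_on UNIV (\<lambda>(t, x). D j k t x) \<and>
           (\<forall>t x. ((\<lambda>s. D j k s x) has_real_derivative D (Suc j) k t x) (at t) \<and>
                  ((\<lambda>y. D j k t y) has_real_derivative D j (Suc k) t x) (at x)))) \<and>
     (\<exists>K. compact K \<and> K \<subseteq> \<Omega> \<and> (\<forall>t x. (t, x) \<notin> K \<longrightarrow> \<phi> t x = 0))"

(* i u_t + u_xx = 0 in the sense of distributions on (0,T) x (R - {0}). *)
definition free_equation_off_origin :: "real \<Rightarrow> (real \<Rightarrow> real \<Rightarrow> complex) \<Rightarrow> bool" where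
  "free_equation_off_origin T u \<longleftrightarrow>
     (\<forall>\<phi>. test_function2 ({0<..<T} \<times> (- {0})) \<phi> \<longrightarrow>
        (LINT t|lborel. LINT x|lborel.
           u t x * (- \<i> * of_real (deriv (\<lambda>s. \<phi> s x) t)
                    + of_real ((deriv ^^ 2) (\<lambda>y. \<phi> t y) x))) = 0)"

(* The x-derivative of u, as a function of x with values in H^{1/4} on [0,T], is given by a jointly
   measurable representative v (v x t for u_x(x,t)); vp and vm are its one-sided limits at x = 0. *)
definition derivative_traces_and_jump :: "real \<Rightarrow> (real \<Rightarrow> real \<Rightarrow> complex) \<Rightarrow> bool" where
  "derivative_traces_and_jump T u \<longleftrightarrow>
     (\<exists>v vp vm.
        (\<lambda>(x, t). v x t) \<in> borel_measurable (borel :: (real \<times> real) measure) \<and>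
        (AE t in restrict_space lborel {0..T}. AE x in lborel. v x t = weak_deriv (u t) x) \<and>
        continuous_into_Hs (1/4) T (- {0}) v \<and>
        Hs (1/4) T vp \<and> Hs (1/4) T vm \<and>
        ((\<lambda>x. Hs_normsq (1/4) T (\<lambda>t. v x t - vp t)) \<longlongrightarrow> 0) (at_right 0) \<and>
        ((\<lambda>x. Hs_normsq (1/4) T (\<lambda>t. v x t - vm t)) \<longlongrightarrow> 0) (at_left 0) \<and>
        (AE t in restrict_space lborel {0..T}.
           vp t - vm t = - of_real ((norm (u t 0))\<^sup>2) * u t 0))"

definition continuous_into_H1 :: "real \<Rightarrow> (real \<Rightarrow> real \<Rightarrow> complex) \<Rightarrow> bool" where
  "continuous_into_H1 T u \<longleftrightarrow>
     (\<forall>t\<in>{0..T}. H1 (u t)) \<and>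
     (\<forall>t\<in>{0..T}. ((\<lambda>s. H1_norm (\<lambda>x. u s x - u t x)) \<longlongrightarrow> 0) (at t within {0..T}))"

(* The exponents range over [1,infinity] and 2/infinity = 1/infinity = 0 in ennreal, so that
   the pairs are exactly those with 4 <= q <= infinity and 2 <= r <= infinity. *)
definition strichartz_class :: "real \<Rightarrow> (real \<Rightarrow> real \<Rightarrow> complex) \<Rightarrow> bool" where
  "strichartz_class T u \<longleftrightarrow>
     (\<forall>q r :: ennreal. 1 \<le> q \<and> 1 \<le> r \<and> 2 / q + 1 / r = 1 / 2 \<longrightarrow>
        Lp_norm q (restrict_space lborel {0..T}) (\<lambda>t. W1_norm r (u t)) < \<infinity>)"

(* H^1 solution on [0,T] of i u_t + u_xx + delta |u|^2 u = 0, with initial value u 0.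
   The values u t for t outside [0,T] are irrelevant. *)
definition H1_solution :: "real \<Rightarrow> (real \<Rightarrow> real \<Rightarrow> complex) \<Rightarrow> bool" where
  "H1_solution T u \<longleftrightarrow> 0 < T \<and>
     continuous_into_H1 T u \<and>
     strichartz_class T u \<and>
     continuous_into_Hs (3/4) T UNIV (\<lambda>x t. u t x) \<and>
     free_equation_off_origin T u \<and>
     derivative_traces_and_jump T u"

(* u is the solution on [0,Tstar), and Tstar is the supremum of all T for which the
   initial value u 0 has an H^1 solution on [0,T]. *)
definition maximal_H1_solution :: "real \<Rightarrow> (real \<Rightarrow> real \<Rightarrow> complex) \<Rightarrow> bool" where
  "maximal_H1_solution Tstar u \<longleftrightarrow> 0 < Tstar \<and>
     (\<forall>T. 0 < T \<and> T < Tstar \<longrightarrow> H1_solution T u) \<and>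
     (\<forall>T w. H1_solution T w \<and> w 0 = u 0 \<longrightarrow> T \<le> Tstar)"

(* By the blow-up alternative of the local theory, the divergence of the norm of u_x is automatic
   once the maximal time is finite; it is stated here as part of the notion of blow-up. *)
definition blows_up_at :: "real \<Rightarrow> (real \<Rightarrow> real \<Rightarrow> complex) \<Rightarrow> bool" where
  "blows_up_at Tstar u \<longleftrightarrow>
     maximal_H1_solution Tstar u \<and>
     filterlim (\<lambda>t. L2_norm (weak_deriv (u t))) at_top (at_left Tstar)"

definition \<phi>\<^sub>0 :: "real \<Rightarrow> complex" where
  "\<phi>\<^sub>0 x = of_real (sqrt 2 * exp (- \<bar>x\<bar>))"

end

theory Submission
  imports Defs
begin

text \<open>
  Averaging the fundamental theorem of calculus for $|f|^2$ over $[-R,R]$ gives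
  $|f(0)|^2 \le m/(2R) + \sqrt{m}\,\|f_x\|$ with $m = \int_{-R}^{R} |f|^2$. For $f = \psi(t)$ and
  $R = \mu(t)/\|\psi_x(t)\|$, conservation of energy, $|\psi(0,t)|^4 = 2\|\psi_x(t)\|^2 - 4E$, turns this
  into $2 - 4E/\|\psi_x\|^2 \le (\sqrt m + m/(2\mu))^2$, so that $\liminf m \ge 2 = \|\varphi_0\|^2$.

  Energy conservation is derived at the given regularity as follows. The time integral
  $W(x) = \int_a^b \psi_x(x,t)\,dt$ satisfies $W' = -i(\psi(b)-\psi(a))$ off the origin and jumps by
  $-\int_a^b |\psi|^2\psi(0,t)\,dt$ at it. Pairing $W$ with $\psi_x(b)-\psi_x(a)$ and taking real parts gives
  an identity for the symmetric kernel $\mathrm{Re}\,\langle\psi_x(s),\psi_x(t)\rangle$. After subtracting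
  $\frac12|\psi(0,s)|^2|\psi(0,t)|^2$, the increments of this kernel are bounded by
  $\int |\psi(0,s)-\psi(0,t)|^2$ near the diagonal, which the $H^{3/4}$ norm of the trace makes
  negligible; hence the kernel is constant on the diagonal.
\<close>

subsection \<open>Smooth cut-off functions\<close>

text \<open>\<open>H1_solution\<close> contains no conservation law, and the formal proof, which
  pairs the equation with psi_t, is out of reach: psi_t is in general only in H^{-1}, and psi_x
  jumps at the origin. The finite difference phi = psi(b) - psi(a) therefore replaces psi_t; since
  W' = -i phi, the bulk term i|phi|^2 is purely imaginary and only the jump contributes to the real
  part. The factor 1/2 in the subtracted kernel comes from polarization. With h(t) = psi(0,t),
  Re(h(s) cnj(h(b) - h(a))) equals (|h(b)|^2 - |h(a)|^2)/2 plus (|h(s) - h(a)|^2 - |h(s) -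
  h(b)|^2)/2. Weighted by |h(s)|^2, the first part is an increment of that kernel and the second is
  quadratic in differences of the trace. Over squares of side \<epsilon> the second part adds up to
  O(\<epsilon>^(1 + 2k)) for a trace in H^k, against \<epsilon>^2 for the triangles: k = 3/4 gives
  5/2, and k = 1/2 would be the borderline. The threshold 2 is sharp for the trace inequality:
  \<open>\<phi>\<^sub>0\<close> gives equality in |f(0)|^2 <= ||f|| ||f_x||.\<close>

definition smooth :: "(real \<Rightarrow> real) \<Rightarrow> bool" where
  "smooth f \<longleftrightarrow> (\<forall>k x. (deriv ^^ k) f field_differentiable at x)"

lemma smooth_0: "smooth f \<Longrightarrow> f field_differentiable at x"
  unfolding smooth_def by (metis funpow_0)

lemma smooth_deriv: "smooth f \<Longrightarrow> smooth (deriv f)"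
  unfolding smooth_def by (metis comp_apply funpow_Suc_right)

lemma smooth_has_deriv: "smooth f \<Longrightarrow> (f has_real_derivative deriv f x) (at x)"
  using smooth_0 field_differentiable_derivI by blast

lemma smooth_continuous: "smooth f \<Longrightarrow> continuous_on A f"
  by (meson DERIV_isCont continuous_at_imp_continuous_on smooth_has_deriv)

text \<open>Iterates of \<open>deriv\<close> are awkward to compute directly; it is enough to
  exhibit a candidate \<open>D k\<close> for every order and to differentiate it once.\<close>

lemma smooth_sequence:
  assumes "D 0 = f" and "\<And>k x. (D k has_real_derivative D (Suc k) x) (at x)"
  shows "smooth f" and "(deriv ^^ k) f = D k"
proof -
  have *: "(deriv ^^ k) f = D k" for k
  proof (induction k)
    case 0 then show ?case using assms(1) by simp
  next
    case (Suc k)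
    then show ?case using DERIV_imp_deriv[OF assms(2)] by auto
  qed
  show "(deriv ^^ k) f = D k" by (fact *)
  show "smooth f" unfolding smooth_def * using assms(2) by (auto simp: field_differentiable_def)
qed

text \<open>Finite differentiability with existential derivatives. Products and inverses then need a
  single Leibniz or quotient rule per induction step, whereas iterated \<open>deriv\<close> would
  call for closed formulas of every order.\<close>

fun differentiable_upto :: "nat \<Rightarrow> (real \<Rightarrow> real) \<Rightarrow> bool" where
  "differentiable_upto 0 f = True"
| "differentiable_upto (Suc n) f =
     (\<exists>f'. (\<forall>x. (f has_real_derivative f' x) (at x)) \<and> differentiable_upto n f')"

lemma differentiable_upto_SucI:
  "(\<And>x. (f has_real_derivative f' x) (at x)) \<Longrightarrow> differentiable_upto n f' \<Longrightarrow>
   differentiable_upto (Suc n) f"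
  by auto

lemma differentiable_upto_Suc_imp:
  "differentiable_upto (Suc n) f \<Longrightarrow> differentiable_upto n f"
  by (induction n arbitrary: f) auto

lemma smooth_iff_differentiable_upto: "smooth f \<longleftrightarrow> (\<forall>n. differentiable_upto n f)"
proof
  have "smooth f \<Longrightarrow> differentiable_upto n f" for n f
  proof (induction n arbitrary: f)
    case (Suc n)
    then show ?case by (intro differentiable_upto_SucI[where f'="deriv f"] Suc smooth_deriv smooth_has_deriv)
  qed simp
  then show "smooth f \<Longrightarrow> \<forall>n. differentiable_upto n f" by blast
next
  have "differentiable_upto (Suc n) f \<Longrightarrow> (deriv ^^ n) f field_differentiable at x" for n x f
  proof (induction n arbitrary: f)
    case 0 then show ?case by (auto simp: field_differentiable_def)
  next
    case (Suc n)
    then obtain f' where f': "\<And>x. (f has_real_derivative f' x) (at x)"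
      "differentiable_upto (Suc n) f'"
      using differentiable_upto.simps(2) by blast
    then have "deriv f = f'" using DERIV_imp_deriv by blast
    then show ?case using Suc.IH[OF f'(2)] by (simp only: funpow_Suc_right comp_apply)
  qed
  then show "\<forall>n. differentiable_upto n f \<Longrightarrow> smooth f" unfolding smooth_def by blast
qed

lemma differentiable_upto_add:
  "differentiable_upto n f \<Longrightarrow> differentiable_upto n g \<Longrightarrow> differentiable_upto n (\<lambda>x. f x + g x)"
proof (induction n arbitrary: f g)
  case (Suc n)
  then obtain f' g' where "\<And>x. (f has_real_derivative f' x) (at x)" "differentiable_upto n f'"
     "\<And>x. (g has_real_derivative g' x) (at x)" "differentiable_upto n g'" by auto
  with Suc.IH show ?case
    by (auto intro!: exI[of _ "\<lambda>x. f' x + g' x"] DERIV_add)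
qed simp

lemma differentiable_upto_mult:
  "differentiable_upto n f \<Longrightarrow> differentiable_upto n g \<Longrightarrow> differentiable_upto n (\<lambda>x. f x * g x)"
proof (induction n arbitrary: f g)
  case (Suc n)
  then obtain f' g' where *: "\<And>x. (f has_real_derivative f' x) (at x)" "differentiable_upto n f'"
     "\<And>x. (g has_real_derivative g' x) (at x)" "differentiable_upto n g'" by auto
  \<comment> \<open>The Leibniz rule keeps one factor undifferentiated, so \<open>f\<close> and
    \<open>g\<close> themselves are also needed at the lower order.\<close>
  have "differentiable_upto n f" "differentiable_upto n g"
    using Suc.prems differentiable_upto_Suc_imp by auto
  then have "differentiable_upto n (\<lambda>x. f' x * g x + g' x * f x)"
    by (intro differentiable_upto_add Suc.IH *)
  then show ?case using *
    by (auto intro!: exI[of _ "\<lambda>x. f' x * g x + g' x * f x"] DERIV_mult)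
qed simp

lemma differentiable_upto_const: "differentiable_upto n (\<lambda>x. c)"
  by (induction n arbitrary: c) (auto intro!: exI[of _ "\<lambda>x. 0"])

text \<open>The derivative -f'/f^2 is the product of \<open>f'\<close> with two copies of the
  inverse itself, which the induction hypothesis already covers to order \<open>n\<close>.\<close>

lemma differentiable_upto_inverse:
  assumes "\<And>x. f x \<noteq> 0"
  shows "differentiable_upto n f \<Longrightarrow> differentiable_upto n (\<lambda>x. inverse (f x))"
proof (induction n)
  case (Suc n)
  then obtain f' where *: "\<And>x. (f has_real_derivative f' x) (at x)" "differentiable_upto n f'"
    by auto
  have i: "differentiable_upto n (\<lambda>x. inverse (f x))"
    using Suc differentiable_upto_Suc_imp by blast
  have "differentiable_upto n (\<lambda>x. (- 1) * (inverse (f x) * f' x * inverse (f x)))"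
    by (intro differentiable_upto_mult differentiable_upto_const i *)
  moreover have "((\<lambda>x. inverse (f x)) has_real_derivative (- 1) * (inverse (f x) * f' x * inverse (f x))) (at x)" for x
    using DERIV_inverse'[OF *(1) assms, of x] by simp
  ultimately show ?case by (intro differentiable_upto_SucI)
qed simp

lemma smooth_add: "smooth f \<Longrightarrow> smooth g \<Longrightarrow> smooth (\<lambda>x. f x + g x)"
  and smooth_mult: "smooth f \<Longrightarrow> smooth g \<Longrightarrow> smooth (\<lambda>x. f x * g x)"
  and smooth_const: "smooth (\<lambda>x. c)"
  and smooth_inverse: "(\<And>x. f x \<noteq> 0) \<Longrightarrow> smooth f \<Longrightarrow> smooth (\<lambda>x. inverse (f x))"
  by (simp_all add: smooth_iff_differentiable_upto differentiable_upto_add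
      differentiable_upto_mult differentiable_upto_const differentiable_upto_inverse)

lemma smooth_affine: 
  assumes "smooth f"
  shows "smooth (\<lambda>x. f (c * x + d))"
proof -
  have "differentiable_upto n f \<Longrightarrow> differentiable_upto n (\<lambda>x. f (c * x + d))" for n f
  proof (induction n arbitrary: f)
    case (Suc n)
    then obtain f' where *: "\<And>x. (f has_real_derivative f' x) (at x)" "differentiable_upto n f'"
      by auto
    have "differentiable_upto n (\<lambda>x. f' (c * x + d) * c)"
      by (intro differentiable_upto_mult differentiable_upto_const Suc.IH *)
    moreover have "((\<lambda>x. f (c * x + d)) has_real_derivative f' (c * x + d) * c) (at x)" for x
      by (rule DERIV_chain2[OF *(1)]) (auto intro!: derivative_eq_intros)
    ultimately show ?case by (intro differentiable_upto_SucI)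
  qed simp
  with assms show ?thesis by (simp add: smooth_iff_differentiable_upto)
qed

text \<open>P(1/x) exp(-1/x) on the positive axis, glued to 0. The polynomial parameter makes the
  family closed under differentiation; \<open>P = 1\<close> is the classical flat function.\<close>

definition flat_exp :: "real poly \<Rightarrow> real \<Rightarrow> real" where
  "flat_exp P x = (if x > 0 then poly P (1 / x) * exp (- (1 / x)) else 0)"

text \<open>The power \<open>k\<close> is carried along because the step from \<open>p\<close> to
  \<open>pCons a p\<close> raises it by one.\<close>

lemma poly_mult_exp_tendsto_0: "((\<lambda>y::real. y ^ k * poly P y * exp (- y)) \<longlongrightarrow> 0) at_top"
proof (induction P arbitrary: k)
  case (pCons a p)
  have "((\<lambda>y::real. a * (y ^ k / exp y) + y ^ Suc k * poly p y * exp (- y)) \<longlongrightarrow> a * 0 + 0) at_top"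
    by (intro tendsto_intros tendsto_power_div_exp_0 pCons)
  then show ?case by (simp add: algebra_simps exp_minus divide_inverse)
qed simp

text \<open>With y = 1/x one has dy/dx = -y^2, so P(y) exp(-y) has the x-derivative y^2 (P - P')(y)
  exp(-y); \<open>[:0, 0, 1:]\<close> is the monomial y^2. At 0 the exponential beats every
  polynomial.\<close>

lemma flat_exp_has_derivative:
  "(flat_exp P has_real_derivative flat_exp ([:0, 0, 1:] * (P - pderiv P)) x) (at x)"
proof -
  consider "x > 0" | "x < 0" | "x = 0" by linarith
  then show ?thesis
  proof cases
    case 1
    have "((\<lambda>x. poly P (1 / x) * exp (- (1 / x))) has_real_derivative
            flat_exp ([:0, 0, 1:] * (P - pderiv P)) x) (at x)"
      using 1 by (auto intro!: derivative_eq_intros poly_DERIV[THEN DERIV_chain2]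
          simp: flat_exp_def power2_eq_square field_simps)
    then show ?thesis
      by (rule has_field_derivative_transform_within_open[where S="{0<..}"])
         (use 1 in \<open>auto simp: flat_exp_def\<close>)
  next
    case 2
    have "((\<lambda>x. 0) has_real_derivative flat_exp ([:0, 0, 1:] * (P - pderiv P)) x) (at x)"
      using 2 by (auto simp: flat_exp_def)
    then show ?thesis
      by (rule has_field_derivative_transform_within_open[where S="{..<0}"])
         (use 2 in \<open>auto simp: flat_exp_def\<close>)
  next
    case 3
    have "((\<lambda>h. flat_exp P h / h) \<longlongrightarrow> 0) (at_right 0)"
    proof -
      \<comment> \<open>The difference quotient at 0 in the variable y = 1/h; division by
        \<open>h\<close> is the factor y^1.\<close>
      have "((\<lambda>h::real. inverse h ^ 1 * poly P (inverse h) * exp (- inverse h)) \<longlongrightarrow> 0) (at_right 0)"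
        by (rule filterlim_compose[OF poly_mult_exp_tendsto_0 filterlim_inverse_at_top_right])
      then show ?thesis
        by (rule Lim_transform_eventually)
           (auto simp: flat_exp_def divide_inverse eventually_at_right_field intro: exI[of _ 1])
    qed
    moreover have "((\<lambda>h. flat_exp P h / h) \<longlongrightarrow> 0) (at_left 0)"
      by (rule Lim_transform_eventually[OF tendsto_const])
         (auto simp: flat_exp_def eventually_at_left_field intro: exI[of _ "-1"])
    ultimately show ?thesis using 3
      by (simp add: DERIV_def filterlim_split_at flat_exp_def)
  qed
qed

lemma smooth_flat_exp: "smooth (flat_exp P)"
  by (rule smooth_sequence(1)[where D="\<lambda>k. flat_exp (((\<lambda>P. [:0, 0, 1:] * (P - pderiv P)) ^^ k) P)"])
     (use flat_exp_has_derivative in auto)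

text \<open>The standard transition from 0 on x <= 0 to 1 on x >= 1; x and 1 - x are never both
  nonpositive, which keeps the denominator positive.\<close>

definition smooth_step :: "real \<Rightarrow> real" where
  "smooth_step x = flat_exp 1 x * inverse (flat_exp 1 x + flat_exp 1 (1 - x))"

lemma smooth_step_denominator_pos: "flat_exp 1 x + flat_exp 1 (1 - x) > 0"
  by (auto simp: flat_exp_def add_pos_pos)

lemma smooth_smooth_step: "smooth smooth_step"
proof -
  have "smooth (\<lambda>x. flat_exp 1 (1 - x))"
    using smooth_affine[OF smooth_flat_exp, of 1 "-1" 1] by simp
  moreover have "flat_exp 1 x + flat_exp 1 (1 - x) \<noteq> 0" for x
    using smooth_step_denominator_pos[of x] by linarith
  ultimately have "smooth (\<lambda>x. flat_exp 1 x * inverse (flat_exp 1 x + flat_exp 1 (1 - x)))"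
    by (intro smooth_mult smooth_inverse smooth_add smooth_flat_exp)
  then show ?thesis by (simp add: smooth_step_def[abs_def])
qed

lemma smooth_step_eq_0: "x \<le> 0 \<Longrightarrow> smooth_step x = 0"
  and smooth_step_eq_1: "x \<ge> 1 \<Longrightarrow> smooth_step x = 1"
  and smooth_step_bounds: "0 \<le> smooth_step x" "smooth_step x \<le> 1"
  using smooth_step_denominator_pos[of x]
  by (auto simp: smooth_step_def flat_exp_def field_simps)

lemma deriv_smooth_step_eq_0:
  assumes "x < 0 \<or> x > 1" shows "deriv smooth_step x = 0"
proof -
  have "((\<lambda>x. if x < 0 then 0 else 1) has_real_derivative 0) (at x)"
  proof (cases "x < 0")
    case True
    show ?thesis
      by (rule has_field_derivative_transform_within_open[where f="\<lambda>x. 0" and S="{..<0}"])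
         (use True in auto)
  next
    case False
    show ?thesis
      by (rule has_field_derivative_transform_within_open[where f="\<lambda>x. 1" and S="{1<..}"])
         (use False assms in auto)
  qed
  then have "(smooth_step has_real_derivative 0) (at x)"
    by (rule has_field_derivative_transform_within_open[where S="{..<0} \<union> {1<..}"])
       (use assms in \<open>auto simp: smooth_step_eq_0 smooth_step_eq_1\<close>)
  then show ?thesis by (rule DERIV_imp_deriv)
qed

subsection \<open>Weak derivatives and absolutely continuous functions\<close>

lemma test_functionI:
  assumes "smooth \<zeta>" "\<And>x. x \<notin> {a..b} \<Longrightarrow> \<zeta> x = 0"
  shows "test_function \<zeta>"
  unfolding test_function_def
  using assms unfolding smooth_def by (metis compact_Icc)

lemma test_functionD: "test_function \<zeta> \<Longrightarrow> smooth \<zeta>"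
  by (simp add: test_function_def smooth_def)

text \<open>The derivative of the step lives on [0,1] and its mass is the height of the step, so
  that rescaled copies of it serve as mollifiers.\<close>

lemma integral_deriv_smooth_step:
  shows "integrable lborel (deriv smooth_step)" and "(LINT y|lborel. deriv smooth_step y) = 1"
proof -
  have "has_bochner_integral lborel (\<lambda>x. indicator {0..1} x *\<^sub>R deriv smooth_step x)
          (smooth_step 1 - smooth_step 0)"
    by (rule has_bochner_integral_FTC_Icc)
       (auto intro: has_vector_derivative_at_within has_field_derivative_at_within smooth_continuous smooth_deriv smooth_smooth_step
         smooth_has_deriv simp flip: has_real_derivative_iff_has_vector_derivative)
  moreover have "(\<lambda>x. indicator {0..1} x *\<^sub>R deriv smooth_step x) = deriv smooth_step"
    by (rule ext) (use deriv_smooth_step_eq_0 in \<open>force simp: indicator_def not_le\<close>)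
  ultimately have "has_bochner_integral lborel (deriv smooth_step) 1"
    by (simp add: smooth_step_eq_0 smooth_step_eq_1)
  then show "integrable lborel (deriv smooth_step)" "(LINT y|lborel. deriv smooth_step y) = 1"
    by (auto simp: has_bochner_integral_iff)
qed

text \<open>After the substitution x = c + \<epsilon> y the kernel is fixed and only the argument of
  \<open>A\<close> moves, so the bound on \<open>A\<close> supplies the dominating function.\<close>

lemma smooth_step_approximate_identity:
  fixes A :: "real \<Rightarrow> complex" and \<epsilon> :: "nat \<Rightarrow> real"
  assumes "continuous_on UNIV A" "\<And>x. norm (A x) \<le> M" "\<And>n. \<epsilon> n > 0" "\<epsilon> \<longlonglongrightarrow> 0"
  shows "integrable lborel (\<lambda>x. A x * of_real (deriv smooth_step ((x - c) / \<epsilon> n) / \<epsilon> n))"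
    and "(\<lambda>n. LINT x|lborel. A x * of_real (deriv smooth_step ((x - c) / \<epsilon> n) / \<epsilon> n)) \<longlonglongrightarrow> A c"
proof -
  note [measurable] = borel_measurable_continuous_onI[OF assms(1)]
     borel_measurable_continuous_onI[OF smooth_continuous[OF smooth_deriv[OF smooth_smooth_step]]]
  have dom: "integrable lborel (\<lambda>y. M * norm (deriv smooth_step y))"
    using integral_deriv_smooth_step by auto
  have i: "integrable lborel (\<lambda>y. A (c + \<epsilon> n * y) * of_real (deriv smooth_step y))" for n
    by (rule Bochner_Integration.integrable_bound[OF dom])
       (simp, rule AE_I2, simp add: norm_mult abs_mult mult_right_mono order_trans[OF assms(2) abs_ge_self])
  have eq: "(\<lambda>y. A (c + \<epsilon> n * y) * of_real (deriv smooth_step y)) =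
     (\<lambda>y. \<epsilon> n *\<^sub>R (A (c + \<epsilon> n * y) * of_real (deriv smooth_step ((c + \<epsilon> n * y - c) / \<epsilon> n) / \<epsilon> n)))" for n
    using assms(3)[of n] by (auto simp: scaleR_conv_of_real)
  show "integrable lborel (\<lambda>x. A x * of_real (deriv smooth_step ((x - c) / \<epsilon> n) / \<epsilon> n))"
  proof -
    have "integrable lborel (\<lambda>y. (A (c + \<epsilon> n * y) * of_real (deriv smooth_step ((c + \<epsilon> n * y - c) / \<epsilon> n) / \<epsilon> n)))"
      using integrable_divide[OF i[of n], of "of_real (\<epsilon> n)"] assms(3)[of n] by simp
    then show ?thesis
      using lborel_integrable_real_affine_iff[of "\<epsilon> n" "\<lambda>x. A x * of_real (deriv smooth_step ((x - c) / \<epsilon> n) / \<epsilon> n)" c]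
        assms(3)[of n] by simp
  qed
  have "(LINT x|lborel. A x * of_real (deriv smooth_step ((x - c) / \<epsilon> n) / \<epsilon> n)) =
     (LINT y|lborel. A (c + \<epsilon> n * y) * of_real (deriv smooth_step y))" for n
    by (subst lborel_integral_real_affine[of "\<epsilon> n" _ c])
       (use assms(3)[of n] in \<open>simp_all add: eq\<close>)
  moreover have "(\<lambda>n. LINT y|lborel. A (c + \<epsilon> n * y) * of_real (deriv smooth_step y)) \<longlonglongrightarrow>
     (LINT y|lborel. A c * of_real (deriv smooth_step y))"
  proof (rule integral_dominated_convergence[where w="\<lambda>y. M * norm (deriv smooth_step y)"])
    show "AE y in lborel. (\<lambda>n. A (c + \<epsilon> n * y) * of_real (deriv smooth_step y)) \<longlonglongrightarrow>
       A c * of_real (deriv smooth_step y)"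
    proof (rule AE_I2)
      fix y
      have "(\<lambda>n. c + \<epsilon> n * y) \<longlonglongrightarrow> c + 0 * y" by (intro tendsto_intros assms)
      then have "(\<lambda>n. A (c + \<epsilon> n * y)) \<longlonglongrightarrow> A c"
        using continuous_on_tendsto_compose[OF assms(1), of "\<lambda>n. c + \<epsilon> n * y" c sequentially] by simp
      then show "(\<lambda>n. A (c + \<epsilon> n * y) * of_real (deriv smooth_step y)) \<longlonglongrightarrow>
         A c * of_real (deriv smooth_step y)" by (intro tendsto_intros)
    qed
    show "AE y in lborel. norm (A (c + \<epsilon> n * y) * of_real (deriv smooth_step y)) \<le> M * norm (deriv smooth_step y)" for n
      by (rule AE_I2) (unfold norm_mult norm_of_real real_norm_def, intro mult_right_mono assms abs_ge_zero)
  qed (use dom in auto)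
  moreover have "(LINT y|lborel. A c * of_real (deriv smooth_step y)) = A c"
    by (simp add: integral_deriv_smooth_step)
  ultimately show "(\<lambda>n. LINT x|lborel. A x * of_real (deriv smooth_step ((x - c) / \<epsilon> n) / \<epsilon> n)) \<longlonglongrightarrow> A c"
    by (simp only:)
qed

text \<open>The lemma of du Bois-Reymond, proved by testing with smoothed indicator functions of $[a,b]$;
  the margin $d$ leaves room for smoothing at $b$.\<close>
lemma weak_derivative_imp_FTC:
  fixes A B :: "real \<Rightarrow> complex"
  assumes "a < b" "d > 0" "continuous_on {a..b + d} A" "set_integrable lborel {a..b + d} B"
    and weak: "\<And>\<zeta>. test_function \<zeta> \<Longrightarrow> (\<And>x. x \<notin> {a..b + d} \<Longrightarrow> \<zeta> x = 0) \<Longrightarrow>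
       (LINT x|lborel. A x * of_real (deriv \<zeta> x)) = - (LINT x|lborel. B x * of_real (\<zeta> x))"
  shows "(LINT x:{a..b}|lborel. B x) = A b - A a"
proof -
  \<comment> \<open>Constant extension of \<open>A\<close> beyond the interval: bounded and
    continuous on the whole line, as the approximate identity requires.\<close>
  define A' where "A' x = A (max a (min (b + d) x))" for x
  have contA: "continuous_on UNIV A'"
    unfolding A'_def using assms(1,2)
    by (intro continuous_on_compose2[OF assms(3)] continuous_intros) auto
  obtain M where M: "\<And>x. norm (A' x) \<le> M"
  proof -
    have "bounded (A ` {a..b + d})"
      using assms(3) compact_continuous_image compact_imp_bounded by blast
    then obtain M where "\<forall>x\<in>A ` {a..b + d}. norm x \<le> M" unfolding bounded_iff by blast
    then have "norm (A' x) \<le> M" for x using assms(1,2) by (simp add: A'_def)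
    then show thesis by (rule that)
  qed
  \<comment> \<open>Widths of at most \<open>d\<close>, so that the descent that starts at
    \<open>b\<close> ends before b + d.\<close>
  define \<epsilon> where "\<epsilon> n = d / real (Suc n)" for n
  have \<epsilon>: "\<epsilon> n > 0" "\<epsilon> n \<le> d" for n
    using assms(2) by (auto simp: \<epsilon>_def field_simps)
  have \<epsilon>0: "\<epsilon> \<longlonglongrightarrow> 0"
    unfolding \<epsilon>_def[abs_def] using tendsto_mult[OF tendsto_const[of d] LIMSEQ_inverse_real_of_nat]
    by (simp add: divide_inverse)
  \<comment> \<open>A plateau that rises on [a, a + \<epsilon>] and falls on [b, b + \<epsilon>].
    Its derivative is a difference of two mollifiers, its limit the indicator of [a,b].\<close>
  define \<zeta> where "\<zeta> n x = smooth_step ((x - a) / \<epsilon> n) - smooth_step ((x - b) / \<epsilon> n)" for n x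
  have sc: "smooth (\<lambda>x. smooth_step ((x - c) / \<epsilon> n))" for c n
    using smooth_affine[OF smooth_smooth_step, of "1 / \<epsilon> n" "- c / \<epsilon> n"]
    by (simp add: diff_divide_distrib)
  have "smooth (\<lambda>x. smooth_step ((x - a) / \<epsilon> n) + (-1) * smooth_step ((x - b) / \<epsilon> n))" for n
    by (intro smooth_add smooth_mult sc smooth_const)
  then have sm: "smooth (\<zeta> n)" for n by (simp add: \<zeta>_def[abs_def])
  have supp: "\<zeta> n x = 0" if "x \<notin> {a..b + d}" for n x
  proof (cases "x < a")
    case True
    then have "(x - a) / \<epsilon> n \<le> 0" "(x - b) / \<epsilon> n \<le> 0"
      using \<epsilon>(1)[of n] assms(1) by (auto simp: field_simps)
    then show ?thesis by (simp add: \<zeta>_def smooth_step_eq_0)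
  next
    case False
    then have "(x - a) / \<epsilon> n \<ge> 1" "(x - b) / \<epsilon> n \<ge> 1"
      using \<epsilon>(1)[of n] \<epsilon>(2)[of n] assms(1) that by (auto simp: field_simps)
    then show ?thesis by (simp add: \<zeta>_def smooth_step_eq_1)
  qed
  have tf: "test_function (\<zeta> n)" for n using test_functionI[OF sm supp] .
  have D: "deriv (\<zeta> n) x = deriv smooth_step ((x - a) / \<epsilon> n) / \<epsilon> n - deriv smooth_step ((x - b) / \<epsilon> n) / \<epsilon> n" for n x
  proof (rule DERIV_imp_deriv)
    have *: "((\<lambda>x. smooth_step ((x - c) / \<epsilon> n)) has_real_derivative deriv smooth_step ((x - c) / \<epsilon> n) * (1 / \<epsilon> n)) (at x)" for c
      by (rule DERIV_chain2[OF smooth_has_deriv[OF smooth_smooth_step]])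
         (auto intro!: derivative_eq_intros simp: divide_inverse)
    show "(\<zeta> n has_real_derivative deriv smooth_step ((x - a) / \<epsilon> n) / \<epsilon> n - deriv smooth_step ((x - b) / \<epsilon> n) / \<epsilon> n) (at x)"
      using DERIV_diff[OF *[of a] *[of b]] by (simp add: \<zeta>_def[abs_def])
  qed
  have AA': "A x * of_real (deriv (\<zeta> n) x) = A' x * of_real (deriv (\<zeta> n) x)" for n x
  proof (cases "x \<in> {a..b + d}")
    case True then show ?thesis by (simp add: A'_def)
  next
    case False
    have "deriv (\<zeta> n) x = 0"
      unfolding D using False \<epsilon>(1)[of n] \<epsilon>(2)[of n] assms(1)
      by (subst (1 2) deriv_smooth_step_eq_0) (auto simp: field_simps)
    then show ?thesis by simp
  qed
  note ai = smooth_step_approximate_identity[OF contA M \<epsilon>(1) \<epsilon>0]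
  have L1: "(\<lambda>n. LINT x|lborel. A x * of_real (deriv (\<zeta> n) x)) \<longlonglongrightarrow> A' a - A' b"
  proof -
    have "(LINT x|lborel. A x * of_real (deriv (\<zeta> n) x)) =
       (LINT x|lborel. A' x * of_real (deriv smooth_step ((x - a) / \<epsilon> n) / \<epsilon> n)) -
       (LINT x|lborel. A' x * of_real (deriv smooth_step ((x - b) / \<epsilon> n) / \<epsilon> n))" for n
    proof -
      have "(\<lambda>x. A x * of_real (deriv (\<zeta> n) x)) =
          (\<lambda>x. A' x * of_real (deriv smooth_step ((x - a) / \<epsilon> n) / \<epsilon> n) -
               A' x * of_real (deriv smooth_step ((x - b) / \<epsilon> n) / \<epsilon> n))"
        by (rule ext, subst AA', subst D) (simp only: of_real_diff right_diff_distrib)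
      then show ?thesis
        by (simp only: Bochner_Integration.integral_diff[OF ai(1) ai(1)])
    qed
    then show ?thesis by (simp only:) (intro tendsto_diff ai)
  qed
  define B' where "B' x = indicator {a..b + d} x *\<^sub>R B x" for x
  have B': "integrable lborel B'" using assms(4) by (simp add: set_integrable_def B'_def[abs_def])
  then have [measurable]: "B' \<in> borel_measurable lborel" by auto
  have bd: "\<bar>\<zeta> n x\<bar> \<le> 1" for n x
    using smooth_step_bounds[of "(x - a) / \<epsilon> n"] smooth_step_bounds[of "(x - b) / \<epsilon> n"]
    by (simp add: \<zeta>_def abs_le_iff)
  have [measurable]: "\<zeta> n \<in> borel_measurable borel" for n
    by (rule borel_measurable_continuous_onI[OF smooth_continuous[OF sm]])
  have L2: "(\<lambda>n. LINT x|lborel. B' x * of_real (\<zeta> n x)) \<longlonglongrightarrow> (LINT x|lborel. B' x * of_real (indicator {a..b} x))"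
  proof (rule integral_dominated_convergence[where w="\<lambda>x. norm (B' x)"])
    \<comment> \<open>The endpoints are left out as null; at \<open>a\<close>, for instance, the
      limit of the plateau is 0 while the indicator is 1.\<close>
    show "AE x in lborel. (\<lambda>n. B' x * of_real (\<zeta> n x)) \<longlonglongrightarrow> B' x * of_real (indicator {a..b} x)"
      using AE_lborel_singleton[of a] AE_lborel_singleton[of b]
    proof eventually_elim
      case (elim x)
      have lim: "(\<lambda>n. smooth_step ((x - c) / \<epsilon> n)) \<longlonglongrightarrow> (if x < c then 0 else 1)" if "x \<noteq> c" for c
      proof (cases "x < c")
        case True
        then have "smooth_step ((x - c) / \<epsilon> n) = 0" for n
          using \<epsilon>(1)[of n] by (intro smooth_step_eq_0) (auto simp: field_simps)
        then show ?thesis using True by simp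
      next
        case False
        then have "eventually (\<lambda>n. \<epsilon> n < x - c) sequentially"
          using that order_tendstoD(2)[OF \<epsilon>0, of "x - c"] by auto
        then have "eventually (\<lambda>n. smooth_step ((x - c) / \<epsilon> n) = 1) sequentially"
        proof eventually_elim
          case (elim n)
          then show ?case using \<epsilon>(1)[of n] by (intro smooth_step_eq_1) (auto simp: field_simps)
        qed
        then show ?thesis using False by (simp add: tendsto_eventually)
      qed
      have "(\<lambda>n. \<zeta> n x) \<longlonglongrightarrow> (if x < a then 0 else 1) - (if x < b then 0 else 1)"
        unfolding \<zeta>_def by (intro tendsto_diff lim elim)
      moreover have "(if x < a then 0 else 1) - (if x < b then 0 else 1) = (indicator {a..b} x :: real)"
        using elim assms(1) by (auto simp: indicator_def)
      ultimately show ?case by (intro tendsto_intros) simp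
    qed
  qed (use B' bd in \<open>auto simp: norm_mult intro!: mult_left_le\<close>)
  have "(LINT x|lborel. B x * of_real (\<zeta> n x)) = (LINT x|lborel. B' x * of_real (\<zeta> n x))" for n
    by (intro Bochner_Integration.integral_cong refl) (use supp[of _ n] in \<open>auto simp: B'_def indicator_def\<close>)
  then have "(\<lambda>n. LINT x|lborel. A x * of_real (deriv (\<zeta> n) x)) \<longlonglongrightarrow> - (LINT x|lborel. B' x * of_real (indicator {a..b} x))"
    using weak[OF tf supp] tendsto_minus[OF L2] by simp
  from LIMSEQ_unique[OF this L1] have "(LINT x|lborel. B' x * of_real (indicator {a..b} x)) = A' b - A' a"
    by (simp add: algebra_simps)
  moreover have "(LINT x|lborel. B' x * of_real (indicator {a..b} x)) = (LINT x:{a..b}|lborel. B x)"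
    unfolding set_lebesgue_integral_def using assms(2)
    by (intro Bochner_Integration.integral_cong refl) (auto simp: B'_def indicator_def)
  moreover have "A' b = A b" "A' a = A a" using assms(1,2) by (auto simp: A'_def)
  ultimately show ?thesis by simp
qed

text \<open>The positive and negative parts of \<open>k\<close> are densities of two finite
  measures. These agree on all rays \<open>{c<..}\<close>, hence are equal, and uniqueness of
  densities makes the two parts equal almost everywhere.\<close>

lemma AE_eq_0_if_interval_integrals_0_real:
  fixes k :: "real \<Rightarrow> real"
  assumes k: "integrable lborel k" and 0: "\<And>a b. a < b \<Longrightarrow> (LINT x:{a..b}|lborel. k x) = 0"
  shows "AE x in lborel. k x = 0"
proof -
  note [measurable] = borel_measurable_integrable[OF k]
  have si: "set_integrable lborel A k" if "A \<in> sets borel" for A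
    unfolding set_integrable_def using k that by (intro integrable_mult_indicator) auto
  \<comment> \<open>Rays are reached as limits of intervals because \<open>k\<close> is
    integrable.\<close>
  have tail: "(LINT x:{c..}|lborel. k x) = 0" for c
  proof -
    have "((\<lambda>b. LINT x:{c..b}|lborel. k x) \<longlongrightarrow> (LINT x:{c..}|lborel. k x)) at_top"
      by (rule tendsto_set_lebesgue_integral_at_top) (auto intro: si)
    moreover have "((\<lambda>b. LINT x:{c..b}|lborel. k x) \<longlongrightarrow> 0) at_top"
      by (rule tendsto_eventually) (use 0 in \<open>auto simp: eventually_at_top_dense\<close>)
    ultimately show ?thesis using LIM_unique trivial_limit_at_top_linorder by (metis tendsto_unique)
  qed
  have kp: "integrable lborel (\<lambda>x. max 0 (k x) * indicator A x)"
    and km: "integrable lborel (\<lambda>x. max 0 (- k x) * indicator A x)" if [measurable]: "A \<in> sets borel" for A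
    by (rule Bochner_Integration.integrable_bound[OF k], simp, auto simp: indicator_def)+
  have em: "emeasure (density lborel (\<lambda>x. ennreal (max 0 (k x)))) {c<..} = ennreal (LINT x|lborel. max 0 (k x) * indicator {c<..} x)"
    "emeasure (density lborel (\<lambda>x. ennreal (max 0 (- k x)))) {c<..} = ennreal (LINT x|lborel. max 0 (- k x) * indicator {c<..} x)" for c
    by (subst emeasure_density, simp, simp, subst nn_integral_eq_integral[symmetric],
        use kp[of "{c<..}"] km[of "{c<..}"] in \<open>auto intro!: nn_integral_cong simp: indicator_def\<close>)+
  have "(LINT x|lborel. max 0 (k x) * indicator {c<..} x) = (LINT x|lborel. max 0 (- k x) * indicator {c<..} x)" for c
  proof -
    have "(LINT x|lborel. max 0 (k x) * indicator {c<..} x) - (LINT x|lborel. max 0 (- k x) * indicator {c<..} x)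
        = (LINT x|lborel. max 0 (k x) * indicator {c<..} x - max 0 (- k x) * indicator {c<..} x)"
      by (subst Bochner_Integration.integral_diff) (auto intro: kp km)
    also have "\<dots> = (LINT x:{c..}|lborel. k x)"
      unfolding set_lebesgue_integral_def
      by (rule integral_cong_AE, simp, simp) (use AE_lborel_singleton[of c] in \<open>eventually_elim, auto simp: indicator_def\<close>)
    finally show ?thesis using tail by simp
  qed
  then have "density lborel (\<lambda>x. ennreal (max 0 (k x))) = density lborel (\<lambda>x. ennreal (max 0 (- k x)))"
    by (intro measure_eqI_lessThan) (simp_all add: em)
  then have "AE x in lborel. ennreal (max 0 (k x)) = ennreal (max 0 (- k x))"
    by (intro sigma_finite_measure.density_unique[OF sigma_finite_lborel]) auto
  then show ?thesis
    by eventually_elim (auto simp: max_def split: if_splits)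
qed

text \<open>Reduction to the integrable real case: truncation to [-n,n], real and imaginary parts
  separately, then a countable union of null sets.\<close>

lemma AE_eq_0_if_interval_integrals_0:
  fixes k :: "real \<Rightarrow> complex"
  assumes k: "\<And>a b. set_integrable lborel {a..b} k"
    and 0: "\<And>a b. a < b \<Longrightarrow> (LINT x:{a..b}|lborel. k x) = 0"
  shows "AE x in lborel. k x = 0"
proof -
  have "AE x in lborel. indicator {- real n..real n} x *\<^sub>R k x = 0" for n
  proof -
    let ?k = "\<lambda>x. indicator {- real n..real n} x *\<^sub>R k x"
    have i: "integrable lborel ?k" using k by (simp add: set_integrable_def)
    have z: "(LINT x:{a..b}|lborel. ?k x) = 0" for a b
    proof -
      have "(LINT x:{a..b}|lborel. ?k x) = (LINT x:{max a (- real n)..min b (real n)}|lborel. k x)"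
        unfolding set_lebesgue_integral_def by (intro Bochner_Integration.integral_cong) (auto simp: indicator_def)
      also have "\<dots> = 0"
      proof (cases "max a (- real n) < min b (real n)")
        case False
        have "AE x in lborel. indicator {max a (- real n)..min b (real n)} x *\<^sub>R k x = 0"
          using AE_lborel_singleton[of "max a (- real n)"]
        proof eventually_elim
          case (elim x)
          then have "x \<notin> {max a (- real n)..min b (real n)}" using False unfolding atLeastAtMost_iff by linarith
          then show ?case by simp
        qed
        then show ?thesis unfolding set_lebesgue_integral_def by (rule integral_eq_zero_AE)
      qed (rule 0)
      finally show ?thesis .
    qed
    have "set_integrable lborel {a..b} ?k" for a b
      unfolding set_integrable_def by (rule integrable_mult_indicator[OF _ i]) simp
    note z' = this[unfolded set_integrable_def] z[unfolded set_lebesgue_integral_def]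
    have "AE x in lborel. Re (?k x) = 0"
      using integral_Re[OF z'(1)] z'(2)
      by (intro AE_eq_0_if_interval_integrals_0_real integrable_Re i) (simp add: set_lebesgue_integral_def mult.assoc)
    moreover have "AE x in lborel. Im (?k x) = 0"
      using integral_Im[OF z'(1)] z'(2)
      by (intro AE_eq_0_if_interval_integrals_0_real integrable_Im i) (simp add: set_lebesgue_integral_def mult.assoc)
    ultimately show ?thesis by eventually_elim (simp add: complex_eq_iff)
  qed
  then have "AE x in lborel. \<forall>n. indicator {- real n..real n} x *\<^sub>R k x = 0"
    by (subst AE_all_countable) auto
  then show ?thesis
  proof eventually_elim
    case (elim x)
    obtain n where "\<bar>x\<bar> \<le> real n" using real_arch_simple by blast
    then show ?case using elim[rule_format, of n] by (auto simp: abs_le_iff indicator_def)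
  qed
qed

text \<open>\<open>F\<close> and \<open>G\<close> are known only as indefinite integrals, so no
  pointwise product rule is at hand. Instead f(x) g(y) is integrated over the square by Fubini and
  split along the diagonal: the two triangles give the two integrals on the left, up to boundary
  values.\<close>

lemma integral_by_parts_lborel:
  fixes F G f g :: "real \<Rightarrow> complex"
  assumes ab: "a \<le> b" and f: "set_integrable lborel {a..b} f" and g: "set_integrable lborel {a..b} g"
    and F: "\<And>x. x \<in> {a..b} \<Longrightarrow> F x = F a + (LINT y:{a..x}|lborel. f y)"
    and G: "\<And>x. x \<in> {a..b} \<Longrightarrow> G x = G a + (LINT y:{a..x}|lborel. g y)"
  shows "set_integrable lborel {a..b} (\<lambda>x. f x * G x)" "set_integrable lborel {a..b} (\<lambda>x. F x * g x)"
    "(LINT x:{a..b}|lborel. f x * G x) + (LINT x:{a..b}|lborel. F x * g x) = F b * G b - F a * G a"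
proof -
  define f' where "f' x = indicator {a..b} x *\<^sub>R f x" for x
  define g' where "g' x = indicator {a..b} x *\<^sub>R g x" for x
  have f'i: "integrable lborel f'" and g'i: "integrable lborel g'"
    using f g by (simp_all add: set_integrable_def f'_def[abs_def] g'_def[abs_def])
  note [measurable] = borel_measurable_integrable[OF f'i] borel_measurable_integrable[OF g'i]
  have prod: "integrable (lborel \<Otimes>\<^sub>M lborel) (\<lambda>(x, y). f' x * g' y)"
  proof (rule lborel_pair.Fubini_integrable)
    show "integrable lborel (\<lambda>x. LINT y|lborel. norm (case (x, y) of (x, y) \<Rightarrow> f' x * g' y))"
      using f'i by (simp add: norm_mult)
    show "AE x in lborel. integrable lborel (\<lambda>y. case (x, y) of (x, y) \<Rightarrow> f' x * g' y)"
      using g'i by simp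
  qed simp
  have prodA: "integrable (lborel \<Otimes>\<^sub>M lborel) (\<lambda>(x, y). indicator {(x, y). y \<le> x} (x, y) *\<^sub>R (f' x * g' y))"
    and prodB: "integrable (lborel \<Otimes>\<^sub>M lborel) (\<lambda>(x, y). indicator {(x, y). x \<le> y} (x, y) *\<^sub>R (f' x * g' y))"
    by (rule Bochner_Integration.integrable_bound[OF prod], measurable, auto simp: indicator_def norm_mult)+
  \<comment> \<open>Integrating out y over the triangle leaves the increment of \<open>G\<close>
    from \<open>a\<close> to x.\<close>
  have Gx: "(LINT y|lborel. indicator {(x, y). y \<le> x} (x, y) *\<^sub>R (f' x * g' y)) = indicator {a..b} x *\<^sub>R (f x * (G x - G a))" for x
  proof (cases "x \<in> {a..b}")
    case True
    have "(LINT y|lborel. indicator {(x, y). y \<le> x} (x, y) *\<^sub>R (f' x * g' y)) = (LINT y|lborel. f x * (indicator {a..x} y *\<^sub>R g y))"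
      using True by (intro Bochner_Integration.integral_cong) (auto simp: f'_def g'_def indicator_def)
    also have "\<dots> = f x * (G x - G a)"
      unfolding integral_mult_right_zero using G[OF True] by (simp add: set_lebesgue_integral_def)
    finally show ?thesis using True by simp
  qed (simp add: f'_def)
  have Fy: "(LINT x|lborel. indicator {(x, y). x \<le> y} (x, y) *\<^sub>R (f' x * g' y)) = indicator {a..b} y *\<^sub>R ((F y - F a) * g y)" for y
  proof (cases "y \<in> {a..b}")
    case True
    have "(LINT x|lborel. indicator {(x, y). x \<le> y} (x, y) *\<^sub>R (f' x * g' y)) = (LINT x|lborel. (indicator {a..y} x *\<^sub>R f x) * g y)"
      using True by (intro Bochner_Integration.integral_cong) (auto simp: f'_def g'_def indicator_def)
    also have "\<dots> = (F y - F a) * g y"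
      unfolding integral_mult_left_zero using F[OF True] by (simp add: set_lebesgue_integral_def)
    finally show ?thesis using True by simp
  qed (simp add: g'_def)
  have iG: "integrable lborel (\<lambda>x. indicator {a..b} x *\<^sub>R (f x * (G x - G a)))"
    using lborel_pair.integrable_fst'[OF prodA] by (simp add: Gx)
  have iF: "integrable lborel (\<lambda>y. indicator {a..b} y *\<^sub>R ((F y - F a) * g y))"
    using lborel_pair.integrable_snd[OF prodB] by (simp add: Fy)
  have cG: "integrable lborel (\<lambda>x. f' x * G a)" and cF: "integrable lborel (\<lambda>x. F a * g' x)"
    using f'i g'i by auto
  have eG: "(\<lambda>x. indicator {a..b} x *\<^sub>R (f x * G x)) = (\<lambda>x. indicator {a..b} x *\<^sub>R (f x * (G x - G a)) + f' x * G a)"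
    and eF: "(\<lambda>x. indicator {a..b} x *\<^sub>R (F x * g x)) = (\<lambda>x. indicator {a..b} x *\<^sub>R ((F x - F a) * g x) + F a * g' x)"
    by (auto simp: f'_def g'_def indicator_def algebra_simps)
  show "set_integrable lborel {a..b} (\<lambda>x. f x * G x)" "set_integrable lborel {a..b} (\<lambda>x. F x * g x)"
    unfolding set_integrable_def eG eF using iG iF cG cF by auto
  have 1: "(LINT x:{a..b}|lborel. f x * G x) = (LINT x|lborel. indicator {a..b} x *\<^sub>R (f x * (G x - G a))) + (LINT x|lborel. f' x) * G a"
    unfolding set_lebesgue_integral_def eG by (subst Bochner_Integration.integral_add[OF iG cG]) simp
  have 2: "(LINT x:{a..b}|lborel. F x * g x) = (LINT x|lborel. indicator {a..b} x *\<^sub>R ((F x - F a) * g x)) + F a * (LINT x|lborel. g' x)"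
    unfolding set_lebesgue_integral_def eF by (subst Bochner_Integration.integral_add[OF iF cF]) simp
  have f'I: "(LINT x|lborel. f' x) = F b - F a" and g'I: "(LINT x|lborel. g' x) = G b - G a"
    using F[of b] G[of b] ab by (simp_all add: f'_def[abs_def] g'_def[abs_def] set_lebesgue_integral_def)
  have "(LINT x|lborel. indicator {a..b} x *\<^sub>R (f x * (G x - G a))) = (LINT p|(lborel \<Otimes>\<^sub>M lborel). (\<lambda>(x, y). indicator {(x, y). y \<le> x} (x, y) *\<^sub>R (f' x * g' y)) p)"
    using lborel_pair.integral_fst'[OF prodA] by (simp add: Gx)
  moreover have "(LINT x|lborel. indicator {a..b} x *\<^sub>R ((F x - F a) * g x)) = (LINT p|(lborel \<Otimes>\<^sub>M lborel). (\<lambda>(x, y). indicator {(x, y). x \<le> y} (x, y) *\<^sub>R (f' x * g' y)) p)"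
    using lborel_pair.integral_snd[OF prodB] by (simp add: Fy)
  ultimately have "(LINT x|lborel. indicator {a..b} x *\<^sub>R (f x * (G x - G a))) + (LINT x|lborel. indicator {a..b} x *\<^sub>R ((F x - F a) * g x)) =
    (LINT p|(lborel \<Otimes>\<^sub>M lborel). (\<lambda>(x, y). indicator {(x, y). y \<le> x} (x, y) *\<^sub>R (f' x * g' y)) p + (\<lambda>(x, y). indicator {(x, y). x \<le> y} (x, y) *\<^sub>R (f' x * g' y)) p)"
    using Bochner_Integration.integral_add[OF prodA prodB] by simp
  also have "\<dots> = (LINT p|(lborel \<Otimes>\<^sub>M lborel). (\<lambda>(x, y). f' x * g' y) p)"
  proof (rule integral_cong_AE)
    \<comment> \<open>The two closed triangles overlap exactly in the diagonal, a null set.\<close>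
    have "AE x in lborel. AE y in lborel. x \<noteq> (y::real)"
    proof (rule AE_I2)
      show "AE y in lborel. x \<noteq> y" for x :: real
        using AE_lborel_singleton[of x] by eventually_elim auto
    qed
    then have "AE p in lborel \<Otimes>\<^sub>M lborel. (\<lambda>(x, y). x \<noteq> (y::real)) p"
    proof (intro lborel_pair.AE_pair_measure)
      show "{p \<in> space (lborel \<Otimes>\<^sub>M lborel). (\<lambda>(x, y). x \<noteq> (y::real)) p} \<in> sets (lborel \<Otimes>\<^sub>M lborel)"
        unfolding split_beta' by measurable
    qed auto
    then show "AE p in lborel \<Otimes>\<^sub>M lborel. (\<lambda>(x, y). indicator {(x, y). y \<le> x} (x, y) *\<^sub>R (f' x * g' y)) p + (\<lambda>(x, y). indicator {(x, y). x \<le> y} (x, y) *\<^sub>R (f' x * g' y)) p = (\<lambda>(x, y). f' x * g' y) p"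
      by eventually_elim (auto simp: indicator_def)
  qed (use prodA prodB prod in auto)
  also have "\<dots> = (LINT x|lborel. LINT y|lborel. f' x * g' y)"
    using lborel_pair.integral_fst'[OF prod] by simp
  also have "\<dots> = (F b - F a) * (G b - G a)"
    by (simp add: f'I g'I)
  finally show "(LINT x:{a..b}|lborel. f x * G x) + (LINT x:{a..b}|lborel. F x * g x) = F b * G b - F a * G a"
    unfolding 1 2 f'I g'I by (simp add: algebra_simps)
qed

subsection \<open>The spaces $L^2$ and $H^1$\<close>

text \<open>Taking the real part makes the product symmetric, which the kernel argument for the
  energy depends on.\<close>

definition L2_inner :: "(real \<Rightarrow> complex) \<Rightarrow> (real \<Rightarrow> complex) \<Rightarrow> real" where
  "L2_inner f g = (LINT x|lborel. Re (f x * cnj (g x)))"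

lemma L2_measurable: "L2 f \<Longrightarrow> f \<in> borel_measurable borel"
  by (simp add: L2_def)

lemma L2_square_integrable: "L2 f \<Longrightarrow> integrable lborel (\<lambda>x. (norm (f x))\<^sup>2)"
  by (simp add: L2_def)

lemma L2_norm_nonneg: "L2_norm f \<ge> 0"
  by (simp add: L2_norm_def)

lemma L2_norm_power2: "(L2_norm f)\<^sup>2 = (LINT x|lborel. (norm (f x))\<^sup>2)"
  by (simp add: L2_norm_def)

lemma L2_norm_cong_AE:
  assumes "f \<in> borel_measurable borel" "g \<in> borel_measurable borel" "AE x in lborel. f x = g x"
  shows "L2_norm f = L2_norm g"
  unfolding L2_norm_def using assms by (intro arg_cong[where f=sqrt] integral_cong_AE) auto

lemma L2_norm_mult_integrable:
  assumes "L2 f" "L2 g"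
  shows "integrable lborel (\<lambda>x. norm (f x) * norm (g x))"
proof -
  note [measurable] = assms[THEN L2_measurable]
  have "integrable lborel (\<lambda>x. (norm (f x))\<^sup>2 + (norm (g x))\<^sup>2)"
    using assms[THEN L2_square_integrable] by simp
  then show ?thesis
  proof (rule Bochner_Integration.integrable_bound)
    show "AE x in lborel. norm (norm (f x) * norm (g x)) \<le> norm ((norm (f x))\<^sup>2 + (norm (g x))\<^sup>2)"
    proof (rule AE_I2)
      fix x
      have "norm (f x) * norm (g x) \<ge> 0" by simp
      then have "norm (f x) * norm (g x) \<le> (norm (f x))\<^sup>2 + (norm (g x))\<^sup>2"
        using sum_squares_bound[of "norm (f x)" "norm (g x)"] by linarith
      then show "norm (norm (f x) * norm (g x)) \<le> norm ((norm (f x))\<^sup>2 + (norm (g x))\<^sup>2)" by simp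
    qed
  qed simp
qed

lemma borel_measurable_cnj [measurable (raw)]:
  "f \<in> borel_measurable M \<Longrightarrow> (\<lambda>x. cnj (f x)) \<in> borel_measurable M"
  by (rule measurable_compose[OF _ borel_measurable_continuous_onI]) (auto intro: continuous_intros)

lemma L2_mult_integrable:
  assumes "L2 f" "L2 g"
  shows "integrable lborel (\<lambda>x. f x * g x)" "integrable lborel (\<lambda>x. f x * cnj (g x))"
  using assms[THEN L2_measurable]
  by (auto intro!: Bochner_Integration.integrable_bound[OF L2_norm_mult_integrable[OF assms]] simp: norm_mult)

lemma L2_Cauchy_Schwarz:
  assumes "L2 f" "L2 g"
  shows "(LINT x|lborel. norm (f x) * norm (g x)) \<le> L2_norm f * L2_norm g"
proof -
  note [measurable] = assms[THEN L2_measurable]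
  let ?I = "LINT x|lborel. norm (f x) * norm (g x)"
  have eq: "(\<integral>\<^sup>+x. ennreal (norm (f x)) * ennreal (norm (g x)) \<partial>lborel) = ennreal ?I"
    using nn_integral_eq_integral[OF L2_norm_mult_integrable[OF assms]] by (simp add: ennreal_mult)
  have sq: "(\<integral>\<^sup>+x. (ennreal (norm (h x)))\<^sup>2 \<partial>lborel) = ennreal ((L2_norm h)\<^sup>2)" if "L2 h" for h
    using nn_integral_eq_integral[OF L2_square_integrable[OF that]]
    by (simp add: ennreal_power L2_norm_power2)
  have I0: "?I \<ge> 0" by simp
  have "ennreal (?I\<^sup>2) \<le> ennreal ((L2_norm f)\<^sup>2 * (L2_norm g)\<^sup>2)"
    using Cauchy_Schwarz_nn_integral[of "\<lambda>x. ennreal (norm (f x))" lborel "\<lambda>x. ennreal (norm (g x))"]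
    unfolding eq sq[OF assms(1)] sq[OF assms(2)] ennreal_power[OF I0] by (simp add: ennreal_mult)
  then have "?I\<^sup>2 \<le> (L2_norm f * L2_norm g)\<^sup>2" by (simp add: power_mult_distrib)
  then show ?thesis using power2_le_imp_le L2_norm_nonneg by (metis mult_nonneg_nonneg)
qed

lemma L2_inner_integrable:
  assumes "L2 f" "L2 g" shows "integrable lborel (\<lambda>x. Re (f x * cnj (g x)))"
  by (rule integrable_Re[OF L2_mult_integrable(2)[OF assms]])

lemma L2_inner_bound:
  assumes "L2 f" "L2 g"
  shows "\<bar>L2_inner f g\<bar> \<le> L2_norm f * L2_norm g"
proof -
  have "\<bar>L2_inner f g\<bar> \<le> (LINT x|lborel. \<bar>Re (f x * cnj (g x))\<bar>)"
    unfolding L2_inner_def using integral_norm_bound[of lborel "\<lambda>x. Re (f x * cnj (g x))"] by simp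
  also have "\<dots> \<le> (LINT x|lborel. norm (f x) * norm (g x))"
  proof (rule integral_mono[OF _ L2_norm_mult_integrable[OF assms]])
    show "integrable lborel (\<lambda>x. \<bar>Re (f x * cnj (g x))\<bar>)"
      using L2_inner_integrable[OF assms] by (rule integrable_abs)
    show "\<bar>Re (f x * cnj (g x))\<bar> \<le> norm (f x) * norm (g x)" for x
      using abs_Re_le_cmod[of "f x * cnj (g x)"] by (simp only: norm_mult complex_mod_cnj)
  qed
  finally show ?thesis using L2_Cauchy_Schwarz[OF assms] by simp
qed

lemma L2_inner_commute: "L2_inner f g = L2_inner g f"
  unfolding L2_inner_def by (intro Bochner_Integration.integral_cong) (auto simp: mult.commute)

lemma L2_inner_self: "L2_inner f f = (L2_norm f)\<^sup>2"
  unfolding L2_inner_def L2_norm_power2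
  by (intro Bochner_Integration.integral_cong) (auto simp: cmod_power2 simp flip: power2_eq_square)

lemma L2_diff:
  assumes "L2 f" "L2 g" shows "L2 (\<lambda>x. f x - g x)"
proof -
  note [measurable] = assms[THEN L2_measurable]
  have "integrable lborel (\<lambda>x. (norm (f x - g x))\<^sup>2)"
  proof (rule Bochner_Integration.integrable_bound)
    show "integrable lborel (\<lambda>x. 2 * (norm (f x))\<^sup>2 + 2 * (norm (g x))\<^sup>2)"
      using assms[THEN L2_square_integrable] by simp
    have "(norm (f x - g x))\<^sup>2 \<le> 2 * (norm (f x))\<^sup>2 + 2 * (norm (g x))\<^sup>2" for x
    proof -
      have "(norm (f x - g x))\<^sup>2 \<le> (norm (f x) + norm (g x))\<^sup>2" 
        by (intro power_mono norm_triangle_ineq4) simp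
      also have "\<dots> \<le> 2 * (norm (f x))\<^sup>2 + 2 * (norm (g x))\<^sup>2"
        using sum_squares_bound[of "norm (f x)" "norm (g x)"] by (simp add: power2_sum)
      finally show ?thesis .
    qed
    then show "AE x in lborel. norm ((norm (f x - g x))\<^sup>2) \<le> norm (2 * (norm (f x))\<^sup>2 + 2 * (norm (g x))\<^sup>2)"
      by (intro AE_I2) (simp add: order_trans[OF _ abs_ge_self])
  qed simp
  then show ?thesis by (simp add: L2_def)
qed

lemma L2_inner_diff_left:
  assumes "L2 f" "L2 g" "L2 h"
  shows "L2_inner (\<lambda>x. f x - g x) h = L2_inner f h - L2_inner g h"
  unfolding L2_inner_def
  using Bochner_Integration.integral_diff[OF L2_inner_integrable[OF assms(1,3)] L2_inner_integrable[OF assms(2,3)]]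
  by (simp add: algebra_simps)

lemma L2_set_integrable:
  assumes "L2 f" shows "set_integrable lborel {a..b} f"
proof -
  note [measurable] = L2_measurable[OF assms]
  have "L2 (indicator {a..b} :: real \<Rightarrow> complex)"
  proof -
    have "(\<lambda>x. (norm (indicator {a..b} x :: complex))\<^sup>2) = (indicator {a..b} :: real \<Rightarrow> real)"
      by (auto simp: indicator_def)
    then show ?thesis unfolding L2_def by (auto intro!: integrable_real_indicator simp: emeasure_lborel_Icc_eq)
  qed
  from L2_mult_integrable(1)[OF this assms] show ?thesis
    unfolding set_integrable_def
    by (rule Bochner_Integration.integrable_cong[THEN iffD1, rotated 2]) (auto simp: indicator_def)
qed

section \<open>Local integrability and weak derivatives of \<open>H1\<close> functions\<close>

lemma locally_integrable_intervalD: "locally_integrable f \<Longrightarrow> set_integrable lborel {a..b} f"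
  by (simp add: locally_integrable_def)

lemma locally_integrable_mult_integrable:
  assumes f: "locally_integrable f" and \<zeta>: "continuous_on UNIV \<zeta>" and K: "\<And>x::real. x \<notin> {a..b} \<Longrightarrow> \<zeta> x = 0"
  shows "integrable lborel (\<lambda>x. f x * of_real (\<zeta> x))"
proof -
  have fi: "integrable lborel (\<lambda>x. indicator {a..b} x *\<^sub>R f x)"
    using locally_integrable_intervalD[OF f] by (simp add: set_integrable_def)
  note [measurable] = borel_measurable_integrable[OF fi] borel_measurable_continuous_onI[OF \<zeta>]
  have "bounded (\<zeta> ` {a..b})"
    by (intro compact_imp_bounded compact_continuous_image continuous_on_subset[OF \<zeta>]) auto
  then obtain M where "\<forall>y\<in>\<zeta> ` {a..b}. norm y \<le> M" unfolding bounded_iff by blast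
  then have M: "\<And>x. x \<in> {a..b} \<Longrightarrow> \<bar>\<zeta> x\<bar> \<le> M" by simp
  have eq: "(\<lambda>x. f x * of_real (\<zeta> x)) = (\<lambda>x. (indicator {a..b} x *\<^sub>R f x) * of_real (\<zeta> x))"
    using K by (auto simp: indicator_def)
  have "integrable lborel (\<lambda>x. M * norm (indicator {a..b} x *\<^sub>R f x))"
    using integrable_mult_right[OF integrable_norm[OF fi]] .
  then show ?thesis unfolding eq
  proof (rule Bochner_Integration.integrable_bound)
    have "norm ((indicator {a..b} x *\<^sub>R f x) * of_real (\<zeta> x)) \<le> M * norm (indicator {a..b} x *\<^sub>R f x)" for x
      using M[of x] mult_right_mono[OF M[of x], of "norm (f x)"] by (auto simp: norm_mult indicator_def mult.commute)
    then show "AE x in lborel. norm ((indicator {a..b} x *\<^sub>R f x) * of_real (\<zeta> x)) \<le> norm (M * norm (indicator {a..b} x *\<^sub>R f x))"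
      by (intro AE_I2) (metis abs_ge_self order_trans real_norm_def)
  qed measurable
qed

lemma deriv_eq_0_outside:
  assumes "\<And>x::real. x \<notin> {a..b} \<Longrightarrow> \<zeta> x = (0::real)" "x \<notin> {a..b}"
  shows "deriv \<zeta> x = 0"
proof (rule DERIV_imp_deriv)
  show "(\<zeta> has_real_derivative 0) (at x)"
    by (rule has_field_derivative_transform_within_open[where f="\<lambda>x. 0" and S="- {a..b}"])
       (use assms in \<open>auto simp: open_Compl\<close>)
qed

lemma test_function_support: 
  assumes "test_function \<zeta>" obtains a b where "\<And>x. x \<notin> {a..b} \<Longrightarrow> \<zeta> x = 0"
proof -
  obtain K where K: "compact K" "\<And>x. x \<notin> K \<Longrightarrow> \<zeta> x = 0" using assms by (auto simp: test_function_def)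
  then obtain a b where "K \<subseteq> cbox a b" using bounded_subset_cbox_symmetric[OF compact_imp_bounded] by blast
  then have "\<zeta> x = 0" if "x \<notin> {a..b}" for x using K(2)[of x] \<open>K \<subseteq> cbox a b\<close> that by fastforce
  then show thesis by (rule that)
qed

lemma test_function_integrable:
  assumes f: "locally_integrable f" and \<zeta>: "test_function \<zeta>"
  shows "integrable lborel (\<lambda>x. f x * of_real (\<zeta> x))" "integrable lborel (\<lambda>x. f x * of_real (deriv \<zeta> x))"
proof -
  obtain a b where ab: "\<And>x. x \<notin> {a..b} \<Longrightarrow> \<zeta> x = 0" using test_function_support[OF \<zeta>] by blast
  note s = test_functionD[OF \<zeta>]
  show "integrable lborel (\<lambda>x. f x * of_real (\<zeta> x))"
    by (rule locally_integrable_mult_integrable[OF f smooth_continuous[OF s] ab])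
  show "integrable lborel (\<lambda>x. f x * of_real (deriv \<zeta> x))"
    by (rule locally_integrable_mult_integrable[OF f smooth_continuous[OF smooth_deriv[OF s]] deriv_eq_0_outside[OF ab]])
qed

text \<open>The du Bois-Reymond lemma on each interval; any margin works there, since the weak
  derivative is global.\<close>

lemma has_weak_deriv_FTC:
  assumes "has_weak_deriv f g" "continuous_on UNIV f" "a \<le> b"
  shows "(LINT x:{a..b}|lborel. g x) = f b - f a"
proof (cases "a < b")
  case True
  show ?thesis
    by (rule weak_derivative_imp_FTC[where d=1])
       (use True assms in \<open>auto simp: has_weak_deriv_def locally_integrable_def intro: continuous_on_subset\<close>)
next
  case False
  have "AE x in lborel. indicator {a..b} x *\<^sub>R g x = 0"
    using AE_lborel_singleton[of a] by eventually_elim (use False in auto)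
  then have "(LINT x:{a..b}|lborel. g x) = 0"
    unfolding set_lebesgue_integral_def by (rule integral_eq_zero_AE)
  then show ?thesis using False assms(3) by auto
qed

text \<open>Both candidates have the increments of \<open>f\<close> as their interval integrals.
  This is what makes the choice in \<open>weak_deriv\<close> harmless.\<close>

lemma has_weak_deriv_unique:
  assumes "has_weak_deriv f g" "has_weak_deriv f g'" "continuous_on UNIV f"
  shows "AE x in lborel. g x = g' x"
proof -
  have si: "set_integrable lborel {a..b} g" "set_integrable lborel {a..b} g'" for a b
    using assms by (auto simp: has_weak_deriv_def locally_integrable_def)
  have "AE x in lborel. g x - g' x = 0"
    by (rule AE_eq_0_if_interval_integrals_0)
       (use si has_weak_deriv_FTC[OF assms(1,3)] has_weak_deriv_FTC[OF assms(2,3)] in \<open>auto simp: set_integral_diff\<close>)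
  then show ?thesis by simp
qed

lemma locally_integrable_diff:
  "locally_integrable f \<Longrightarrow> locally_integrable g \<Longrightarrow> locally_integrable (\<lambda>x. f x - g x)"
  by (simp add: locally_integrable_def)

lemma has_weak_deriv_diff:
  assumes "has_weak_deriv f f'" "has_weak_deriv g g'"
  shows "has_weak_deriv (\<lambda>x. f x - g x) (\<lambda>x. f' x - g' x)"
proof -
  have l: "locally_integrable f" "locally_integrable f'" "locally_integrable g" "locally_integrable g'"
    using assms by (auto simp: has_weak_deriv_def)
  have "(LINT x|lborel. (f x - g x) * of_real (deriv \<phi> x)) = - (LINT x|lborel. (f' x - g' x) * of_real (\<phi> x))"
    if "test_function \<phi>" for \<phi>
    using assms that l[THEN test_function_integrable(1)] l[THEN test_function_integrable(2)]
    by (simp add: has_weak_deriv_def left_diff_distrib)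
  then show ?thesis using l by (simp add: has_weak_deriv_def locally_integrable_diff)
qed

lemma H1_L2: "H1 f \<Longrightarrow> L2 f" and H1_continuous: "H1 f \<Longrightarrow> continuous_on UNIV f"
  by (auto simp: H1_def)

lemma H1_weak_deriv:
  assumes "H1 f" shows L2_weak_deriv: "L2 (weak_deriv f)" and "has_weak_deriv f (weak_deriv f)"
proof -
  have "\<exists>g. L2 g \<and> has_weak_deriv f g" using assms by (auto simp: H1_def)
  from someI_ex[OF this] show "L2 (weak_deriv f)" "has_weak_deriv f (weak_deriv f)"
    by (auto simp: weak_deriv_def)
qed

lemma H1_FTC: "H1 f \<Longrightarrow> a \<le> b \<Longrightarrow> (LINT x:{a..b}|lborel. weak_deriv f x) = f b - f a"
  using has_weak_deriv_FTC H1_weak_deriv(2) H1_continuous by blast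

text \<open>Since \<open>weak_deriv\<close> is a choice, it respects differences only almost
  everywhere, which is enough under norms and integrals.\<close>

lemma H1_diff:
  assumes "H1 f" "H1 g"
  shows "H1 (\<lambda>x. f x - g x)"
    and "AE x in lborel. weak_deriv (\<lambda>x. f x - g x) x = weak_deriv f x - weak_deriv g x"
proof -
  have w: "has_weak_deriv (\<lambda>x. f x - g x) (\<lambda>x. weak_deriv f x - weak_deriv g x)"
    using assms by (intro has_weak_deriv_diff H1_weak_deriv)
  have "L2 (\<lambda>x. weak_deriv f x - weak_deriv g x)" using assms by (intro L2_diff H1_weak_deriv)
  with w show H: "H1 (\<lambda>x. f x - g x)"
    using assms unfolding H1_def[of "\<lambda>x. f x - g x"]
    by (auto intro: continuous_on_diff L2_diff simp: H1_L2 H1_continuous)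
  show "AE x in lborel. weak_deriv (\<lambda>x. f x - g x) x = weak_deriv f x - weak_deriv g x"
    by (rule has_weak_deriv_unique[OF H1_weak_deriv(2)[OF H] w H1_continuous[OF H]])
qed

lemma L2_norm_weak_deriv_diff:
  assumes "H1 f" "H1 g"
  shows "L2_norm (\<lambda>x. weak_deriv f x - weak_deriv g x) = L2_norm (weak_deriv (\<lambda>x. f x - g x))"
  by (rule L2_norm_cong_AE)
     (use H1_diff[OF assms] L2_measurable L2_weak_deriv L2_diff assms in \<open>auto elim!: eventually_mono\<close>)

lemma L2_norm_le_H1_norm: "L2_norm f \<le> H1_norm f" "L2_norm (weak_deriv f) \<le> H1_norm f"
  unfolding H1_norm_def by (auto intro: real_le_rsqrt)

section \<open>The value at the origin, controlled by local mass and the derivative\<close>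

lemma set_integral_subset_mono:
  fixes h :: "real \<Rightarrow> real"
  assumes "integrable lborel h" "\<And>x. h x \<ge> 0" "A \<subseteq> B" "A \<in> sets borel" "B \<in> sets borel"
  shows "(LINT x:A|lborel. h x) \<le> (LINT x:B|lborel. h x)"
  unfolding set_lebesgue_integral_def
  by (rule integral_mono; (intro integrable_mult_indicator assms(1))?) (use assms in \<open>auto simp: indicator_def\<close>)

text \<open>Integration by parts with \<open>F = f\<close> and \<open>G = cnj f\<close>: the
  increment of |f|^2 is the sum of the integrals of f' cnj f and f cnj f', each bounded in
  modulus.\<close>

lemma H1_norm_square_diff:
  assumes f: "H1 f" and "a \<le> b"
  shows "\<bar>(norm (f b))\<^sup>2 - (norm (f a))\<^sup>2\<bar> \<le> 2 * (LINT x:{a..b}|lborel. norm (f x) * norm (weak_deriv f x))"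
proof -
  let ?w = "weak_deriv f"
  note L = H1_L2[OF f] L2_weak_deriv[OF f]
  note [measurable] = L[THEN L2_measurable]
  have w: "set_integrable lborel {a..b} ?w" by (rule L2_set_integrable[OF L(2)])
  have cw: "set_integrable lborel {a..b} (\<lambda>x. cnj (?w x))"
    using integrable_cnj[of lborel "\<lambda>x. indicator {a..b} x *\<^sub>R ?w x"] w by (simp add: set_integrable_def)
  have F: "f x = f a + (LINT y:{a..x}|lborel. ?w y)" if "x \<in> {a..b}" for x
    using H1_FTC[OF f, of a x] that by simp
  have G: "cnj (f x) = cnj (f a) + (LINT y:{a..x}|lborel. cnj (?w y))" if "x \<in> {a..b}" for x
  proof -
    have "(LINT y:{a..x}|lborel. cnj (?w y)) = cnj (LINT y:{a..x}|lborel. ?w y)"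
      using Bochner_Integration.integral_cnj[of lborel "\<lambda>y. indicator {a..x} y *\<^sub>R ?w y"] by (simp add: set_lebesgue_integral_def)
    then show ?thesis using F[OF that] by simp
  qed
  note ibp = integral_by_parts_lborel[where F=f and G="\<lambda>x. cnj (f x)", OF assms(2) w cw F G]
  have si: "set_integrable lborel {a..b} (\<lambda>x. norm (f x) * norm (?w x))"
    unfolding set_integrable_def by (rule integrable_mult_indicator[OF _ L2_norm_mult_integrable[OF L]]) simp
  have "\<bar>(norm (f b))\<^sup>2 - (norm (f a))\<^sup>2\<bar> = norm (f b * cnj (f b) - f a * cnj (f a))"
    by (simp flip: complex_norm_square of_real_power of_real_diff)
  also have "\<dots> \<le> norm (LINT x:{a..b}|lborel. ?w x * cnj (f x)) + norm (LINT x:{a..b}|lborel. f x * cnj (?w x))"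
    using norm_triangle_ineq[of "LINT x:{a..b}|lborel. ?w x * cnj (f x)" "LINT x:{a..b}|lborel. f x * cnj (?w x)"]
    by (simp only: ibp(3))
  also have "\<dots> \<le> (LINT x:{a..b}|lborel. norm (?w x * cnj (f x))) + (LINT x:{a..b}|lborel. norm (f x * cnj (?w x)))"
    by (intro add_mono set_integral_norm_bound ibp)
  also have "\<dots> = 2 * (LINT x:{a..b}|lborel. norm (f x) * norm (?w x))"
    by (simp add: norm_mult mult.commute)
  finally show ?thesis .
qed

text \<open>The last term has the factor 1 because a point on one side of 0 pays only for its own
  side: averaging over [-R,R] gives \<open>Jp\<close> and \<open>Jm\<close> the weight 1/2 each,
  which cancels the 2 from \<open>H1_norm_square_diff\<close>. For \<open>\<phi>\<^sub>0\<close>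
  both sides tend to 2 as R grows, so the constant cannot be improved.\<close>

lemma H1_point_bound:
  assumes f: "H1 f" and R: "R > 0"
  defines "m \<equiv> (LINT x:{-R..R}|lborel. (norm (f x))\<^sup>2)"
  shows "(norm (f 0))\<^sup>2 \<le> m / (2 * R) + sqrt m * L2_norm (weak_deriv f)"
proof -
  let ?w = "weak_deriv f"
  note L = H1_L2[OF f] L2_weak_deriv[OF f]
  note [measurable] = L[THEN L2_measurable]
  define h where "h x = norm (f x) * norm (?w x)" for x
  have hi: "integrable lborel h" unfolding h_def[abs_def] by (rule L2_norm_mult_integrable[OF L])
  have h0: "h x \<ge> 0" for x by (simp add: h_def)
  have hA: "integrable lborel (\<lambda>x. indicator A x * h x)" if "A \<in> sets borel" for A
    using integrable_mult_indicator[OF _ hi, of A] that by simp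
  have qA: "integrable lborel (\<lambda>x. indicator {-R..R} x * (norm (f x))\<^sup>2)"
    using integrable_mult_indicator[OF _ L2_square_integrable[OF L(1)], of "{-R..R}"] by simp
  define Jp where "Jp = (LINT x:{0..R}|lborel. h x)"
  define Jm where "Jm = (LINT x:{-R..0}|lborel. h x)"
  have pt: "(norm (f 0))\<^sup>2 \<le> (norm (f x))\<^sup>2 + 2 * (if x \<ge> 0 then Jp else Jm)" if x: "x \<in> {-R..R}" for x
  proof (cases "x \<ge> 0")
    case True
    have "(LINT x:{0..x}|lborel. h x) \<le> Jp"
      unfolding Jp_def using x by (intro set_integral_subset_mono hi h0) auto
    then show ?thesis using H1_norm_square_diff[OF f True] True by (auto simp: h_def)
  next
    case False
    have "(LINT x:{x..0}|lborel. h x) \<le> Jm"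
      unfolding Jm_def using x by (intro set_integral_subset_mono hi h0) auto
    then show ?thesis using H1_norm_square_diff[OF f, of x 0] False by (auto simp: h_def)
  qed
  have ii: "integrable lborel (indicator A :: real \<Rightarrow> real)" if "A \<in> sets borel" "A \<subseteq> {-R..R}" for A
    using that emeasure_mono[OF that(2), of lborel] R
    by (intro integrable_real_indicator) (auto intro: le_less_trans)
  have i1: "integrable lborel (indicator {0..R} :: real \<Rightarrow> real)"
    "integrable lborel (indicator {-R..<0} :: real \<Rightarrow> real)" "integrable lborel (indicator {-R..R} :: real \<Rightarrow> real)"
    using R by (auto intro!: ii)
  have "(LINT x|lborel. indicator {-R..R} x * (norm (f 0))\<^sup>2) \<le>
     (LINT x|lborel. indicator {-R..R} x * (norm (f x))\<^sup>2 + (indicator {0..R} x * (2 * Jp) + indicator {-R..<0} x * (2 * Jm)))"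
  proof (rule integral_mono)
    fix x
    show "indicator {-R..R} x * (norm (f 0))\<^sup>2 \<le> indicator {-R..R} x * (norm (f x))\<^sup>2 + (indicator {0..R} x * (2 * Jp) + indicator {-R..<0} x * (2 * Jm))"
      using pt[of x] R by (auto simp: indicator_def)
  qed (use qA i1 in auto)
  also have "\<dots> = m + (R * (2 * Jp) + R * (2 * Jm))"
    using qA i1 R by (simp add: m_def set_lebesgue_integral_def)
  finally have 1: "2 * R * (norm (f 0))\<^sup>2 \<le> m + 2 * R * (Jp + Jm)"
    using R by (simp add: algebra_simps)
  have "Jp + Jm = (LINT x|lborel. indicator {0..R} x * h x + indicator {-R..0} x * h x)"
    unfolding Jp_def Jm_def set_lebesgue_integral_def real_scaleR_def
    by (rule Bochner_Integration.integral_add[symmetric]) (auto intro: hA)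
  also have "\<dots> = (LINT x|lborel. norm (indicator {-R..R} x *\<^sub>R f x) * norm (?w x))"
    by (rule integral_cong_AE) (simp_all add: h_def, use AE_lborel_singleton[of 0] in \<open>eventually_elim, use R in \<open>auto simp: indicator_def\<close>\<close>)
  also have "\<dots> \<le> L2_norm (\<lambda>x. indicator {-R..R} x *\<^sub>R f x) * L2_norm ?w"
  proof (rule L2_Cauchy_Schwarz[OF _ L(2)])
    have "(\<lambda>x. (norm (indicator {-R..R} x *\<^sub>R f x))\<^sup>2) = (\<lambda>x. indicator {-R..R} x * (norm (f x))\<^sup>2)"
      by (auto simp: indicator_def)
    then show "L2 (\<lambda>x. indicator {-R..R} x *\<^sub>R f x)" unfolding L2_def using qA by simp
  qed
  also have "L2_norm (\<lambda>x. indicator {-R..R} x *\<^sub>R f x) = sqrt m"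
    unfolding L2_norm_def m_def set_lebesgue_integral_def
    by (intro arg_cong[where f=sqrt] Bochner_Integration.integral_cong) (auto simp: indicator_def)
  finally have "2 * R * (norm (f 0))\<^sup>2 \<le> m + 2 * R * (sqrt m * L2_norm ?w)"
    using 1 R mult_left_mono[of "Jp + Jm" "sqrt m * L2_norm ?w" "2 * R"] by linarith
  then show ?thesis using R by (simp add: field_simps)
qed

text \<open>The choice R = 1, with each of the two terms bounded by the square of the
  \<open>H1\<close> norm. It makes the trace at 0 continuous in time along \<open>H1\<close>
  curves.\<close>

lemma H1_point_le_H1_norm:
  assumes "H1 f" shows "(norm (f 0))\<^sup>2 \<le> 2 * (H1_norm f)\<^sup>2"
proof -
  let ?m = "LINT x:{-1..1}|lborel. (norm (f x))\<^sup>2"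
  have "?m \<le> (LINT x:UNIV|lborel. (norm (f x))\<^sup>2)"
    by (rule set_integral_subset_mono) (auto intro: L2_square_integrable H1_L2 assms)
  then have m: "?m \<le> (L2_norm f)\<^sup>2" by (simp add: set_lebesgue_integral_def L2_norm_power2)
  have m0: "?m \<ge> 0" by (simp add: set_lebesgue_integral_def)
  have "(L2_norm f)\<^sup>2 \<le> (H1_norm f)\<^sup>2" by (intro power_mono L2_norm_le_H1_norm L2_norm_nonneg)
  then have "?m / 2 \<le> (H1_norm f)\<^sup>2" using m m0 by linarith
  moreover have "sqrt ?m \<le> H1_norm f"
    using m L2_norm_le_H1_norm(1)[of f] real_le_lsqrt[OF L2_norm_nonneg m] by (metis dual_order.trans real_sqrt_le_mono real_sqrt_abs abs_of_nonneg L2_norm_nonneg)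
  then have "sqrt ?m * L2_norm (weak_deriv f) \<le> H1_norm f * H1_norm f"
    by (intro mult_mono L2_norm_le_H1_norm) (use m0 in \<open>auto simp: H1_norm_def L2_norm_nonneg\<close>)
  ultimately show ?thesis using H1_point_bound[OF assms, of 1] by (simp add: power2_eq_square)
qed

subsection \<open>Symmetric kernels near the diagonal\<close>

lemma LINT_eq_integral_continuous:
  fixes f :: "real \<Rightarrow> 'a::euclidean_space"
  shows "continuous_on {a..b} f \<Longrightarrow> (LINT x:{a..b}|lborel. f x) = integral {a..b} f"
  by (intro set_borel_integral_eq_integral(2) borel_integrable_atLeastAtMost')

lemma integral_shift_continuous:
  fixes f :: "real \<Rightarrow> real"
  assumes "continuous_on UNIV f"
  shows "integral {a..b} (\<lambda>x. f (x + c)) = integral {a + c..b + c} f"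
proof -
  have "(LINT x:{a + c..b + c}|lborel. f x) = (LINT x:{a..b}|lborel. f (x + c))"
    unfolding set_lebesgue_integral_def
    by (subst lborel_integral_real_affine[of 1 _ c])
       (auto intro!: Bochner_Integration.integral_cong simp: indicator_def add.commute)
  moreover have "continuous_on UNIV (\<lambda>x. f (x + c))"
    by (intro continuous_on_compose2[OF assms] continuous_intros) auto
  ultimately show ?thesis
    using assms by (simp add: LINT_eq_integral_continuous continuous_on_subset)
qed

lemma integral_flip_continuous:
  fixes f :: "real \<Rightarrow> real"
  assumes "continuous_on UNIV f"
  shows "integral {0..b} (\<lambda>x. f (b - x)) = integral {0..b} f"
proof -
  have "(LINT x:{0..b}|lborel. f x) = (LINT x:{0..b}|lborel. f (b - x))"
    unfolding set_lebesgue_integral_def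
    by (subst lborel_integral_real_affine[of "-1" _ b])
       (auto intro!: Bochner_Integration.integral_cong simp: indicator_def)
  moreover have "continuous_on UNIV (\<lambda>x. f (b - x))"
    by (intro continuous_on_compose2[OF assms] continuous_intros) auto
  ultimately show ?thesis
    using assms by (simp add: LINT_eq_integral_continuous continuous_on_subset)
qed

lemma continuous_on_param2:
  assumes "continuous_on UNIV (\<lambda>(s, t). Q s t)" "continuous_on A f" "continuous_on A g"
  shows "continuous_on A (\<lambda>z. Q (f z) (g z))"
  using continuous_on_compose2[OF assms(1) continuous_on_Pair[OF assms(2,3)]] by auto

lemma continuous_on_integral_param:
  fixes Q :: "real \<Rightarrow> real \<Rightarrow> real"
  assumes "continuous_on UNIV (\<lambda>(s, t). Q s t)"
  shows "continuous_on A (\<lambda>s. integral {a..b} (Q s))"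
  using integral_continuous_on_param[of A a b Q] continuous_on_subset[OF assms] by auto

lemma integral_swap:
  fixes Q :: "real \<Rightarrow> real \<Rightarrow> real"
  assumes "continuous_on UNIV (\<lambda>(s, t). Q s t)"
  shows "integral {a..b} (\<lambda>s. integral {c..d} (\<lambda>t. Q s t)) = integral {c..d} (\<lambda>t. integral {a..b} (\<lambda>s. Q s t))"
  using integral_swap_continuous[of a c b d Q] continuous_on_subset[OF assms] by auto

lemma ennreal_integral_Icc:
  fixes f :: "real \<Rightarrow> real"
  assumes "continuous_on {a..b} f" "\<And>x. x \<in> {a..b} \<Longrightarrow> f x \<ge> 0"
  shows "ennreal (integral {a..b} f) = (\<integral>\<^sup>+x\<in>{a..b}. ennreal (f x) \<partial>lborel)"
proof -
  have "integrable lborel (\<lambda>x. indicator {a..b} x *\<^sub>R f x)"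
    using borel_integrable_atLeastAtMost'[OF assms(1)] by (simp add: set_integrable_def)
  then have "(\<integral>\<^sup>+x. ennreal (indicator {a..b} x *\<^sub>R f x) \<partial>lborel) = ennreal (LINT x:{a..b}|lborel. f x)"
    unfolding set_lebesgue_integral_def using assms(2)
    by (intro nn_integral_eq_integral) (auto simp: indicator_def)
  moreover have "(\<integral>\<^sup>+x. ennreal (indicator {a..b} x *\<^sub>R f x) \<partial>lborel) = (\<integral>\<^sup>+x\<in>{a..b}. ennreal (f x) \<partial>lborel)"
    by (intro nn_integral_cong) (auto simp: indicator_def)
  ultimately show ?thesis unfolding LINT_eq_integral_continuous[OF assms(1)] by simp
qed

text \<open>Symmetry turns the increment of a kernel over the squares $[a,a+\varepsilon]^2$ along the diagonal
  into a telescoping sum: after integration in $a$ only triangles of area $\varepsilon^2/2$ at the two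
  ends survive.\<close>
lemma symmetric_kernel_telescope:
  fixes Q :: "real \<Rightarrow> real \<Rightarrow> real"
  assumes Q: "continuous_on UNIV (\<lambda>(s, t). Q s t)" and sym: "\<And>s t. Q s t = Q t s"
    and ab: "\<alpha> < \<beta>" and \<epsilon>: "\<epsilon> > 0"
    and \<eta>: "\<And>x \<sigma>. x \<in> {\<alpha>..\<alpha> + \<epsilon>} \<Longrightarrow> \<sigma> \<in> {0..\<epsilon>} \<Longrightarrow> \<bar>Q x (x + \<sigma>) - Q \<alpha> \<alpha>\<bar> \<le> \<eta>"
      "\<And>x \<sigma>. x \<in> {\<beta>..\<beta> + \<epsilon>} \<Longrightarrow> \<sigma> \<in> {0..\<epsilon>} \<Longrightarrow> \<bar>Q x (x + \<sigma>) - Q \<beta> \<beta>\<bar> \<le> \<eta>"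
  shows "\<bar>integral {\<alpha>..\<beta>} (\<lambda>a. integral {0..\<epsilon>} (\<lambda>\<sigma>. Q (a + \<sigma>) (a + \<epsilon>) - Q (a + \<sigma>) a))
     - (Q \<beta> \<beta> - Q \<alpha> \<alpha>) * (\<epsilon>\<^sup>2 / 2)\<bar> \<le> \<eta> * \<epsilon>\<^sup>2"
proof -
  \<comment> \<open>\<open>A\<close> and \<open>B\<close> collect the two halves of the increment.
    By symmetry Q(a + \<sigma>, a) = Q(a, a + \<sigma>), so that both integrate values at pairs in
    increasing order.\<close>
  define A where "A \<sigma> = integral {\<alpha>..\<beta>} (\<lambda>a. Q (a + \<sigma>) (a + \<epsilon>))" for \<sigma>
  define B where "B \<sigma> = integral {\<alpha>..\<beta>} (\<lambda>a. Q a (a + \<sigma>))" for \<sigma>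
  note cQ = continuous_on_param2[OF Q]
  have c1: "continuous_on UNIV (\<lambda>(a, \<sigma>). Q (a + \<sigma>) (a + \<epsilon>) - Q (a + \<sigma>) a)"
    unfolding split_beta' by (intro continuous_intros cQ)
  have cA: "continuous_on UNIV A" unfolding A_def
    by (rule continuous_on_integral_param) (unfold split_beta', intro continuous_intros cQ)
  have cB: "continuous_on UNIV B" unfolding B_def
    by (rule continuous_on_integral_param) (unfold split_beta', intro continuous_intros cQ)
  have intg: "f integrable_on {a..b}" if "continuous_on UNIV f" for f :: "real \<Rightarrow> real" and a b
    using that by (intro integrable_continuous_real) (auto intro: continuous_on_subset)
  have cAf: "continuous_on UNIV (\<lambda>\<sigma>. A (\<epsilon> - \<sigma>))"
    by (intro continuous_on_compose2[OF cA] continuous_intros) auto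
  have "integral {\<alpha>..\<beta>} (\<lambda>a. integral {0..\<epsilon>} (\<lambda>\<sigma>. Q (a + \<sigma>) (a + \<epsilon>) - Q (a + \<sigma>) a))
      = integral {0..\<epsilon>} (\<lambda>\<sigma>. integral {\<alpha>..\<beta>} (\<lambda>a. Q (a + \<sigma>) (a + \<epsilon>) - Q (a + \<sigma>) a))"
    by (rule integral_swap[OF c1])
  also have "\<dots> = integral {0..\<epsilon>} (\<lambda>\<sigma>. A \<sigma> - B \<sigma>)"
  proof (rule integral_cong)
    fix \<sigma>
    have "integral {\<alpha>..\<beta>} (\<lambda>a. Q (a + \<sigma>) (a + \<epsilon>) - Q (a + \<sigma>) a) =
        integral {\<alpha>..\<beta>} (\<lambda>a. Q (a + \<sigma>) (a + \<epsilon>)) - integral {\<alpha>..\<beta>} (\<lambda>a. Q (a + \<sigma>) a)"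
      by (rule integral_diff) (auto intro!: intg cQ continuous_intros)
    then show "integral {\<alpha>..\<beta>} (\<lambda>a. Q (a + \<sigma>) (a + \<epsilon>) - Q (a + \<sigma>) a) = A \<sigma> - B \<sigma>"
      by (simp add: A_def B_def sym[of "_ + \<sigma>"])
  qed
  also have "\<dots> = integral {0..\<epsilon>} A - integral {0..\<epsilon>} B"
    by (intro integral_diff intg cA cB)
  \<comment> \<open>The flip equalizes the gaps: A(\<epsilon> - \<sigma>) and B(\<sigma>) both
    integrate Q(x, x + \<sigma>), over windows shifted against each other by \<epsilon> -
    \<sigma>.\<close>
  also have "\<dots> = integral {0..\<epsilon>} (\<lambda>\<sigma>. A (\<epsilon> - \<sigma>)) - integral {0..\<epsilon>} B"
    by (simp add: integral_flip_continuous[OF cA])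
  also have "\<dots> = integral {0..\<epsilon>} (\<lambda>\<sigma>. A (\<epsilon> - \<sigma>) - B \<sigma>)"
    by (intro integral_diff[symmetric] intg cAf cB)
  finally have I: "integral {\<alpha>..\<beta>} (\<lambda>a. integral {0..\<epsilon>} (\<lambda>\<sigma>. Q (a + \<sigma>) (a + \<epsilon>) - Q (a + \<sigma>) a))
     = integral {0..\<epsilon>} (\<lambda>\<sigma>. A (\<epsilon> - \<sigma>) - B \<sigma>)" .
  \<comment> \<open>The end windows have length \<epsilon> - \<sigma>; integrated over \<sigma>,
    this is the area of a triangle.\<close>
  have half: "((\<lambda>\<sigma>. c * (\<epsilon> - \<sigma>)) has_integral c * (\<epsilon>\<^sup>2 / 2)) {0..\<epsilon>}" for c
  proof -
    have "((\<lambda>\<sigma>. c * (\<epsilon> - \<sigma>)) has_integral (c * (\<epsilon> * \<epsilon> - \<epsilon>\<^sup>2 / 2) - c * (\<epsilon> * 0 - 0\<^sup>2 / 2))) {0..\<epsilon>}"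
      using \<epsilon> by (intro fundamental_theorem_of_calculus)
        (auto intro!: derivative_eq_intros simp flip: has_real_derivative_iff_has_vector_derivative)
    then show ?thesis by (simp add: power2_eq_square)
  qed
  have pt: "\<bar>A (\<epsilon> - \<sigma>) - B \<sigma> - (Q \<beta> \<beta> - Q \<alpha> \<alpha>) * (\<epsilon> - \<sigma>)\<bar> \<le> 2 * \<eta> * (\<epsilon> - \<sigma>)" if \<sigma>: "\<sigma> \<in> {0..\<epsilon>}" for \<sigma>
  proof -
    let ?G = "\<lambda>x. Q x (x + \<sigma>)"
    let ?d = "\<epsilon> - \<sigma>"
    have cG: "continuous_on UNIV ?G" by (intro cQ continuous_intros)
    have "A (\<epsilon> - \<sigma>) = integral {\<alpha>..\<beta>} (\<lambda>a. ?G (a + ?d))"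
      unfolding A_def by (simp add: algebra_simps)
    also have "\<dots> = integral {\<alpha> + ?d..\<beta> + ?d} ?G" by (rule integral_shift_continuous[OF cG])
    \<comment> \<open>The common part of the two windows cancels.\<close>
    finally have "A (\<epsilon> - \<sigma>) - B \<sigma> = integral {\<beta>..\<beta> + ?d} ?G - integral {\<alpha>..\<alpha> + ?d} ?G"
      using Henstock_Kurzweil_Integration.integral_combine[of \<alpha> \<beta> "\<beta> + ?d" ?G]
        Henstock_Kurzweil_Integration.integral_combine[of \<alpha> "\<alpha> + ?d" "\<beta> + ?d" ?G] \<sigma> ab intg[OF cG]
      unfolding B_def by auto
    moreover have "\<bar>integral {c..c + ?d} ?G - Q c c * ?d\<bar> \<le> \<eta> * ?d"
      if c: "\<And>x. x \<in> {c..c + \<epsilon>} \<Longrightarrow> \<bar>Q x (x + \<sigma>) - Q c c\<bar> \<le> \<eta>" for c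
    proof -
      have "integral {c..c + ?d} ?G - Q c c * ?d = integral {c..c + ?d} (\<lambda>x. ?G x - Q c c)"
        using \<sigma> by (subst integral_diff) (auto intro: intg cG)
      moreover have "norm (integral {c..c + ?d} (\<lambda>x. ?G x - Q c c)) \<le> \<eta> * (c + ?d - c)"
        by (rule integral_bound) (use \<sigma> c in \<open>auto intro!: continuous_intros cQ\<close>)
      ultimately show ?thesis by simp
    qed
    from this[of \<alpha>] this[of \<beta>] have "\<bar>integral {\<alpha>..\<alpha> + ?d} ?G - Q \<alpha> \<alpha> * ?d\<bar> \<le> \<eta> * ?d"
      "\<bar>integral {\<beta>..\<beta> + ?d} ?G - Q \<beta> \<beta> * ?d\<bar> \<le> \<eta> * ?d" using \<eta> \<sigma> by auto
    ultimately show ?thesis unfolding left_diff_distrib by linarith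
  qed
  have "integral {0..\<epsilon>} (\<lambda>\<sigma>. A (\<epsilon> - \<sigma>) - B \<sigma>) - (Q \<beta> \<beta> - Q \<alpha> \<alpha>) * (\<epsilon>\<^sup>2 / 2) =
     integral {0..\<epsilon>} (\<lambda>\<sigma>. A (\<epsilon> - \<sigma>) - B \<sigma> - (Q \<beta> \<beta> - Q \<alpha> \<alpha>) * (\<epsilon> - \<sigma>))"
    unfolding integral_unique[OF half[of "Q \<beta> \<beta> - Q \<alpha> \<alpha>"], symmetric]
    by (rule integral_diff[symmetric]) (auto intro!: intg continuous_intros cAf cB)
  moreover have "norm (integral {0..\<epsilon>} (\<lambda>\<sigma>. A (\<epsilon> - \<sigma>) - B \<sigma> - (Q \<beta> \<beta> - Q \<alpha> \<alpha>) * (\<epsilon> - \<sigma>)))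
      \<le> integral {0..\<epsilon>} (\<lambda>\<sigma>. 2 * \<eta> * (\<epsilon> - \<sigma>))"
    by (rule Henstock_Kurzweil_Integration.integral_norm_bound_integral) (use pt in \<open>auto intro!: intg continuous_intros cAf cB\<close>)
  moreover have "integral {0..\<epsilon>} (\<lambda>\<sigma>. 2 * \<eta> * (\<epsilon> - \<sigma>)) = \<eta> * \<epsilon>\<^sup>2"
    using integral_unique[OF half[of "2 * \<eta>"]] by simp
  ultimately show ?thesis unfolding I by (simp only: real_norm_def)
qed

text \<open>Where |t - s| <= \<epsilon>, the weight |t - s|^(-p) is at least \<epsilon>^(-p), so the
  unweighted integral is at most \<epsilon>^p times the Gagliardo double integral. The substitution
  is t = a + c, s = a + d + \<sigma>; the offsets allow a comparison with either end of the
  interval.\<close>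

lemma near_diagonal_integral_le:
  fixes h :: "real \<Rightarrow> complex" and N :: ennreal and p :: real
  assumes h: "continuous_on UNIV h" and p: "p > 0" and \<epsilon>: "\<epsilon> > 0" and N: "N < \<infinity>"
    and d: "\<And>a. a \<in> {\<alpha>..\<beta>} \<Longrightarrow> {a + d..a + d + \<epsilon>} \<subseteq> {l..r}" "\<And>a. a \<in> {\<alpha>..\<beta>} \<Longrightarrow> a + c \<in> {l..r}"
    and dc: "d \<le> c" "c \<le> d + \<epsilon>"
    and Nd: "(\<integral>\<^sup>+t\<in>{l..r}. (\<integral>\<^sup>+s\<in>{l..r}. ennreal ((norm (h t - h s))\<^sup>2 / \<bar>t - s\<bar> powr p) \<partial>lborel) \<partial>lborel) \<le> N"
  shows "integral {\<alpha>..\<beta>} (\<lambda>a. integral {0..\<epsilon>} (\<lambda>\<sigma>. (norm (h (a + d + \<sigma>) - h (a + c)))\<^sup>2)) \<le> \<epsilon> powr p * enn2real N"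
proof -
  have ch: "continuous_on A (\<lambda>x. h (f x))" if "continuous_on A f" for f and A :: "'c::topological_space set"
    by (rule continuous_on_compose2[OF h that]) auto
  define \<Phi> where "\<Phi> t = (\<integral>\<^sup>+s\<in>{l..r}. ennreal ((norm (h t - h s))\<^sup>2 / \<bar>t - s\<bar> powr p) \<partial>lborel)" for t
  have [measurable]: "h \<in> borel_measurable borel" by (rule borel_measurable_continuous_onI[OF h])
  have [measurable]: "\<Phi> \<in> borel_measurable borel" unfolding \<Phi>_def by measurable
  define J where "J a = integral {0..\<epsilon>} (\<lambda>\<sigma>. (norm (h (a + d + \<sigma>) - h (a + c)))\<^sup>2)" for a
  have cJ: "continuous_on UNIV J" unfolding J_def
    by (rule continuous_on_integral_param) (unfold split_beta', intro continuous_intros ch)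
  have J0: "J a \<ge> 0" for a unfolding J_def by (intro integral_nonneg integrable_continuous_real) (auto intro!: continuous_intros ch)
  have J: "ennreal (J a) \<le> ennreal (\<epsilon> powr p) * \<Phi> (a + c)" if a: "a \<in> {\<alpha>..\<beta>}" for a
  proof -
    let ?H = "\<lambda>s. (norm (h s - h (a + c)))\<^sup>2"
    have cH: "continuous_on A ?H" for A by (intro continuous_intros ch)
    have "J a = integral {a + d..a + d + \<epsilon>} ?H"
      using integral_shift_continuous[OF cH, of 0 \<epsilon> "a + d"] by (simp add: J_def add_ac)
    then have "ennreal (J a) = (\<integral>\<^sup>+s\<in>{a + d..a + d + \<epsilon>}. ennreal (?H s) \<partial>lborel)"
      using ennreal_integral_Icc[OF cH] by simp
    also have "\<dots> \<le> (\<integral>\<^sup>+s. ennreal (\<epsilon> powr p) * (ennreal ((norm (h (a + c) - h s))\<^sup>2 / \<bar>a + c - s\<bar> powr p) * indicator {l..r} s) \<partial>lborel)"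
    proof (rule nn_integral_mono)
      fix s
      have "?H s \<le> \<epsilon> powr p * ((norm (h (a + c) - h s))\<^sup>2 / \<bar>a + c - s\<bar> powr p)" if s: "s \<in> {a + d..a + d + \<epsilon>}"
      \<comment> \<open>On the diagonal both sides are 0, by the convention for division by
        0.\<close>
      proof (cases "s = a + c")
        case False
        have "\<bar>a + c - s\<bar> powr p \<le> \<epsilon> powr p"
          using s dc p by (intro powr_mono2) auto
        then have "?H s * \<bar>a + c - s\<bar> powr p \<le> ?H s * \<epsilon> powr p"
          by (intro mult_left_mono) auto
        then show ?thesis using False by (simp add: field_simps norm_minus_commute)
      qed simp
      then show "ennreal (?H s) * indicator {a + d..a + d + \<epsilon>} s \<le> ennreal (\<epsilon> powr p) * (ennreal ((norm (h (a + c) - h s))\<^sup>2 / \<bar>a + c - s\<bar> powr p) * indicator {l..r} s)"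
        using d(1)[OF a] by (auto simp: indicator_def ennreal_mult[symmetric] intro!: ennreal_leI)
    qed
    also have "\<dots> = ennreal (\<epsilon> powr p) * \<Phi> (a + c)"
      unfolding \<Phi>_def by (rule nn_integral_cmult) measurable
    finally show ?thesis .
  qed
  have "ennreal (integral {\<alpha>..\<beta>} J) = (\<integral>\<^sup>+a\<in>{\<alpha>..\<beta>}. ennreal (J a) \<partial>lborel)"
    by (rule ennreal_integral_Icc) (auto intro: J0 continuous_on_subset[OF cJ])
  also have "\<dots> \<le> (\<integral>\<^sup>+a. ennreal (\<epsilon> powr p) * (\<Phi> (a + c) * indicator {l..r} (a + c)) \<partial>lborel)"
    using J d(2) by (intro nn_integral_mono) (auto simp: indicator_def)
  also have "\<dots> = ennreal (\<epsilon> powr p) * (\<integral>\<^sup>+a. \<Phi> (a + c) * indicator {l..r} (a + c) \<partial>lborel)"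
    by (rule nn_integral_cmult) measurable
  also have "(\<integral>\<^sup>+a. \<Phi> (a + c) * indicator {l..r} (a + c) \<partial>lborel) = (\<integral>\<^sup>+t. \<Phi> t * indicator {l..r} t \<partial>lborel)"
    by (subst nn_integral_real_affine[where c=1 and t=c]) (auto simp: add.commute)
  also have "\<dots> \<le> N" using Nd by (simp add: \<Phi>_def)
  finally have "ennreal (integral {\<alpha>..\<beta>} J) \<le> ennreal (\<epsilon> powr p) * N" by (simp add: mult_left_mono)
  also have "N = ennreal (enn2real N)" using N by simp
  finally have "ennreal (integral {\<alpha>..\<beta>} J) \<le> ennreal (\<epsilon> powr p * enn2real N)" by (simp add: ennreal_mult)
  then show ?thesis unfolding J_def[abs_def] by (simp add: ennreal_le_iff)
qed

text \<open>The exponent $p > 2$ makes the right-hand side of the hypothesis negligible against the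
  triangles of area $\varepsilon^2/2$.\<close>
lemma symmetric_kernel_diagonal_constant:
  fixes Q :: "real \<Rightarrow> real \<Rightarrow> real" and h :: "real \<Rightarrow> complex"
  assumes Q: "continuous_on UNIV (\<lambda>(s, t). Q s t)" and sym: "\<And>s t. Q s t = Q t s"
    and h: "continuous_on UNIV h" and ab: "\<alpha> < \<beta>" and \<delta>: "\<delta> > 0" and p: "p > 2" and C: "C \<ge> 0"
    and fin: "(\<integral>\<^sup>+t\<in>{\<alpha>..\<beta> + \<delta>}. (\<integral>\<^sup>+s\<in>{\<alpha>..\<beta> + \<delta>}. ennreal ((norm (h t - h s))\<^sup>2 / \<bar>t - s\<bar> powr p) \<partial>lborel) \<partial>lborel) < \<infinity>"
    and incr: "\<And>a b. \<alpha> \<le> a \<Longrightarrow> a < b \<Longrightarrow> b \<le> \<beta> + \<delta> \<Longrightarrow> \<bar>integral {a..b} (\<lambda>s. Q s b - Q s a)\<bar>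
       \<le> C * integral {a..b} (\<lambda>s. (norm (h s - h b))\<^sup>2 + (norm (h s - h a))\<^sup>2)"
  shows "Q \<alpha> \<alpha> = Q \<beta> \<beta>"
proof -
  define N where "N = (\<integral>\<^sup>+t\<in>{\<alpha>..\<beta> + \<delta>}. (\<integral>\<^sup>+s\<in>{\<alpha>..\<beta> + \<delta>}. ennreal ((norm (h t - h s))\<^sup>2 / \<bar>t - s\<bar> powr p) \<partial>lborel) \<partial>lborel)"
  note cQ = continuous_on_param2[OF Q]
  have ch: "continuous_on A (\<lambda>x. h (f x))" if "continuous_on A f" for f and A :: "'c::topological_space set"
    by (rule continuous_on_compose2[OF h that]) auto
  have intg: "f integrable_on {a..b}" if "continuous_on UNIV f" for f :: "real \<Rightarrow> real" and a b
    using that by (intro integrable_continuous_real) (auto intro: continuous_on_subset)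
  have main: "\<bar>Q \<beta> \<beta> - Q \<alpha> \<alpha>\<bar> \<le> 2 * \<eta> + 4 * C * enn2real N * \<epsilon> powr (p - 2)"
    if \<epsilon>: "\<epsilon> > 0" "\<epsilon> \<le> \<delta>" and \<eta>: "\<And>c x \<sigma>. c \<in> {\<alpha>, \<beta>} \<Longrightarrow> x \<in> {c..c + \<epsilon>} \<Longrightarrow> \<sigma> \<in> {0..\<epsilon>} \<Longrightarrow> \<bar>Q x (x + \<sigma>) - Q c c\<bar> \<le> \<eta>" for \<epsilon> \<eta>
  proof -
    define I where "I = integral {\<alpha>..\<beta>} (\<lambda>a. integral {0..\<epsilon>} (\<lambda>\<sigma>. Q (a + \<sigma>) (a + \<epsilon>) - Q (a + \<sigma>) a))"
    \<comment> \<open>The summand 0 keeps \<open>J1\<close> and \<open>J2\<close> literally in the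
      form of \<open>near_diagonal_integral_le\<close> with d = 0, for c = \<epsilon> and c =
      0.\<close>
    define J1 where "J1 a = integral {0..\<epsilon>} (\<lambda>\<sigma>. (norm (h (a + 0 + \<sigma>) - h (a + \<epsilon>)))\<^sup>2)" for a
    define J2 where "J2 a = integral {0..\<epsilon>} (\<lambda>\<sigma>. (norm (h (a + 0 + \<sigma>) - h (a + 0)))\<^sup>2)" for a
    have cJ: "continuous_on UNIV J1" "continuous_on UNIV J2" unfolding J1_def J2_def
      by (rule continuous_on_integral_param, unfold split_beta', intro continuous_intros ch)+
    have cI: "continuous_on UNIV (\<lambda>a. integral {0..\<epsilon>} (\<lambda>\<sigma>. Q (a + \<sigma>) (a + \<epsilon>) - Q (a + \<sigma>) a))"
      by (rule continuous_on_integral_param) (unfold split_beta', intro continuous_intros cQ)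
    have t: "\<bar>I - (Q \<beta> \<beta> - Q \<alpha> \<alpha>) * (\<epsilon>\<^sup>2 / 2)\<bar> \<le> \<eta> * \<epsilon>\<^sup>2"
      unfolding I_def by (rule symmetric_kernel_telescope[OF Q sym ab]) (use \<epsilon> \<eta> in auto)
    have pt: "\<bar>integral {0..\<epsilon>} (\<lambda>\<sigma>. Q (a + \<sigma>) (a + \<epsilon>) - Q (a + \<sigma>) a)\<bar> \<le> C * (J1 a + J2 a)" if a: "a \<in> {\<alpha>..\<beta>}" for a
    proof -
      let ?q = "\<lambda>s. Q s (a + \<epsilon>) - Q s a" and ?g = "\<lambda>s. (norm (h s - h (a + \<epsilon>)))\<^sup>2 + (norm (h s - h a))\<^sup>2"
      have c: "continuous_on UNIV ?q" "continuous_on UNIV ?g" by (intro continuous_intros cQ ch)+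
      have "integral {0..\<epsilon>} (\<lambda>\<sigma>. Q (a + \<sigma>) (a + \<epsilon>) - Q (a + \<sigma>) a) = integral {a..a + \<epsilon>} ?q"
        using integral_shift_continuous[OF c(1), of 0 \<epsilon> a] by (simp add: add_ac)
      moreover have "J1 a + J2 a = integral {0..\<epsilon>} (\<lambda>\<sigma>. ?g (\<sigma> + a))"
        unfolding J1_def J2_def by (subst integral_add[symmetric]) (auto intro!: intg continuous_intros ch simp: add_ac)
      moreover have "\<dots> = integral {a..a + \<epsilon>} ?g"
        using integral_shift_continuous[OF c(2), of 0 \<epsilon> a] by (simp add: add_ac)
      ultimately show ?thesis using incr[of a "a + \<epsilon>"] a \<epsilon> by simp
    qed
    have "\<bar>I\<bar> \<le> integral {\<alpha>..\<beta>} (\<lambda>a. C * (J1 a + J2 a))"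
      unfolding I_def real_norm_def[symmetric]
      by (rule Henstock_Kurzweil_Integration.integral_norm_bound_integral)
         (use pt cI cJ in \<open>auto intro!: intg continuous_intros\<close>)
    also have "\<dots> = C * (integral {\<alpha>..\<beta>} J1 + integral {\<alpha>..\<beta>} J2)"
      by (simp add: integral_add intg cJ)
    also have "\<dots> \<le> C * (\<epsilon> powr p * enn2real N + \<epsilon> powr p * enn2real N)"
      unfolding J1_def J2_def using fin \<epsilon> p C
      by (intro mult_left_mono add_mono near_diagonal_integral_le[where l=\<alpha> and r="\<beta> + \<delta>"] h) (auto simp: N_def)
    finally have "\<bar>I\<bar> \<le> 2 * C * enn2real N * \<epsilon> powr p" by (simp add: algebra_simps)
    then have "\<bar>(Q \<beta> \<beta> - Q \<alpha> \<alpha>) * (\<epsilon>\<^sup>2 / 2)\<bar> \<le> \<eta> * \<epsilon>\<^sup>2 + 2 * C * enn2real N * \<epsilon> powr p"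
      using t by linarith
    also have "\<epsilon> powr p = \<epsilon> powr (p - 2) * \<epsilon>\<^sup>2"
      using \<epsilon> by (simp add: powr_diff)
    finally have "\<bar>Q \<beta> \<beta> - Q \<alpha> \<alpha>\<bar> * (\<epsilon>\<^sup>2 / 2) \<le> (2 * \<eta> + 4 * C * enn2real N * \<epsilon> powr (p - 2)) * (\<epsilon>\<^sup>2 / 2)"
      unfolding abs_mult[of _ "\<epsilon>\<^sup>2 / 2"] by (simp add: algebra_simps)
    then show ?thesis using \<epsilon>(1) by (simp add: mult_le_cancel_right)
  qed
  have "\<bar>Q \<beta> \<beta> - Q \<alpha> \<alpha>\<bar> \<le> 0 + e" if e: "e > 0" for e
  proof -
    have lim: "((\<lambda>\<epsilon>. 4 * C * enn2real N * \<epsilon> powr (p - 2)) \<longlongrightarrow> 4 * C * enn2real N * 0) (at_right 0)"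
      using p by (intro tendsto_intros tendsto_zero_powrI[where b="p - 2"])
        (auto simp: eventually_at_right_field intro: exI[of _ 1] tendsto_ident_at)
    then have ev1: "\<forall>\<^sub>F \<epsilon> in at_right 0. 4 * C * enn2real N * \<epsilon> powr (p - 2) < e / 2"
      using e by (intro order_tendstoD(2)) auto
    have "\<exists>r>0. \<forall>x y. \<bar>x - c\<bar> < r \<and> \<bar>y - c\<bar> < r \<longrightarrow> \<bar>Q x y - Q c c\<bar> \<le> e / 4" for c
    proof -
      have "isCont (\<lambda>(s, t). Q s t) (c, c)" using Q by (simp add: continuous_on_eq_continuous_at)
      then obtain r where r: "r > 0" "\<And>z. dist z (c, c) < r \<Longrightarrow> dist (case z of (s, t) \<Rightarrow> Q s t) (Q c c) < e / 4"
        using e unfolding continuous_at_eps_delta by (metis case_prod_conv divide_pos_pos zero_less_numeral)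
      have "\<bar>Q x y - Q c c\<bar> \<le> e / 4" if "\<bar>x - c\<bar> < r / 2" "\<bar>y - c\<bar> < r / 2" for x y
      proof -
        have "dist (x, y) (c, c) \<le> dist x c + dist y c"
          unfolding dist_Pair_Pair by (rule sqrt_sum_squares_le_sum) auto
        then show ?thesis using r(2)[of "(x, y)"] that by (auto simp: dist_real_def)
      qed
      then show ?thesis using r(1) half_gt_zero by blast
    qed
    then obtain r where r: "\<And>c. r c > 0" "\<And>c x y. \<bar>x - c\<bar> < r c \<Longrightarrow> \<bar>y - c\<bar> < r c \<Longrightarrow> \<bar>Q x y - Q c c\<bar> \<le> e / 4" by metis
    \<comment> \<open>Both coordinates x and x + \<sigma> lie within 2 \<epsilon> of the corner,
      hence the division by 2.\<close>
    define m where "m = min \<delta> (min (r \<alpha>) (r \<beta>) / 2)"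
    have "m > 0" using r(1)[of \<alpha>] r(1)[of \<beta>] \<delta> by (auto simp: m_def)
    then have "\<forall>\<^sub>F \<epsilon> in at_right 0. \<epsilon> < m \<and> \<epsilon> > 0"
      by (auto simp: eventually_at_right_field intro: exI[of _ m])
    with ev1 have "\<forall>\<^sub>F \<epsilon> in at_right 0. 4 * C * enn2real N * \<epsilon> powr (p - 2) < e / 2 \<and> \<epsilon> < m \<and> \<epsilon> > 0"
      by eventually_elim auto
    then obtain \<epsilon> where \<epsilon>: "4 * C * enn2real N * \<epsilon> powr (p - 2) < e / 2" "\<epsilon> < m" "\<epsilon> > 0"
      using eventually_happens[of _ "at_right (0::real)"] trivial_limit_at_right_real by blast
    have "\<bar>Q \<beta> \<beta> - Q \<alpha> \<alpha>\<bar> \<le> 2 * (e / 4) + 4 * C * enn2real N * \<epsilon> powr (p - 2)"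
    proof (rule main)
      show "\<epsilon> > 0" "\<epsilon> \<le> \<delta>" using \<epsilon> by (auto simp: m_def)
      fix c x \<sigma> assume *: "c \<in> {\<alpha>, \<beta>}" "x \<in> {c..c + \<epsilon>}" "\<sigma> \<in> {0..\<epsilon>}"
      have "2 * \<epsilon> < r c" using * \<epsilon> by (auto simp: m_def)
      then show "\<bar>Q x (x + \<sigma>) - Q c c\<bar> \<le> e / 4" using * by (intro r(2)) auto
    qed
    then show ?thesis using \<epsilon>(1) by linarith
  qed
  then have "\<bar>Q \<beta> \<beta> - Q \<alpha> \<alpha>\<bar> \<le> 0" by (rule field_le_epsilon)
  then show ?thesis by simp
qed

subsection \<open>The equation integrated in time\<close>

text \<open>Curves live on the whole time axis, so that continuity is meant at points and not within
  an interval; solutions are extended to it by clamping time.\<close>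

definition H1_continuous_curve :: "(real \<Rightarrow> real \<Rightarrow> complex) \<Rightarrow> bool" where
  "H1_continuous_curve U \<longleftrightarrow> (\<forall>t. H1 (U t)) \<and>
     (\<forall>t. ((\<lambda>s. H1_norm (\<lambda>x. U s x - U t x)) \<longlongrightarrow> 0) (at t))"

section \<open>Pairings and traces along an \<open>H1\<close>-continuous curve\<close>

lemma L2_mult_bound:
  assumes "L2 f" "L2 g"
  shows "norm (LINT x|lborel. f x * g x) \<le> L2_norm f * L2_norm g"
  using integral_norm_bound[of lborel "\<lambda>x. f x * g x"] L2_Cauchy_Schwarz[OF assms]
  by (simp add: norm_mult)

text \<open>Not immediate: \<open>weak_deriv\<close> of the zero function is some chosen function
  that vanishes only almost everywhere.\<close>

lemma H1_norm_diff_self: "H1 f \<Longrightarrow> H1_norm (\<lambda>x. f x - f x) = 0"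
  using L2_norm_weak_deriv_diff[of f f] by (simp add: H1_norm_def) (simp add: L2_norm_def)

lemma curve_H1: "H1_continuous_curve U \<Longrightarrow> H1 (U t)"
  by (simp add: H1_continuous_curve_def)

text \<open>Passing from the punctured to the full neighbourhood filter uses that the difference at
  \<open>t\<close> has norm 0. Limits in two variables need this, because one coordinate may stay
  fixed.\<close>

lemma curve_tendsto:
  assumes "H1_continuous_curve U"
  shows "((\<lambda>s. H1_norm (\<lambda>x. U s x - U t x)) \<longlongrightarrow> 0) (nhds t)"
proof -
  have "isCont (\<lambda>s. H1_norm (\<lambda>x. U s x - U t x)) t"
    using assms H1_norm_diff_self[OF curve_H1[OF assms]] by (simp add: isCont_def H1_continuous_curve_def)
  then show ?thesis
    using H1_norm_diff_self[OF curve_H1[OF assms]]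
      tendsto_at_iff_tendsto_nhds[of "\<lambda>s. H1_norm (\<lambda>x. U s x - U t x)" t]
    by (simp add: isCont_def)
qed

lemma curve_continuousI:
  fixes F :: "real \<Rightarrow> 'a::real_normed_vector"
  assumes "H1_continuous_curve U" "\<And>s t. norm (F s - F t) \<le> C * H1_norm (\<lambda>x. U s x - U t x)"
  shows "continuous_on UNIV F"
proof -
  have "((\<lambda>s. norm (F s - F t)) \<longlongrightarrow> 0) (nhds t)" for t
  proof (rule tendsto_sandwich[OF _ _ tendsto_const])
    show "((\<lambda>s. C * H1_norm (\<lambda>x. U s x - U t x)) \<longlongrightarrow> 0) (nhds t)"
      using tendsto_mult[OF tendsto_const curve_tendsto[OF assms(1)], of C t] by simp
  qed (use assms(2) in auto)
  then have "(F \<longlongrightarrow> F t) (nhds t)" for t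
    by (rule LIM_zero_cancel[OF tendsto_norm_zero_cancel])
  then have "(F \<longlongrightarrow> F t) (at t)" for t
    by (rule tendsto_mono[OF at_within_le_nhds])
  then show ?thesis by (simp add: continuous_on_eq_continuous_at isCont_def)
qed

lemma curve_point_continuous:
  assumes "H1_continuous_curve U"
  shows "continuous_on UNIV (\<lambda>t. U t 0)"
proof (rule curve_continuousI[OF assms, where C="sqrt 2"])
  fix s t
  have "(norm (U s 0 - U t 0))\<^sup>2 \<le> 2 * (H1_norm (\<lambda>x. U s x - U t x))\<^sup>2"
    by (rule H1_point_le_H1_norm[OF H1_diff(1)]) (simp_all add: curve_H1[OF assms])
  then have "sqrt ((norm (U s 0 - U t 0))\<^sup>2) \<le> sqrt (2 * (H1_norm (\<lambda>x. U s x - U t x))\<^sup>2)"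
    by (rule real_sqrt_le_mono)
  moreover have "H1_norm f \<ge> 0" for f by (simp add: H1_norm_def)
  ultimately show "norm (U s 0 - U t 0) \<le> sqrt 2 * H1_norm (\<lambda>x. U s x - U t x)"
    by (simp add: real_sqrt_mult)
qed

lemma curve_pairing_continuous:
  assumes U: "H1_continuous_curve U" and g: "L2 g"
  shows "continuous_on UNIV (\<lambda>t. LINT x|lborel. U t x * g x)"
    "continuous_on UNIV (\<lambda>t. LINT x|lborel. weak_deriv (U t) x * g x)"
proof -
  note H = curve_H1[OF U]
  show "continuous_on UNIV (\<lambda>t. LINT x|lborel. U t x * g x)"
  proof (rule curve_continuousI[OF U, where C="L2_norm g"])
    fix s t
    have "(LINT x|lborel. U s x * g x) - (LINT x|lborel. U t x * g x) = (LINT x|lborel. (U s x - U t x) * g x)"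
      using Bochner_Integration.integral_diff[OF L2_mult_integrable(1)[OF H1_L2[OF H] g] L2_mult_integrable(1)[OF H1_L2[OF H] g], of s t]
      by (simp add: left_diff_distrib)
    also have "norm \<dots> \<le> L2_norm (\<lambda>x. U s x - U t x) * L2_norm g"
      by (intro L2_mult_bound g L2_diff H1_L2 H)
    also have "\<dots> \<le> H1_norm (\<lambda>x. U s x - U t x) * L2_norm g"
      by (intro mult_right_mono L2_norm_le_H1_norm L2_norm_nonneg)
    finally show "norm ((LINT x|lborel. U s x * g x) - (LINT x|lborel. U t x * g x)) \<le> L2_norm g * H1_norm (\<lambda>x. U s x - U t x)"
      by (simp add: mult.commute)
  qed
  show "continuous_on UNIV (\<lambda>t. LINT x|lborel. weak_deriv (U t) x * g x)"
  proof (rule curve_continuousI[OF U, where C="L2_norm g"])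
    fix s t
    have "(LINT x|lborel. weak_deriv (U s) x * g x) - (LINT x|lborel. weak_deriv (U t) x * g x) = (LINT x|lborel. (weak_deriv (U s) x - weak_deriv (U t) x) * g x)"
      using Bochner_Integration.integral_diff[OF L2_mult_integrable(1)[OF L2_weak_deriv[OF H] g] L2_mult_integrable(1)[OF L2_weak_deriv[OF H] g], of s t]
      by (simp add: left_diff_distrib)
    also have "norm \<dots> \<le> L2_norm (\<lambda>x. weak_deriv (U s) x - weak_deriv (U t) x) * L2_norm g"
      by (intro L2_mult_bound g L2_diff L2_weak_deriv H)
    also have "\<dots> \<le> H1_norm (\<lambda>x. U s x - U t x) * L2_norm g"
      unfolding L2_norm_weak_deriv_diff[OF H H] by (intro mult_right_mono L2_norm_le_H1_norm L2_norm_nonneg)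
    finally show "norm ((LINT x|lborel. weak_deriv (U s) x * g x) - (LINT x|lborel. weak_deriv (U t) x * g x)) \<le> L2_norm g * H1_norm (\<lambda>x. U s x - U t x)"
      by (simp add: mult.commute)
  qed
qed

lemma curve_inner_continuous:
  assumes U: "H1_continuous_curve U"
  shows "continuous_on UNIV (\<lambda>(s, t). L2_inner (weak_deriv (U s)) (weak_deriv (U t)))"
proof -
  let ?w = "\<lambda>t. weak_deriv (U t)" and ?d = "\<lambda>s t. H1_norm (\<lambda>x. U s x - U t x)"
  note H = curve_H1[OF U] and L = L2_weak_deriv[OF curve_H1[OF U]]
  have b: "\<bar>L2_inner (\<lambda>x. ?w s x - ?w s0 x) g\<bar> \<le> ?d s s0 * L2_norm g" if "L2 g" for s s0 g
  proof -
    have "\<bar>L2_inner (\<lambda>x. ?w s x - ?w s0 x) g\<bar> \<le> L2_norm (\<lambda>x. ?w s x - ?w s0 x) * L2_norm g"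
      by (intro L2_inner_bound L2_diff L that)
    also have "\<dots> \<le> ?d s s0 * L2_norm g"
      unfolding L2_norm_weak_deriv_diff[OF H H] by (intro mult_right_mono L2_norm_le_H1_norm L2_norm_nonneg)
    finally show ?thesis .
  qed
  \<comment> \<open>Bilinear expansion around (s0, t0): one term quadratic in the increments and two
    linear ones.\<close>
  have est: "\<bar>L2_inner (?w s) (?w t) - L2_inner (?w s0) (?w t0)\<bar> \<le> ?d s s0 * ?d t t0 + ?d s s0 * L2_norm (?w t0) + ?d t t0 * L2_norm (?w s0)" for s t s0 t0
  proof -
    let ?ds = "\<lambda>x. ?w s x - ?w s0 x" and ?dt = "\<lambda>x. ?w t x - ?w t0 x"
    note Ld = L2_diff[OF L L]
    have "L2_inner (?w s) (?w t) - L2_inner (?w s0) (?w t0) = L2_inner ?ds ?dt + L2_inner ?ds (?w t0) + L2_inner ?dt (?w s0)"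
      using L2_inner_diff_left[OF L L L, of s s0 t] L2_inner_diff_left[OF L L Ld, of t t0 s s0] L2_inner_diff_left[OF L L L, of t t0 s0]
        L2_inner_commute[of "?w t" ?ds] L2_inner_commute[of "?w t0" ?ds] L2_inner_commute[of ?dt ?ds]
        L2_inner_commute[of "?w t" "?w s0"] L2_inner_commute[of "?w t0" "?w s0"]
      by linarith
    moreover have "\<bar>L2_inner ?ds ?dt\<bar> \<le> ?d s s0 * ?d t t0"
    proof -
      have "\<bar>L2_inner ?ds ?dt\<bar> \<le> ?d s s0 * L2_norm ?dt" by (rule b[OF Ld])
      also have "\<dots> \<le> ?d s s0 * ?d t t0"
        unfolding L2_norm_weak_deriv_diff[OF H H] by (intro mult_left_mono L2_norm_le_H1_norm) (simp add: H1_norm_def)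
      finally show ?thesis .
    qed
    ultimately show ?thesis using b[OF L, of s s0 t0] b[OF L, of t t0 s0] by linarith
  qed
  have "isCont (\<lambda>(s, t). L2_inner (?w s) (?w t)) (s0, t0)" for s0 t0
  proof -
    have f: "((\<lambda>p. ?d (fst p) s0) \<longlongrightarrow> 0) (at (s0, t0))" "((\<lambda>p. ?d (snd p) t0) \<longlongrightarrow> 0) (at (s0, t0))"
      by (rule filterlim_compose[OF curve_tendsto[OF U]], rule tendsto_eq_rhs, rule tendsto_intros, rule tendsto_ident_at, simp)+
    have "((\<lambda>p. ?d (fst p) s0 * ?d (snd p) t0 + ?d (fst p) s0 * L2_norm (?w t0) + ?d (snd p) t0 * L2_norm (?w s0)) \<longlongrightarrow>
       0 * 0 + 0 * L2_norm (?w t0) + 0 * L2_norm (?w s0)) (at (s0, t0))"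
      by (intro tendsto_intros f)
    then have "((\<lambda>p. \<bar>L2_inner (?w (fst p)) (?w (snd p)) - L2_inner (?w s0) (?w t0)\<bar>) \<longlongrightarrow> 0) (at (s0, t0))"
      by (rule tendsto_sandwich[OF _ _ tendsto_const, rotated 2, OF tendsto_eq_rhs]) (use est in auto)
    then have "((\<lambda>p. L2_inner (?w (fst p)) (?w (snd p))) \<longlongrightarrow> L2_inner (?w s0) (?w t0)) (at (s0, t0))"
      by (rule LIM_zero_cancel[OF tendsto_rabs_zero_cancel])
    then show ?thesis by (simp add: isCont_def split_beta')
  qed
  then show ?thesis by (auto simp: continuous_on_eq_continuous_at)
qed

section \<open>Compactly supported weights and product test functions\<close>

lemma continuous_compact_support_integrable:
  fixes f :: "real \<Rightarrow> complex"
  assumes "continuous_on {a..b} f" "\<And>x. x \<notin> {a..b} \<Longrightarrow> f x = 0"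
  shows "integrable lborel f"
proof -
  have "(\<lambda>x. indicator {a..b} x *\<^sub>R f x) = f" using assms(2) by (auto simp: indicator_def)
  then show ?thesis using borel_integrable_atLeastAtMost'[OF assms(1)] by (simp add: set_integrable_def)
qed

lemma continuous_support_L2:
  assumes "continuous_on UNIV \<zeta>" "\<And>x::real. x \<notin> {a..b} \<Longrightarrow> \<zeta> x = 0"
  shows "L2 (\<lambda>x. of_real (\<zeta> x))"
proof -
  have "integrable lborel (\<lambda>x. of_real ((\<zeta> x)\<^sup>2) :: complex)"
    by (rule continuous_compact_support_integrable[of a b])
       (use assms in \<open>auto intro!: continuous_intros intro: continuous_on_subset\<close>)
  then have "integrable lborel (\<lambda>x. Re (of_real ((\<zeta> x)\<^sup>2)))" by (rule integrable_Re)
  moreover have [measurable]: "\<zeta> \<in> borel_measurable borel" using assms(1) by (rule borel_measurable_continuous_onI)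
  ultimately show ?thesis by (simp add: L2_def)
qed

lemma test_function_deriv:
  assumes "smooth \<zeta>" "\<And>x. x \<notin> {a..b} \<Longrightarrow> \<zeta> x = 0"
  shows "test_function (deriv \<zeta>)"
  by (rule test_functionI[OF smooth_deriv[OF assms(1)], where a=a and b=b]) (rule deriv_eq_0_outside[OF assms(2)])

lemma test_function2_product:
  assumes \<eta>: "smooth \<eta>" "\<And>t. t \<notin> {a..b} \<Longrightarrow> \<eta> t = 0" and \<zeta>: "smooth \<zeta>" "\<And>x. x \<notin> {c..e} \<Longrightarrow> \<zeta> x = 0"
    and sub: "{a..b} \<times> {c..e} \<subseteq> \<Omega>"
  shows "test_function2 \<Omega> (\<lambda>t x. \<eta> t * \<zeta> x)"
proof -
  have hd: "(((deriv ^^ k) f) has_real_derivative (deriv ^^ Suc k) f x) (at x)" if "smooth f" for k f x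
    using that by (simp add: smooth_def field_differentiable_derivI)
  have c: "continuous_on A (\<lambda>z. (deriv ^^ k) f (g z))" if "smooth f" "continuous_on A g" for k f g and A :: "(real \<times> real) set"
    by (rule continuous_on_compose2[OF _ that(2), of UNIV]) (use hd[OF that(1)] in \<open>auto intro: DERIV_continuous_on\<close>)
  have "compact ({a..b} \<times> {c..e})" by (intro compact_Times compact_Icc)
  moreover have "\<forall>t x. (t, x) \<notin> {a..b} \<times> {c..e} \<longrightarrow> \<eta> t * \<zeta> x = 0" using \<eta> \<zeta> by auto
  moreover have "(\<lambda>j k t x. (deriv ^^ j) \<eta> t * (deriv ^^ k) \<zeta> x) 0 0 = (\<lambda>t x. \<eta> t * \<zeta> x)" by simp
  moreover have "continuous_on UNIV (\<lambda>(t, x). (deriv ^^ j) \<eta> t * (deriv ^^ k) \<zeta> x)" for j k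
    unfolding split_beta' by (intro continuous_intros c \<eta> \<zeta>)
  moreover have "((\<lambda>s. (deriv ^^ j) \<eta> s * (deriv ^^ k) \<zeta> x) has_real_derivative (deriv ^^ Suc j) \<eta> t * (deriv ^^ k) \<zeta> x) (at t)"
     "((\<lambda>y. (deriv ^^ j) \<eta> t * (deriv ^^ k) \<zeta> y) has_real_derivative (deriv ^^ j) \<eta> t * (deriv ^^ Suc k) \<zeta> x) (at x)" for j k t x
    using DERIV_cmult_right[OF hd[OF \<eta>(1)]] DERIV_cmult[OF hd[OF \<zeta>(1)]] by auto
  ultimately show ?thesis unfolding test_function2_def using sub
    by (intro conjI exI[of _ "\<lambda>j k t x. (deriv ^^ j) \<eta> t * (deriv ^^ k) \<zeta> x"] exI[of _ "{a..b} \<times> {c..e}"]) auto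
qed

text \<open>Testing the equation with products $\eta(t)\zeta(x)$ shows that
  $i\,\frac{d}{dt}\int u\zeta = \int u_x\zeta'$.\<close>
lemma free_equation_time_integrated:
  assumes U: "H1_continuous_curve U" and eq: "free_equation_off_origin T u"
    and uU: "\<And>t. t \<in> {0..T} \<Longrightarrow> u t = U t"
    and ab: "0 < a" "a < b" "b < T" and \<zeta>: "smooth \<zeta>" "\<And>x. x \<notin> {c..e} \<Longrightarrow> \<zeta> x = 0" and 0: "0 \<notin> {c..e}"
  shows "(LINT x|lborel. (U b x - U a x) * of_real (\<zeta> x)) =
    - \<i> * (LINT t:{a..b}|lborel. LINT x|lborel. weak_deriv (U t) x * of_real (deriv \<zeta> x))"
proof -
  \<comment> \<open>Room for smoothing after \<open>b\<close> that still ends before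
    \<open>T\<close>.\<close>
  define d where "d = (T - b) / 2"
  have d: "d > 0" "b + d < T" using ab by (auto simp: d_def field_simps)
  have supp': "deriv \<zeta> x = 0" "deriv (deriv \<zeta>) x = 0" if "x \<notin> {c..e}" for x
    using deriv_eq_0_outside[OF \<zeta>(2)] deriv_eq_0_outside[OF deriv_eq_0_outside[OF \<zeta>(2)]] that by auto
  have L: "L2 (\<lambda>x. of_real (\<zeta> x))" "L2 (\<lambda>x. of_real (deriv \<zeta> x))" "L2 (\<lambda>x. of_real (deriv (deriv \<zeta>) x))"
    using continuous_support_L2[OF smooth_continuous[OF \<zeta>(1)] \<zeta>(2)]
      continuous_support_L2[OF smooth_continuous[OF smooth_deriv[OF \<zeta>(1)]] supp'(1)]
      continuous_support_L2[OF smooth_continuous[OF smooth_deriv[OF smooth_deriv[OF \<zeta>(1)]]] supp'(2)] by auto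
  define A where "A t = (LINT x|lborel. U t x * of_real (\<zeta> x))" for t
  define D where "D t = (LINT x|lborel. weak_deriv (U t) x * of_real (deriv \<zeta> x))" for t
  have cA: "continuous_on S A" for S unfolding A_def[abs_def] using curve_pairing_continuous(1)[OF U L(1)] continuous_on_subset by blast
  have cD: "continuous_on S D" for S unfolding D_def[abs_def] using curve_pairing_continuous(2)[OF U L(2)] continuous_on_subset by blast
  \<comment> \<open>One spatial integration by parts, namely the definition of the weak derivative
    tested with \<open>deriv \<zeta>\<close>; \<open>weak_deriv\<close> itself is never
    differentiated.\<close>
  have D2: "(LINT x|lborel. U t x * of_real (deriv (deriv \<zeta>) x)) = - D t" for t
    using H1_weak_deriv(2)[OF curve_H1[OF U, of t]] test_function_deriv[OF \<zeta>] unfolding has_weak_deriv_def D_def by blast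
  have "(LINT t:{a..b}|lborel. - \<i> * D t) = A b - A a"
  proof (rule weak_derivative_imp_FTC[OF ab(2) d(1) cA])
    show "set_integrable lborel {a..b + d} (\<lambda>t. - \<i> * D t)"
      by (intro borel_integrable_atLeastAtMost' continuous_intros cD)
    fix \<eta> assume "test_function \<eta>" and \<eta>0: "\<And>t. t \<notin> {a..b + d} \<Longrightarrow> \<eta> t = 0"
    have \<eta>: "smooth \<eta>" using \<open>test_function \<eta>\<close> by (rule test_functionD)
    have \<eta>0': "deriv \<eta> t = 0" if "t \<notin> {a..b + d}" for t using deriv_eq_0_outside[OF \<eta>0 that] .
    have tf: "test_function2 ({0<..<T} \<times> (- {0})) (\<lambda>t x. \<eta> t * \<zeta> x)"
      by (rule test_function2_product[OF \<eta> \<eta>0 \<zeta>]) (use ab d 0 in auto)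
    have inner: "(LINT x|lborel. u t x * (- \<i> * of_real (deriv (\<lambda>s. \<eta> s * \<zeta> x) t) + of_real ((deriv ^^ 2) (\<lambda>y. \<eta> t * \<zeta> y) x)))
       = - \<i> * (A t * of_real (deriv \<eta> t)) - D t * of_real (\<eta> t)" for t
    proof -
      have d1: "deriv (\<lambda>s. \<eta> s * \<zeta> x) t = deriv \<eta> t * \<zeta> x" for x
        by (rule DERIV_imp_deriv) (use DERIV_mult[OF smooth_has_deriv[OF \<eta>] DERIV_const] in auto)
      have "deriv (\<lambda>y. c * f y) = (\<lambda>x. c * deriv f x)" if "smooth f" for c f
        using DERIV_imp_deriv[OF DERIV_cmult[OF smooth_has_deriv[OF that]]] by auto
      then have d2: "(deriv ^^ 2) (\<lambda>y. \<eta> t * \<zeta> y) x = \<eta> t * deriv (deriv \<zeta>) x" for x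
        using \<zeta>(1) smooth_deriv by (simp add: numeral_2_eq_2)
      show ?thesis
      proof (cases "t \<in> {a..b + d}")
        case False
        then show ?thesis unfolding d1 d2 using \<eta>0 \<eta>0' by simp
      next
        case True
        then have "u t = U t" using ab d by (intro uU) auto
        then have "(LINT x|lborel. u t x * (- \<i> * of_real (deriv (\<lambda>s. \<eta> s * \<zeta> x) t) + of_real ((deriv ^^ 2) (\<lambda>y. \<eta> t * \<zeta> y) x))) =
          (LINT x|lborel. (- \<i> * of_real (deriv \<eta> t)) * (U t x * of_real (\<zeta> x)) + of_real (\<eta> t) * (U t x * of_real (deriv (deriv \<zeta>) x)))"
          unfolding d1 d2 by (intro Bochner_Integration.integral_cong) (auto simp: algebra_simps)
        also have "\<dots> = (- \<i> * of_real (deriv \<eta> t)) * A t + of_real (\<eta> t) * (- D t)"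
          unfolding A_def D2[symmetric] integral_mult_right_zero[symmetric]
          by (intro Bochner_Integration.integral_add integrable_mult_right L2_mult_integrable(1) L H1_L2 curve_H1[OF U])
        also have "\<dots> = - \<i> * (A t * of_real (deriv \<eta> t)) - D t * of_real (\<eta> t)" by (simp add: algebra_simps)
        finally show ?thesis .
      qed
    qed
    have iA: "integrable lborel (\<lambda>t. A t * of_real (deriv \<eta> t))"
      by (rule continuous_compact_support_integrable[of a "b + d"])
         (use \<eta>0' in \<open>auto intro!: continuous_intros cA smooth_continuous smooth_deriv \<eta>\<close>)
    have iD: "integrable lborel (\<lambda>t. D t * of_real (\<eta> t))"
      by (rule continuous_compact_support_integrable[of a "b + d"])
         (use \<eta>0 in \<open>auto intro!: continuous_intros cD smooth_continuous \<eta>\<close>)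
    have "(LINT t|lborel. - \<i> * (A t * of_real (deriv \<eta> t)) - D t * of_real (\<eta> t)) = 0"
      using eq tf unfolding free_equation_off_origin_def inner[symmetric] by blast
    moreover have "(LINT t|lborel. - \<i> * (A t * of_real (deriv \<eta> t)) - D t * of_real (\<eta> t)) =
        - \<i> * (LINT t|lborel. A t * of_real (deriv \<eta> t)) - (LINT t|lborel. D t * of_real (\<eta> t))"
      unfolding integral_mult_right_zero[symmetric]
      by (intro Bochner_Integration.integral_diff integrable_mult_right iA iD)
    ultimately have e: "(LINT t|lborel. D t * of_real (\<eta> t)) = - \<i> * (LINT t|lborel. A t * of_real (deriv \<eta> t))"
      by (metis eq_iff_diff_eq_0)
    have "(LINT t|lborel. - \<i> * D t * of_real (\<eta> t)) = - \<i> * (LINT t|lborel. D t * of_real (\<eta> t))"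
      unfolding integral_mult_right_zero[symmetric] by (simp only: mult.assoc)
    also have "\<dots> = (- \<i> * - \<i>) * (LINT t|lborel. A t * of_real (deriv \<eta> t))"
      unfolding e by (simp only: mult.assoc)
    also have "- \<i> * - \<i> = -1" by simp
    finally show "(LINT t|lborel. A t * of_real (deriv \<eta> t)) = - (LINT t|lborel. - \<i> * D t * of_real (\<eta> t))"
      by simp
  qed
  moreover have "(LINT x|lborel. (U b x - U a x) * of_real (\<zeta> x)) = A b - A a"
    unfolding A_def using Bochner_Integration.integral_diff[OF L2_mult_integrable(1)[OF H1_L2[OF curve_H1[OF U]] L(1)] L2_mult_integrable(1)[OF H1_L2[OF curve_H1[OF U]] L(1)], of b a]
    by (simp add: left_diff_distrib)
  moreover have "(LINT t:{a..b}|lborel. - \<i> * D t) = - \<i> * (LINT t:{a..b}|lborel. D t)"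
    by (rule set_integral_mult_right)
  ultimately show ?thesis unfolding D_def by simp
qed

subsection \<open>Pairing with a function that jumps at the origin\<close>

lemma LINT_Icc_combine:
  fixes f :: "real \<Rightarrow> complex"
  assumes "set_integrable lborel {a..c} f" "a \<le> b" "b \<le> c"
  shows "(LINT x:{a..c}|lborel. f x) = (LINT x:{a..b}|lborel. f x) + (LINT x:{b..c}|lborel. f x)"
proof -
  have "set_integrable lborel {a..b} f" "set_integrable lborel {b..c} f"
    by (rule set_integrable_subset[OF assms(1)]; use assms in auto)+
  then have "(LINT x:{a..b} \<union> {b..c}|lborel. f x) = (LINT x:{a..b}|lborel. f x) + (LINT x:{b..c}|lborel. f x)"
    by (intro set_integral_Un_AE) (use AE_lborel_singleton[of b] in \<open>auto elim!: eventually_mono\<close>)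
  moreover have "{a..b} \<union> {b..c} = {a..c}" using assms by auto
  ultimately show ?thesis by simp
qed

lemma LINT_Icc_cong_AE_singleton:
  fixes f g :: "real \<Rightarrow> complex"
  assumes "set_integrable lborel {a..b} f" "\<And>x. x \<in> {a..b} \<Longrightarrow> x \<noteq> c \<Longrightarrow> f x = g x"
    "set_integrable lborel {a..b} g"
  shows "(LINT x:{a..b}|lborel. f x) = (LINT x:{a..b}|lborel. g x)"
  unfolding set_lebesgue_integral_def
proof (rule integral_cong_AE)
  show "AE x in lborel. indicator {a..b} x *\<^sub>R f x = indicator {a..b} x *\<^sub>R g x"
    using AE_lborel_singleton[of c] by eventually_elim (use assms(2) in \<open>auto simp: indicator_def\<close>)
qed (use assms in \<open>auto simp: set_integrable_def\<close>)

text \<open>A nonzero limit would force |f| >= |L|/2 on arbitrarily long intervals. This disposes of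
  boundary terms at infinity that are integrable but have no known decay.\<close>

lemma integrable_tendsto_at_top_imp_0:
  fixes f :: "real \<Rightarrow> real"
  assumes f: "integrable lborel f" and lim: "(f \<longlongrightarrow> L) at_top"
  shows "L = 0"
proof (rule ccontr)
  assume "L \<noteq> 0"
  then have "\<forall>\<^sub>F x in at_top. dist (f x) L < \<bar>L\<bar> / 2" using lim by (intro tendstoD) auto
  then obtain R where R: "\<And>x. x \<ge> R \<Longrightarrow> \<bar>f x - L\<bar> < \<bar>L\<bar> / 2" by (auto simp: eventually_at_top_linorder dist_real_def)
  have "real n * (\<bar>L\<bar> / 2) \<le> (LINT x|lborel. \<bar>f x\<bar>)" for n
  proof -
    have "real n * (\<bar>L\<bar> / 2) = (LINT x|lborel. indicator {R..R + real n} x * (\<bar>L\<bar> / 2))" by simp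
    also have "\<dots> \<le> (LINT x|lborel. \<bar>f x\<bar>)"
    proof (rule integral_mono)
      show "indicator {R..R + real n} x * (\<bar>L\<bar> / 2) \<le> \<bar>f x\<bar>" for x
      proof (cases "x \<in> {R..R + real n}")
        case True
        then have "\<bar>f x - L\<bar> < \<bar>L\<bar> / 2" by (intro R) simp
        then have "\<bar>L\<bar> / 2 \<le> \<bar>f x\<bar>" by arith
        with True show ?thesis by simp
      qed simp
    qed (use f in \<open>auto intro!: integrable_real_mult_indicator simp: emeasure_lborel_Icc_eq\<close>)
    finally show ?thesis .
  qed
  moreover obtain n :: nat where "real n * (\<bar>L\<bar> / 2) > (LINT x|lborel. \<bar>f x\<bar>)"
    using reals_Archimedean3[of "\<bar>L\<bar> / 2"] \<open>L \<noteq> 0\<close> by auto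
  ultimately show False using leD by blast
qed

text \<open>Integration by parts against a primitive of $-i\varphi$: the other term $|\varphi|^2$ has no real part
  after multiplication by $i$.\<close>
lemma Re_integral_by_parts_primitive:
  fixes W \<phi> \<phi>' :: "real \<Rightarrow> complex"
  assumes W: "\<And>x. x \<in> {l..r} \<Longrightarrow> W x = W l - (LINT z:{l..x}|lborel. \<i> * \<phi> z)" and lr: "l \<le> r"
    and \<phi>: "continuous_on UNIV \<phi>" and \<phi>'i: "set_integrable lborel {l..r} \<phi>'"
    and FTC: "\<And>a b. a \<le> b \<Longrightarrow> (LINT x:{a..b}|lborel. \<phi>' x) = \<phi> b - \<phi> a"
  shows "set_integrable lborel {l..r} (\<lambda>x. W x * cnj (\<phi>' x))"
    "Re (LINT x:{l..r}|lborel. W x * cnj (\<phi>' x)) = Re (W r * cnj (\<phi> r)) - Re (W l * cnj (\<phi> l))"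
proof -
  have f: "set_integrable lborel {l..r} (\<lambda>x. - (\<i> * \<phi> x))"
    by (rule borel_integrable_atLeastAtMost') (intro continuous_intros continuous_on_subset[OF \<phi>] subset_UNIV)
  have g: "set_integrable lborel {l..r} (\<lambda>x. cnj (\<phi>' x))"
    using integrable_cnj[of lborel "\<lambda>x. indicator {l..r} x *\<^sub>R \<phi>' x"] \<phi>'i by (simp add: set_integrable_def)
  have F: "W x = W l + (LINT y:{l..x}|lborel. - (\<i> * \<phi> y))" if "x \<in> {l..r}" for x
    using W[OF that] by (simp only: set_lebesgue_integral_def scaleR_minus_right Bochner_Integration.integral_minus diff_conv_add_uminus)
  have G: "cnj (\<phi> x) = cnj (\<phi> l) + (LINT y:{l..x}|lborel. cnj (\<phi>' y))" if "x \<in> {l..r}" for x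
  proof -
    have "(LINT y:{l..x}|lborel. cnj (\<phi>' y)) = cnj (LINT y:{l..x}|lborel. \<phi>' y)"
      using Bochner_Integration.integral_cnj[of lborel "\<lambda>y. indicator {l..x} y *\<^sub>R \<phi>' y"] by (simp add: set_lebesgue_integral_def)
    then show ?thesis using FTC[of l x] that by simp
  qed
  note ibp = integral_by_parts_lborel[where G="\<lambda>x. cnj (\<phi> x)", OF lr f g F G]
  show "set_integrable lborel {l..r} (\<lambda>x. W x * cnj (\<phi>' x))" by (rule ibp(2))
  have "Re (LINT x:{l..r}|lborel. - (\<i> * \<phi> x) * cnj (\<phi> x)) = (LINT x|lborel. Re (indicator {l..r} x *\<^sub>R (- (\<i> * \<phi> x) * cnj (\<phi> x))))"
    using ibp(1) by (simp only: set_lebesgue_integral_def set_integrable_def integral_Re)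
  also have "\<dots> = 0" by (simp add: algebra_simps)
  finally have "Re (LINT x:{l..r}|lborel. - (\<i> * \<phi> x) * cnj (\<phi> x)) = 0" .
  then show "Re (LINT x:{l..r}|lborel. W x * cnj (\<phi>' x)) = Re (W r * cnj (\<phi> r)) - Re (W l * cnj (\<phi> l))"
    using arg_cong[OF ibp(3), of Re] by simp
qed

text \<open>The two half-lines are treated separately. At 0 the boundary terms combine to the jump;
  at R and -R they form P(R) - P(-R), which converges because the integrals do and is integrable by
  \<open>i2\<close>, so that its limit is 0.\<close>

lemma Re_pairing_with_jump:
  fixes W \<phi> \<phi>' :: "real \<Rightarrow> complex"
  assumes W: "\<And>x y. x < y \<Longrightarrow> 0 < x \<or> y < 0 \<Longrightarrow> W y - W x = - (LINT z:{x..y}|lborel. \<i> * \<phi> z)"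
    and lim: "(W \<longlongrightarrow> cp) (at_right 0)" "(W \<longlongrightarrow> cm) (at_left 0)"
    and \<phi>: "continuous_on UNIV \<phi>" and \<phi>'i: "\<And>l r. set_integrable lborel {l..r} \<phi>'"
    and FTC: "\<And>a b. a \<le> b \<Longrightarrow> (LINT x:{a..b}|lborel. \<phi>' x) = \<phi> b - \<phi> a"
    and i1: "integrable lborel (\<lambda>x. W x * cnj (\<phi>' x))" and i2: "integrable lborel (\<lambda>x. W x * cnj (\<phi> x))"
  shows "Re (LINT x|lborel. W x * cnj (\<phi>' x)) = Re ((cm - cp) * cnj (\<phi> 0))"
proof -
  define \<Phi> where "\<Phi> a b = (LINT z:{a..b}|lborel. \<i> * \<phi> z)" for a b
  have cphi: "continuous_on A (\<lambda>z. \<i> * \<phi> z)" for A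
    by (intro continuous_intros continuous_on_subset[OF \<phi>]) auto
  have si: "set_integrable lborel {a..b} (\<lambda>z. \<i> * \<phi> z)" for a b
    by (rule borel_integrable_atLeastAtMost'[OF cphi])
  have add: "\<Phi> a c = \<Phi> a b + \<Phi> b c" if "a \<le> b" "b \<le> c" for a b c
    unfolding \<Phi>_def by (rule LINT_Icc_combine[OF si that])
  have c\<Phi>: "continuous_on {a..b} (\<lambda>x. \<Phi> a x)" for a b
  proof -
    have "continuous_on {a..b} (\<lambda>x. integral {a..x} (\<lambda>z. \<i> * \<phi> z))"
      by (rule indefinite_integral_continuous_1[OF integrable_continuous_real[OF cphi]])
    then show ?thesis unfolding \<Phi>_def by (simp only: LINT_eq_integral_continuous[OF cphi])
  qed
  have \<Phi>0: "\<Phi> a a = 0" for a unfolding \<Phi>_def LINT_eq_integral_continuous[OF cphi] by simp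
  have i1s: "set_integrable lborel {a..b} (\<lambda>x. W x * cnj (\<phi>' x))" for a b
    unfolding set_integrable_def by (rule integrable_mult_indicator[OF _ i1]) simp
  have right: "Re (LINT x:{0..R}|lborel. W x * cnj (\<phi>' x)) = Re (W R * cnj (\<phi> R)) - Re (cp * cnj (\<phi> 0))" if R: "R > 0" for R
  proof -
    \<comment> \<open>The value of \<open>W\<close> at 0 is unrelated to its limits and is replaced
      by the one-sided limit; integrals do not see the change.\<close>
    define W' where "W' x = (if x = 0 then cp else W x)" for x
    have "W' x = W' 0 - \<Phi> 0 x" if x: "x \<in> {0..R}" for x
    proof (cases "x = 0")
      case False
      then have "x > 0" using x by auto
      have "((\<lambda>y. W x + \<Phi> 0 x - \<Phi> 0 y) \<longlongrightarrow> W x + \<Phi> 0 x - \<Phi> 0 0) (at_right 0)"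
      proof (intro tendsto_intros)
        have "(\<Phi> 0 \<longlongrightarrow> \<Phi> 0 0) (at 0 within {0..x})" using c\<Phi>[of 0 x] \<open>x > 0\<close> by (auto simp: continuous_on_def)
        then show "(\<Phi> 0 \<longlongrightarrow> \<Phi> 0 0) (at_right 0)"
          using \<open>x > 0\<close> by (simp add: at_within_Icc_at_right)
      qed
      moreover have "\<forall>\<^sub>F y in at_right 0. W x + \<Phi> 0 x - \<Phi> 0 y = W y"
        unfolding eventually_at_right_field
      proof (intro exI[of _ x] conjI allI impI \<open>x > 0\<close>)
        fix y assume "0 < y" "y < x"
        then show "W x + \<Phi> 0 x - \<Phi> 0 y = W y" using W[of y x] add[of 0 y x] by (simp add: \<Phi>_def algebra_simps)
      qed
      ultimately have "(W \<longlongrightarrow> W x + \<Phi> 0 x - \<Phi> 0 0) (at_right 0)" by (rule Lim_transform_eventually)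
      then have "cp = W x + \<Phi> 0 x - \<Phi> 0 0" using tendsto_unique[OF _ lim(1)] by fastforce
      then show ?thesis using False \<Phi>0 by (simp add: W'_def)
    qed (simp add: \<Phi>0)
    then have p: "W' x = W' 0 - (LINT z:{0..x}|lborel. \<i> * \<phi> z)" if "x \<in> {0..R}" for x using that unfolding \<Phi>_def by blast
    note b = Re_integral_by_parts_primitive[OF p less_imp_le[OF R] \<phi> \<phi>'i FTC]
    have "(LINT x:{0..R}|lborel. W x * cnj (\<phi>' x)) = (LINT x:{0..R}|lborel. W' x * cnj (\<phi>' x))"
      by (rule LINT_Icc_cong_AE_singleton[where c=0, OF i1s _ b(1)]) (auto simp: W'_def)
    then show ?thesis using b(2) R by (simp only: W'_def) simp
  qed
  have left: "Re (LINT x:{-R..0}|lborel. W x * cnj (\<phi>' x)) = Re (cm * cnj (\<phi> 0)) - Re (W (-R) * cnj (\<phi> (-R)))" if R: "R > 0" for R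
  proof -
    define W' where "W' x = (if x = 0 then cm else W x)" for x
    have "W' x = W' (-R) - \<Phi> (-R) x" if x: "x \<in> {-R..0}" for x
    proof -
      have neg: "W y = W (-R) - \<Phi> (-R) y" if "y < 0" "y \<ge> -R" for y
        using W[of "-R" y] that \<Phi>0 by (cases "y = -R") (auto simp: \<Phi>_def algebra_simps)
      show ?thesis
      proof (cases "x = 0")
        case True
        have "((\<lambda>y. W (-R) - \<Phi> (-R) y) \<longlongrightarrow> W (-R) - \<Phi> (-R) 0) (at_left 0)"
        proof (intro tendsto_intros)
          have "(\<Phi> (-R) \<longlongrightarrow> \<Phi> (-R) 0) (at 0 within {-R..0})" using c\<Phi>[of "-R" 0] R by (auto simp: continuous_on_def)
          then show "(\<Phi> (-R) \<longlongrightarrow> \<Phi> (-R) 0) (at_left 0)"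
            using R by (simp add: at_within_Icc_at_left)
        qed
        moreover have "\<forall>\<^sub>F y in at_left 0. W (-R) - \<Phi> (-R) y = W y"
          unfolding eventually_at_left_field
        proof (intro exI[of _ "-R"] conjI allI impI)
          fix y assume "- R < y" "y < 0"
          then show "W (-R) - \<Phi> (-R) y = W y" using neg[of y] by simp
        qed (use R in simp)
        ultimately have "(W \<longlongrightarrow> W (-R) - \<Phi> (-R) 0) (at_left 0)" by (rule Lim_transform_eventually)
        then have "cm = W (-R) - \<Phi> (-R) 0" using tendsto_unique[OF _ lim(2)] by fastforce
        then show ?thesis using True R by (simp add: W'_def)
      next
        case False
        then show ?thesis using neg[of x] x R by (auto simp: W'_def)
      qed
    qed
    then have p: "W' x = W' (-R) - (LINT z:{-R..x}|lborel. \<i> * \<phi> z)" if "x \<in> {-R..0}" for x using that unfolding \<Phi>_def by blast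
    have R': "-R \<le> 0" using R by simp
    note b = Re_integral_by_parts_primitive[OF p R' \<phi> \<phi>'i FTC]
    have "(LINT x:{-R..0}|lborel. W x * cnj (\<phi>' x)) = (LINT x:{-R..0}|lborel. W' x * cnj (\<phi>' x))"
      by (rule LINT_Icc_cong_AE_singleton[where c=0, OF i1s _ b(1)]) (auto simp: W'_def)
    then show ?thesis using b(2) R by (simp only: W'_def) simp
  qed
  define P where "P x = Re (W x * cnj (\<phi> x))" for x
  have P: "integrable lborel P" unfolding P_def[abs_def] by (rule integrable_Re[OF i2])
  then have D: "integrable lborel (\<lambda>R. P R - P (- R))"
    using lborel_integrable_real_affine[OF P, of "-1" 0] by simp
  have "((\<lambda>R. LINT x:{-R..R}|lborel. W x * cnj (\<phi>' x)) \<longlongrightarrow> (LINT x|lborel. W x * cnj (\<phi>' x))) at_top"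
    unfolding set_lebesgue_integral_def
  proof (rule integral_dominated_convergence_at_top[where w="\<lambda>x. norm (W x * cnj (\<phi>' x))"])
    show "AE x in lborel. ((\<lambda>R. indicator {-R..R} x *\<^sub>R (W x * cnj (\<phi>' x))) \<longlongrightarrow> W x * cnj (\<phi>' x)) at_top"
    proof (rule AE_I2, rule tendsto_eventually)
      fix x :: real
      show "\<forall>\<^sub>F R in at_top. indicator {-R..R} x *\<^sub>R (W x * cnj (\<phi>' x)) = W x * cnj (\<phi>' x)"
        using eventually_ge_at_top[of "\<bar>x\<bar>"] by eventually_elim (auto simp: indicator_def)
    qed
  qed (use i1 in \<open>auto simp: indicator_def\<close>)
  then have lim1: "((\<lambda>R. Re (LINT x:{-R..R}|lborel. W x * cnj (\<phi>' x))) \<longlongrightarrow> Re (LINT x|lborel. W x * cnj (\<phi>' x))) at_top"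
    by (rule tendsto_Re)
  \<comment> \<open>The limit is the difference of the two sides of the claim, and integrability
    forces it to be 0.\<close>
  have "((\<lambda>R. P R - P (- R)) \<longlongrightarrow> Re (LINT x|lborel. W x * cnj (\<phi>' x)) - Re ((cm - cp) * cnj (\<phi> 0))) at_top"
  proof (rule Lim_transform_eventually[OF tendsto_diff[OF lim1 tendsto_const]])
    show "\<forall>\<^sub>F R in at_top. Re (LINT x:{-R..R}|lborel. W x * cnj (\<phi>' x)) - Re ((cm - cp) * cnj (\<phi> 0)) = P R - P (- R)"
      using eventually_gt_at_top[of 0]
    proof eventually_elim
      case (elim R)
      then show ?case
        using left[OF elim] right[OF elim] LINT_Icc_combine[OF i1s, of "-R" 0 R] by (simp add: P_def algebra_simps)
    qed
  qed
  from integrable_tendsto_at_top_imp_0[OF D this] show ?thesis by simp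
qed

subsection \<open>Conservation of energy\<close>

lemma L2_cnj: "L2 f \<Longrightarrow> L2 (\<lambda>x. cnj (f x))"
  by (auto simp: L2_def intro: borel_measurable_cnj)

text \<open>\<open>v\<close> agrees with \<open>weak_deriv (U t)\<close> only for almost every t and
  x, but it is jointly measurable, as Fubini requires; derivatives chosen slice by slice give no
  such information.\<close>

lemma curve_derivative_Fubini:
  fixes v :: "real \<Rightarrow> real \<Rightarrow> complex"
  assumes U: "H1_continuous_curve U" and g: "L2 g"
    and v: "(\<lambda>(x, t). v x t) \<in> borel_measurable (borel :: (real \<times> real) measure)"
    and vU: "AE t in lborel. t \<in> {a..b} \<longrightarrow> (AE x in lborel. v x t = weak_deriv (U t) x)"
  shows "integrable lborel (\<lambda>x. (LINT t:{a..b}|lborel. v x t) * g x)"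
    "(LINT x|lborel. (LINT t:{a..b}|lborel. v x t) * g x) = (LINT t:{a..b}|lborel. LINT x|lborel. weak_deriv (U t) x * g x)"
proof -
  note [measurable] = L2_measurable[OF g]
  have [measurable]: "(\<lambda>p. v (snd p) (fst p)) \<in> borel_measurable (borel \<Otimes>\<^sub>M borel)"
    using measurable_compose[of "\<lambda>p :: real \<times> real. (snd p, fst p)" "borel \<Otimes>\<^sub>M borel" "borel \<Otimes>\<^sub>M borel", OF _ v[folded borel_prod]]
    by simp
  note Lw = L2_weak_deriv[OF curve_H1[OF U]]
  define h where "h t x = indicator {a..b} t *\<^sub>R (v x t * g x)" for t x
  have hm: "(\<lambda>(t, x). h t x) \<in> borel_measurable (lborel \<Otimes>\<^sub>M lborel)"
    unfolding h_def split_beta' by measurable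
  \<comment> \<open>The norm is continuous in time, being the square root of the inner product
    kernel on the diagonal.\<close>
  obtain M where M: "\<And>t. t \<in> {a..b} \<Longrightarrow> L2_norm (weak_deriv (U t)) \<le> M"
  proof -
    have "continuous_on {a..b} (\<lambda>t. L2_inner (weak_deriv (U t)) (weak_deriv (U t)))"
      by (rule continuous_on_param2[OF curve_inner_continuous[OF U]]) (intro continuous_intros)+
    then have "continuous_on {a..b} (\<lambda>t. sqrt (L2_inner (weak_deriv (U t)) (weak_deriv (U t))))"
      by (intro continuous_intros)
    then have "continuous_on {a..b} (\<lambda>t. L2_norm (weak_deriv (U t)))"
      by (simp add: L2_inner_self L2_norm_nonneg)
    then have "bounded ((\<lambda>t. L2_norm (weak_deriv (U t))) ` {a..b})"
      by (intro compact_imp_bounded compact_continuous_image) auto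
    then obtain M where "\<forall>y\<in>(\<lambda>t. L2_norm (weak_deriv (U t))) ` {a..b}. norm y \<le> M" unfolding bounded_iff by blast
    then have "L2_norm (weak_deriv (U t)) \<le> M" if "t \<in> {a..b}" for t using that by force
    then show thesis by (rule that)
  qed
  have meas1: "(\<lambda>x. h t x) \<in> borel_measurable lborel" for t
    using measurable_compose[OF measurable_Pair1' hm, of t] by simp
  have eqAE: "AE t in lborel. (AE x in lborel. h t x = indicator {a..b} t *\<^sub>R (weak_deriv (U t) x * g x))"
    using vU
  proof eventually_elim
    case (elim t)
    show ?case
    proof (cases "t \<in> {a..b}")
      case True
      with elim have "AE x in lborel. v x t = weak_deriv (U t) x" by simp
      then show ?thesis by eventually_elim (simp add: h_def)
    qed (simp add: h_def)
  qed
  have wi: "integrable lborel (\<lambda>x. indicator {a..b} t *\<^sub>R (weak_deriv (U t) x * g x))" for t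
    by (intro integrable_scaleR_right L2_mult_integrable(1) Lw g)
  have hi: "AE t in lborel. integrable lborel (h t)"
    using eqAE
  proof eventually_elim
    case (elim t)
    then show ?case
      using integrable_cong_AE[OF meas1[of t] borel_measurable_integrable[OF wi[of t]]] wi[of t] by simp
  qed
  have int: "integrable (lborel \<Otimes>\<^sub>M lborel) (\<lambda>(t, x). h t x)"
  proof (rule lborel_pair.Fubini_integrable[OF hm])
    show "AE t in lborel. integrable lborel (\<lambda>x. case (t, x) of (t, x) \<Rightarrow> h t x)" using hi by simp
    have "integrable lborel (\<lambda>t. indicator {a..b} t * (M * L2_norm g))"
      by (intro integrable_mult_left integrable_real_indicator) (auto simp: emeasure_lborel_Icc_eq)
    then show "integrable lborel (\<lambda>t. LINT x|lborel. norm (case (t, x) of (t, x) \<Rightarrow> h t x))"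
    proof (rule Bochner_Integration.integrable_bound)
      have "(\<lambda>(t, x). norm (h t x)) \<in> borel_measurable (lborel \<Otimes>\<^sub>M lborel)"
        using measurable_compose[OF hm borel_measurable_norm] by (simp add: split_beta')
      then show "(\<lambda>t. LINT x|lborel. norm (case (t, x) of (t, x) \<Rightarrow> h t x)) \<in> borel_measurable lborel"
        using lborel.borel_measurable_lebesgue_integral[of "\<lambda>t x. norm (h t x)" lborel] by simp
      show "AE t in lborel. norm (LINT x|lborel. norm (case (t, x) of (t, x) \<Rightarrow> h t x)) \<le> norm (indicator {a..b} t * (M * L2_norm g))"
        using eqAE
      proof eventually_elim
        case (elim t)
        have "(LINT x|lborel. norm (h t x)) = (LINT x|lborel. norm (indicator {a..b} t *\<^sub>R (weak_deriv (U t) x * g x)))"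
          by (rule integral_cong_AE[OF measurable_compose[OF meas1 borel_measurable_norm] measurable_compose[OF borel_measurable_integrable[OF wi] borel_measurable_norm]])
             (use elim in \<open>eventually_elim, simp only:\<close>)
        also have "\<dots> = indicator {a..b} t * (LINT x|lborel. norm (weak_deriv (U t) x) * norm (g x))"
          by (simp add: norm_mult)
        also have "\<dots> \<le> indicator {a..b} t * (L2_norm (weak_deriv (U t)) * L2_norm g)"
          by (intro mult_left_mono L2_Cauchy_Schwarz Lw g) simp
        also have "\<dots> \<le> indicator {a..b} t * (M * L2_norm g)"
          using M[of t] by (cases "t \<in> {a..b}") (auto intro: mult_right_mono L2_norm_nonneg)
        finally have "(LINT x|lborel. norm (h t x)) \<le> indicator {a..b} t * (M * L2_norm g)" .
        moreover have "(LINT x|lborel. norm (h t x)) \<ge> 0" by simp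
        ultimately show ?case by simp
      qed
    qed
  qed
  have inner: "(LINT t|lborel. h t x) = (LINT t:{a..b}|lborel. v x t) * g x" for x
    unfolding set_lebesgue_integral_def h_def by (simp flip: integral_mult_left_zero)
  show "integrable lborel (\<lambda>x. (LINT t:{a..b}|lborel. v x t) * g x)"
    using lborel_pair.integrable_snd[OF int] by (simp add: inner)
  have "(LINT x|lborel. (LINT t:{a..b}|lborel. v x t) * g x) = (LINT t|lborel. LINT x|lborel. h t x)"
    using lborel_pair.Fubini_integral[OF int] by (simp add: inner)
  also have "\<dots> = (LINT t:{a..b}|lborel. LINT x|lborel. weak_deriv (U t) x * g x)"
    unfolding set_lebesgue_integral_def
  proof (rule integral_cong_AE)
    show "(\<lambda>t. LINT x|lborel. h t x) \<in> borel_measurable lborel"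
      using lborel.borel_measurable_lebesgue_integral[of h lborel] hm by simp
    have "(\<lambda>t. LINT x|lborel. weak_deriv (U t) x * g x) \<in> borel_measurable borel"
      by (rule borel_measurable_continuous_onI[OF curve_pairing_continuous(2)[OF U g]])
    then show "(\<lambda>t. indicator {a..b} t *\<^sub>R (LINT x|lborel. weak_deriv (U t) x * g x)) \<in> borel_measurable lborel" by simp
    show "AE t in lborel. (LINT x|lborel. h t x) = indicator {a..b} t *\<^sub>R (LINT x|lborel. weak_deriv (U t) x * g x)"
      using eqAE
    proof eventually_elim
      case (elim t)
      have "(LINT x|lborel. h t x) = (LINT x|lborel. indicator {a..b} t *\<^sub>R (weak_deriv (U t) x * g x))"
        by (rule integral_cong_AE) (use elim meas1[of t] borel_measurable_integrable[OF wi[of t]] in auto)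
      then show ?case by simp
    qed
  qed
  finally show "(LINT x|lborel. (LINT t:{a..b}|lborel. v x t) * g x) = (LINT t:{a..b}|lborel. LINT x|lborel. weak_deriv (U t) x * g x)" .
qed

text \<open>Only the \<open>L2\<close> part of the norm is used, by Cauchy-Schwarz against the
  indicator of [a,b].\<close>

lemma Hs_interval_integral:
  assumes f: "f \<in> borel_measurable (restrict_space lborel {0..T})" and fin: "Hs_normsq s T f < \<infinity>"
    and ab: "0 \<le> a" "a \<le> b" "b \<le> T"
  shows "set_integrable lborel {a..b} f"
    "norm (LINT t:{a..b}|lborel. f t) \<le> sqrt ((b - a) * enn2real (Hs_normsq s T f))"
proof -
  \<comment> \<open>Measurability is given on [0,T] only, so \<open>f\<close> is first extended by
    0.\<close>
  have "(\<lambda>t. indicator {0..T} t *\<^sub>R f t) \<in> borel_measurable borel"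
    using f by (subst (asm) borel_measurable_restrict_space_iff) auto
  then have "(\<lambda>t. indicator {a..b} t *\<^sub>R (indicator {0..T} t *\<^sub>R f t)) \<in> borel_measurable borel"
    by (rule borel_measurable_scaleR[rotated]) simp
  moreover have "(\<lambda>t. indicator {a..b} t *\<^sub>R (indicator {0..T} t *\<^sub>R f t)) = (\<lambda>t. indicator {a..b} t *\<^sub>R f t)"
    using ab by (auto simp: indicator_def)
  ultimately have m[measurable]: "(\<lambda>t. indicator {a..b} t *\<^sub>R f t) \<in> borel_measurable borel" by simp
  let ?f = "\<lambda>t. indicator {a..b} t *\<^sub>R f t" and ?N = "Hs_normsq s T f"
  have N: "ennreal (enn2real ?N) = ?N" using fin by simp
  have "(\<integral>\<^sup>+t. ennreal (norm (?f t)) \<partial>lborel)\<^sup>2 = (\<integral>\<^sup>+t. indicator {a..b} t * ennreal (norm (?f t)) \<partial>lborel)\<^sup>2"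
    by (intro arg_cong[where f="\<lambda>x. x\<^sup>2"] nn_integral_cong) (auto simp: indicator_def)
  also have "\<dots> \<le> (\<integral>\<^sup>+t. (indicator {a..b} t)\<^sup>2 \<partial>lborel) * (\<integral>\<^sup>+t. (ennreal (norm (?f t)))\<^sup>2 \<partial>lborel)"
    by (rule Cauchy_Schwarz_nn_integral) measurable
  also have "(\<integral>\<^sup>+t. (indicator {a..b} t)\<^sup>2 \<partial>lborel) = (\<integral>\<^sup>+t. indicator {a..b} t \<partial>lborel)"
    by (intro nn_integral_cong) (auto simp: indicator_def)
  also have "\<dots> = ennreal (b - a)" using ab by simp
  also have "ennreal (b - a) * (\<integral>\<^sup>+t. (ennreal (norm (?f t)))\<^sup>2 \<partial>lborel) \<le> ennreal (b - a) * ?N"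
  proof (rule mult_left_mono)
    have "(\<integral>\<^sup>+t. (ennreal (norm (?f t)))\<^sup>2 \<partial>lborel) \<le> (\<integral>\<^sup>+t\<in>{0..T}. ennreal ((norm (f t))\<^sup>2) \<partial>lborel)"
      using ab by (intro nn_integral_mono) (auto simp: indicator_def ennreal_power)
    also have "\<dots> \<le> ?N" unfolding Hs_normsq_def by simp
    finally show "(\<integral>\<^sup>+t. (ennreal (norm (?f t)))\<^sup>2 \<partial>lborel) \<le> ?N" .
  qed simp
  also have "\<dots> = ennreal ((b - a) * enn2real ?N)" using N ab by (simp add: ennreal_mult)
  finally have sq: "(\<integral>\<^sup>+t. ennreal (norm (?f t)) \<partial>lborel)\<^sup>2 \<le> ennreal ((b - a) * enn2real ?N)" .
  then have "(\<integral>\<^sup>+t. ennreal (norm (?f t)) \<partial>lborel)\<^sup>2 < \<infinity>"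
    by (rule le_less_trans) simp
  then have "(\<integral>\<^sup>+t. ennreal (norm (?f t)) \<partial>lborel) < \<infinity>"
    by (simp only: power_less_top_ennreal infinity_ennreal_def) simp
  then have i: "integrable lborel ?f" by (intro integrableI_bounded) auto
  then show "set_integrable lborel {a..b} f" by (simp add: set_integrable_def)
  have "ennreal ((norm (LINT t|lborel. ?f t))\<^sup>2) = (ennreal (norm (LINT t|lborel. ?f t)))\<^sup>2" by (simp add: ennreal_power)
  also have "\<dots> \<le> (\<integral>\<^sup>+t. ennreal (norm (?f t)) \<partial>lborel)\<^sup>2"
    by (intro power_mono integral_norm_bound_ennreal i) simp
  also note sq
  finally have "(norm (LINT t|lborel. ?f t))\<^sup>2 \<le> (b - a) * enn2real ?N" using ab by (simp add: ennreal_le_iff)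
  then show "norm (LINT t:{a..b}|lborel. f t) \<le> sqrt ((b - a) * enn2real ?N)"
    unfolding set_lebesgue_integral_def by (rule real_le_rsqrt)
qed

text \<open>Integration over [a,b] is a continuous functional on \<open>Hs\<close>, so that
  continuity and one-sided limits of psi_x in the variable x pass to its time integral.\<close>

lemma Hs_tendsto_interval_integral:
  assumes f: "\<forall>\<^sub>F y in F. Hs s T (f y)" and g: "Hs s T g"
    and lim: "((\<lambda>y. Hs_normsq s T (\<lambda>t. f y t - g t)) \<longlongrightarrow> 0) F"
    and ab: "0 \<le> a" "a \<le> b" "b \<le> T"
  shows "((\<lambda>y. LINT t:{a..b}|lborel. f y t) \<longlongrightarrow> (LINT t:{a..b}|lborel. g t)) F"
proof -
  let ?N = "\<lambda>y. Hs_normsq s T (\<lambda>t. f y t - g t)"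
  have "(?N \<longlongrightarrow> ennreal 0) F" using lim by simp
  then have "((\<lambda>y. enn2real (?N y)) \<longlongrightarrow> 0) F" by (rule tendsto_enn2real) simp
  then have "((\<lambda>y. sqrt ((b - a) * enn2real (?N y))) \<longlongrightarrow> sqrt ((b - a) * 0)) F"
    by (rule tendsto_real_sqrt[OF tendsto_mult[OF tendsto_const]])
  then have l0: "((\<lambda>y. sqrt ((b - a) * enn2real (?N y))) \<longlongrightarrow> 0) F" by simp
  have "\<forall>\<^sub>F y in F. ?N y < \<infinity>" using order_tendstoD(2)[OF lim, of \<infinity>] by simp
  with f have "\<forall>\<^sub>F y in F. norm ((LINT t:{a..b}|lborel. f y t) - (LINT t:{a..b}|lborel. g t)) \<le> sqrt ((b - a) * enn2real (?N y))"
  proof eventually_elim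
    case (elim y)
    have fi: "set_integrable lborel {a..b} (f y)" and gi: "set_integrable lborel {a..b} g"
      using elim g Hs_interval_integral(1)[of _ T s, OF _ _ ab] by (auto simp: Hs_def)
    have "norm (LINT t:{a..b}|lborel. f y t - g t) \<le> sqrt ((b - a) * enn2real (?N y))"
      by (rule Hs_interval_integral(2)[OF _ elim(2) ab]) (use elim g in \<open>auto simp: Hs_def\<close>)
    then show ?case using set_integral_diff(2)[OF fi gi] by simp
  qed
  then have "((\<lambda>y. (LINT t:{a..b}|lborel. f y t) - (LINT t:{a..b}|lborel. g t)) \<longlongrightarrow> 0) F"
    by (rule Lim_null_comparison[OF _ l0])
  then show ?thesis by (rule LIM_zero_cancel)
qed

text \<open>The real part of the pairing of \<open>W\<close> with \<open>\<phi>'\<close> is computed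
  twice. Fubini in time gives the left-hand side; integration by parts in x leaves only the jump of
  \<open>W\<close> at the origin, which the jump condition turns into the right-hand side.\<close>

lemma energy_increment:
  assumes U: "H1_continuous_curve U" and sol: "H1_solution T u"
    and uU: "\<And>t. t \<in> {0..T} \<Longrightarrow> u t = U t" and ab: "0 < a" "a < b" "b < T"
  shows "integral {a..b} (\<lambda>s. L2_inner (weak_deriv (U s)) (weak_deriv (U b)) - L2_inner (weak_deriv (U s)) (weak_deriv (U a)))
    = Re (integral {a..b} (\<lambda>s. of_real ((norm (U s 0))\<^sup>2) * U s 0) * cnj (U b 0 - U a 0))"
proof -
  obtain v vp vm where v: "(\<lambda>(x, t). v x t) \<in> borel_measurable (borel :: (real \<times> real) measure)"
    and vu: "AE t in restrict_space lborel {0..T}. AE x in lborel. v x t = weak_deriv (u t) x"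
    and vc: "continuous_into_Hs (1/4) T (- {0}) v" and vpm: "Hs (1/4) T vp" "Hs (1/4) T vm"
    and lp: "((\<lambda>x. Hs_normsq (1/4) T (\<lambda>t. v x t - vp t)) \<longlongrightarrow> 0) (at_right 0)"
    and lm: "((\<lambda>x. Hs_normsq (1/4) T (\<lambda>t. v x t - vm t)) \<longlongrightarrow> 0) (at_left 0)"
    and jump: "AE t in restrict_space lborel {0..T}. vp t - vm t = - of_real ((norm (u t 0))\<^sup>2) * u t 0"
    using sol unfolding H1_solution_def derivative_traces_and_jump_def by blast
  have eq: "free_equation_off_origin T u" using sol by (simp add: H1_solution_def)
  have vU: "AE t in lborel. t \<in> {a..b} \<longrightarrow> (AE x in lborel. v x t = weak_deriv (U t) x)"
  proof -
    have "AE t in lborel. t \<in> {0..T} \<longrightarrow> (AE x in lborel. v x t = weak_deriv (u t) x)"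
      using vu by (subst (asm) AE_restrict_space_iff) auto
    then show ?thesis
    proof eventually_elim
      case (elim t)
      show ?case
      proof
        assume "t \<in> {a..b}"
        then have "t \<in> {0..T}" using ab by auto
        then show "AE x in lborel. v x t = weak_deriv (U t) x" using elim uU by simp
      qed
    qed
  qed
  note Fub = curve_derivative_Fubini[OF U _ v vU]
  have ab': "0 \<le> a" "a \<le> b" "b \<le> T" using ab by auto
  define W where "W x = (LINT t:{a..b}|lborel. v x t)" for x
  define cp where "cp = (LINT t:{a..b}|lborel. vp t)"
  define cm where "cm = (LINT t:{a..b}|lborel. vm t)"
  define \<phi> where "\<phi> x = U b x - U a x" for x
  define \<phi>' where "\<phi>' x = weak_deriv (U b) x - weak_deriv (U a) x" for x
  note H = curve_H1[OF U] and L = L2_weak_deriv[OF curve_H1[OF U]]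
  have L\<phi>: "L2 \<phi>" "L2 \<phi>'" unfolding \<phi>_def[abs_def] \<phi>'_def[abs_def] by (intro L2_diff H1_L2 H L)+
  have cont\<phi>: "continuous_on UNIV \<phi>" unfolding \<phi>_def[abs_def] by (intro continuous_on_diff H1_continuous H)
  have Hsv: "Hs (1/4) T (v x)" if "x \<noteq> 0" for x using vc that by (auto simp: continuous_into_Hs_def)
  have Hsv_ev: "\<forall>\<^sub>F y in at x within S. Hs (1/4) T (v y)" if "S \<subseteq> - {0}" for x S
  proof -
    have "Hs (1/4) T (v y)" if "y \<in> S" for y using \<open>S \<subseteq> - {0}\<close> that by (intro Hsv) auto
    then show ?thesis by (simp add: eventually_at_filter)
  qed
  have Wc: "continuous_on (- {0}) W"
    unfolding continuous_on_def W_def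
    by (intro ballI Hs_tendsto_interval_integral[where s="1/4" and T=T] Hsv_ev ab')
       (use vc in \<open>auto simp: continuous_into_Hs_def\<close>)
  have Wp: "(W \<longlongrightarrow> cp) (at_right 0)" unfolding W_def cp_def
    by (rule Hs_tendsto_interval_integral[OF Hsv_ev vpm(1) lp ab']) auto
  have Wm: "(W \<longlongrightarrow> cm) (at_left 0)" unfolding W_def cm_def
    by (rule Hs_tendsto_interval_integral[OF Hsv_ev vpm(2) lm ab']) auto
  have Wdiff: "W y - W x = - (LINT z:{x..y}|lborel. \<i> * \<phi> z)" if xy: "x < y" "0 < x \<or> y < 0" for x y
  proof -
    \<comment> \<open>For negative y the enlarged interval ends at y/2 and so still avoids the
      origin.\<close>
    define d where "d = (if 0 < x then 1 else - y / 2)"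
    have d: "d > 0" "0 \<notin> {x..y + d}" using xy by (auto simp: d_def)
    have "(LINT z:{x..y}|lborel. - (\<i> * \<phi> z)) = W y - W x"
    proof (rule weak_derivative_imp_FTC[OF xy(1) d(1)])
      show "continuous_on {x..y + d} W" by (rule continuous_on_subset[OF Wc]) (use d in auto)
      show "set_integrable lborel {x..y + d} (\<lambda>z. - (\<i> * \<phi> z))"
        by (rule borel_integrable_atLeastAtMost') (intro continuous_intros continuous_on_subset[OF cont\<phi>] subset_UNIV)
      fix \<zeta> assume "test_function \<zeta>" and \<zeta>0: "\<And>z. z \<notin> {x..y + d} \<Longrightarrow> \<zeta> z = 0"
      have \<zeta>: "smooth \<zeta>" using \<open>test_function \<zeta>\<close> by (rule test_functionD)
      have L\<zeta>': "L2 (\<lambda>x. of_real (deriv \<zeta> x))"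
        by (rule continuous_support_L2[OF smooth_continuous[OF smooth_deriv[OF \<zeta>]] deriv_eq_0_outside[OF \<zeta>0]])
      have "(LINT z|lborel. \<phi> z * of_real (\<zeta> z)) = - \<i> * (LINT z|lborel. W z * of_real (deriv \<zeta> z))"
        unfolding \<phi>_def W_def Fub(2)[OF L\<zeta>']
        by (rule free_equation_time_integrated[OF U eq uU ab \<zeta> \<zeta>0 d(2)])
      then have "(LINT z|lborel. W z * of_real (deriv \<zeta> z)) = \<i> * (LINT z|lborel. \<phi> z * of_real (\<zeta> z))"
        by simp
      also have "\<dots> = - (LINT z|lborel. - (\<i> * \<phi> z) * of_real (\<zeta> z))"
        by (simp add: mult.assoc)
      finally show "(LINT z|lborel. W z * of_real (deriv \<zeta> z)) = - (LINT z|lborel. - (\<i> * \<phi> z) * of_real (\<zeta> z))" .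
    qed
    then show ?thesis
      by (simp only: set_lebesgue_integral_def scaleR_minus_right Bochner_Integration.integral_minus)
  qed
  have FTC: "(LINT x:{c..e}|lborel. \<phi>' x) = \<phi> e - \<phi> c" if "c \<le> e" for c e
    unfolding \<phi>'_def \<phi>_def using that
    by (subst set_integral_diff(2)) (auto intro: L2_set_integrable L simp: H1_FTC[OF H])
  note Lc = L\<phi>[THEN L2_cnj]
  have pairing: "Re (LINT x|lborel. W x * cnj (\<phi>' x)) = Re ((cm - cp) * cnj (\<phi> 0))"
    by (rule Re_pairing_with_jump[OF Wdiff Wp Wm cont\<phi> L2_set_integrable[OF L\<phi>(2)] FTC])
       (use Fub(1)[OF Lc(1)] Fub(1)[OF Lc(2)] in \<open>simp_all add: W_def\<close>)
  have inner: "Re (LINT x|lborel. weak_deriv (U t) x * cnj (\<phi>' x)) =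
      L2_inner (weak_deriv (U t)) (weak_deriv (U b)) - L2_inner (weak_deriv (U t)) (weak_deriv (U a))" for t
  proof -
    have "Re (LINT x|lborel. weak_deriv (U t) x * cnj (\<phi>' x)) = L2_inner (weak_deriv (U t)) \<phi>'"
      unfolding L2_inner_def by (rule integral_Re[symmetric, OF L2_mult_integrable(2)[OF L L\<phi>(2)]])
    also have "\<dots> = L2_inner \<phi>' (weak_deriv (U t))" by (rule L2_inner_commute)
    also have "\<dots> = L2_inner (weak_deriv (U b)) (weak_deriv (U t)) - L2_inner (weak_deriv (U a)) (weak_deriv (U t))"
      unfolding \<phi>'_def[abs_def] by (rule L2_inner_diff_left[OF L L L])
    finally show ?thesis by (simp only: L2_inner_commute[of _ "weak_deriv (U t)"])
  qed
  have cI: "continuous_on A (\<lambda>t. LINT x|lborel. weak_deriv (U t) x * cnj (\<phi>' x))" for A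
    using curve_pairing_continuous(2)[OF U Lc(2)] continuous_on_subset by blast
  have "Re (LINT x|lborel. W x * cnj (\<phi>' x)) = Re (LINT t:{a..b}|lborel. LINT x|lborel. weak_deriv (U t) x * cnj (\<phi>' x))"
    unfolding W_def Fub(2)[OF Lc(2)] by simp
  also have "\<dots> = (LINT t:{a..b}|lborel. Re (LINT x|lborel. weak_deriv (U t) x * cnj (\<phi>' x)))"
    using integral_Re[OF borel_integrable_atLeastAtMost'[OF cI, unfolded set_integrable_def], of a b]
    by (simp add: set_lebesgue_integral_def)
  also have "\<dots> = integral {a..b} (\<lambda>t. Re (LINT x|lborel. weak_deriv (U t) x * cnj (\<phi>' x)))"
    by (rule LINT_eq_integral_continuous) (intro continuous_on_Re cI)
  finally have lhs: "Re (LINT x|lborel. W x * cnj (\<phi>' x)) = integral {a..b} (\<lambda>s. L2_inner (weak_deriv (U s)) (weak_deriv (U b)) - L2_inner (weak_deriv (U s)) (weak_deriv (U a)))"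
    unfolding inner .
  let ?g = "\<lambda>s. of_real ((norm (U s 0))\<^sup>2) * U s 0"
  have ch: "continuous_on A (\<lambda>t. U t 0)" for A using curve_point_continuous[OF U] continuous_on_subset by blast
  have cg: "continuous_on A ?g" for A by (intro continuous_intros ch)
  have si: "set_integrable lborel {a..b} vm" "set_integrable lborel {a..b} vp"
    using vpm Hs_interval_integral(1)[OF _ _ ab'] by (auto simp: Hs_def)
  \<comment> \<open>Left minus right trace, hence the opposite sign to the jump condition.\<close>
  have "cm - cp = (LINT t:{a..b}|lborel. vm t - vp t)"
    unfolding cm_def cp_def by (rule set_integral_diff(2)[OF si, symmetric])
  also have "\<dots> = (LINT t:{a..b}|lborel. ?g t)"
    unfolding set_lebesgue_integral_def
  proof (rule integral_cong_AE)
    have "AE t in lborel. t \<in> {0..T} \<longrightarrow> vp t - vm t = - of_real ((norm (u t 0))\<^sup>2) * u t 0"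
      using jump by (subst (asm) AE_restrict_space_iff) auto
    then show "AE t in lborel. indicator {a..b} t *\<^sub>R (vm t - vp t) = indicator {a..b} t *\<^sub>R ?g t"
    proof eventually_elim
      case (elim t)
      show ?case
      proof (cases "t \<in> {a..b}")
        case True
        then have "t \<in> {0..T}" using ab by auto
        with elim uU have "vp t - vm t = - ?g t" by simp
        then have "vm t - vp t = ?g t" by (metis minus_diff_eq minus_minus)
        then show ?thesis by simp
      qed simp
    qed
    show "(\<lambda>t. indicator {a..b} t *\<^sub>R (vm t - vp t)) \<in> borel_measurable lborel"
      using set_integral_diff(1)[OF si] by (auto simp: set_integrable_def)
    show "(\<lambda>t. indicator {a..b} t *\<^sub>R ?g t) \<in> borel_measurable lborel"
      using borel_integrable_atLeastAtMost'[OF cg, of a b] by (auto simp: set_integrable_def)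
  qed
  also have "\<dots> = integral {a..b} ?g" by (rule LINT_eq_integral_continuous[OF cg])
  finally show ?thesis using pairing lhs by (simp add: \<phi>_def)
qed

text \<open>Clamping time to [0,T] is a continuous map, so composing with it turns continuity within
  [0,T] into continuity on the whole axis.\<close>

lemma clamped_curve:
  assumes "continuous_into_H1 T u" "0 < T"
  shows "H1_continuous_curve (\<lambda>t. u (max 0 (min T t)))"
  unfolding H1_continuous_curve_def
proof (intro conjI allI)
  let ?c = "\<lambda>t. max 0 (min T t)"
  have c: "?c t \<in> {0..T}" for t using assms(2) by auto
  then show H: "H1 (u (?c t))" for t using assms(1) unfolding continuous_into_H1_def by blast
  fix t
  let ?d = "\<lambda>s. H1_norm (\<lambda>x. u s x - u (?c t) x)"
  have "continuous (at (?c t) within {0..T}) ?d"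
    using assms(1) c[of t] H1_norm_diff_self[OF H[of t]] by (simp add: continuous_within continuous_into_H1_def)
  then have "continuous (at (?c t) within range ?c) ?d"
    by (rule continuous_within_subset) (use c in blast)
  moreover have "continuous (at t within UNIV) ?c" by (intro continuous_intros)
  ultimately have "continuous (at t within UNIV) (\<lambda>s. ?d (?c s))"
    by (rule continuous_within_compose2[where f="?c" and g="?d", rotated])
  then show "((\<lambda>s. H1_norm (\<lambda>x. u (?c s) x - u (?c t) x)) \<longlongrightarrow> 0) (at t)"
    using H1_norm_diff_self[OF H[of t]] by (simp add: continuous_within)
qed

text \<open>The conserved quantity is twice the energy and is the diagonal value of the kernel
  \<open>Q\<close>. Both times are interior because the equation is tested only on the open time
  interval.\<close>

lemma H1_solution_energy_conserved:
  assumes sol: "H1_solution T u" and ts: "0 < \<alpha>" "\<alpha> < \<beta>" "\<beta> < T"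
  shows "(L2_norm (weak_deriv (u \<alpha>)))\<^sup>2 - (norm (u \<alpha> 0)) ^ 4 / 2 = (L2_norm (weak_deriv (u \<beta>)))\<^sup>2 - (norm (u \<beta> 0)) ^ 4 / 2"
proof -
  define U where "U t = u (max 0 (min T t))" for t
  have uU: "u t = U t" if "t \<in> {0..T}" for t using that by (simp add: U_def)
  have U: "H1_continuous_curve U" unfolding U_def[abs_def]
    by (rule clamped_curve) (use sol in \<open>auto simp: H1_solution_def\<close>)
  define h where "h t = U t 0" for t
  have h: "continuous_on UNIV h" unfolding h_def[abs_def] by (rule curve_point_continuous[OF U])
  have ch: "continuous_on A (\<lambda>x. h (f x))" if "continuous_on A f" for f and A :: "'c::topological_space set"
    by (rule continuous_on_compose2[OF h that]) auto
  define \<rho> where "\<rho> t = (norm (h t))\<^sup>2" for t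
  have c\<rho>: "continuous_on A (\<lambda>x. \<rho> (f x))" if "continuous_on A f" for f and A :: "'c::topological_space set"
    unfolding \<rho>_def by (intro continuous_intros ch that)
  define K where "K s t = L2_inner (weak_deriv (U s)) (weak_deriv (U t))" for s t
  have K: "continuous_on UNIV (\<lambda>(s, t). K s t)" unfolding K_def by (rule curve_inner_continuous[OF U])
  define Q where "Q s t = K s t - \<rho> s * \<rho> t / 2" for s t
  have Q: "continuous_on UNIV (\<lambda>(s, t). Q s t)"
    unfolding Q_def split_beta' by (intro continuous_intros c\<rho> continuous_on_param2[OF K]) auto
  have sym: "Q s t = Q t s" for s t by (simp add: Q_def K_def L2_inner_commute mult.commute)
  define \<delta> where "\<delta> = (T - \<beta>) / 2"
  have \<delta>: "\<delta> > 0" "\<beta> + \<delta> < T" using ts by (auto simp: \<delta>_def field_simps)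
  have "bounded (\<rho> ` {\<alpha>..\<beta> + \<delta>})"
    by (intro compact_imp_bounded compact_continuous_image c\<rho>[of _ "\<lambda>x. x"]) auto
  then obtain M where "\<forall>y\<in>\<rho> ` {\<alpha>..\<beta> + \<delta>}. norm y \<le> M" unfolding bounded_iff by blast
  then have M: "\<rho> t \<le> M" if "t \<in> {\<alpha>..\<beta> + \<delta>}" for t using that by force
  have \<rho>0: "\<rho> t \<ge> 0" for t by (simp add: \<rho>_def)
  have M0: "M \<ge> 0" using M[of \<alpha>] \<rho>0[of \<alpha>] ts \<delta> by auto
  have "Q \<alpha> \<alpha> = Q \<beta> \<beta>"
  \<comment> \<open>5/2 is the Gagliardo exponent 1 + 2k for k = 3/4, and \<open>M\<close> bounds
    |h|^2 on the time interval.\<close>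
  proof (rule symmetric_kernel_diagonal_constant[OF Q sym h ts(2) \<delta>(1), where p="5/2" and C=M])
    have "Hs (3/4) T (\<lambda>t. u t 0)" using sol by (simp add: H1_solution_def continuous_into_Hs_def)
    then have fin: "(\<integral>\<^sup>+t\<in>{0..T}. (\<integral>\<^sup>+\<tau>\<in>{0..T}. ennreal ((norm (u t 0 - u \<tau> 0))\<^sup>2 / \<bar>t - \<tau>\<bar> powr (5/2)) \<partial>lborel) \<partial>lborel) < \<infinity>"
      by (simp add: Hs_def Hs_normsq_def)
    have sub: "{\<alpha>..\<beta> + \<delta>} \<subseteq> {0..T}" using ts \<delta> by auto
    have "(\<integral>\<^sup>+t\<in>{\<alpha>..\<beta> + \<delta>}. (\<integral>\<^sup>+s\<in>{\<alpha>..\<beta> + \<delta>}. ennreal ((norm (h t - h s))\<^sup>2 / \<bar>t - s\<bar> powr (5/2)) \<partial>lborel) \<partial>lborel)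
       \<le> (\<integral>\<^sup>+t\<in>{0..T}. (\<integral>\<^sup>+\<tau>\<in>{0..T}. ennreal ((norm (u t 0 - u \<tau> 0))\<^sup>2 / \<bar>t - \<tau>\<bar> powr (5/2)) \<partial>lborel) \<partial>lborel)"
    proof (rule nn_integral_mono)
      fix t
      have "(\<integral>\<^sup>+s\<in>{\<alpha>..\<beta> + \<delta>}. ennreal ((norm (h t - h s))\<^sup>2 / \<bar>t - s\<bar> powr (5/2)) \<partial>lborel)
        \<le> (\<integral>\<^sup>+\<tau>\<in>{0..T}. ennreal ((norm (u t 0 - u \<tau> 0))\<^sup>2 / \<bar>t - \<tau>\<bar> powr (5/2)) \<partial>lborel)" if "t \<in> {\<alpha>..\<beta> + \<delta>}"
        using that sub by (intro nn_integral_mono) (auto simp: indicator_def h_def uU)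
      then show "(\<integral>\<^sup>+s\<in>{\<alpha>..\<beta> + \<delta>}. ennreal ((norm (h t - h s))\<^sup>2 / \<bar>t - s\<bar> powr (5/2)) \<partial>lborel) * indicator {\<alpha>..\<beta> + \<delta>} t
        \<le> (\<integral>\<^sup>+\<tau>\<in>{0..T}. ennreal ((norm (u t 0 - u \<tau> 0))\<^sup>2 / \<bar>t - \<tau>\<bar> powr (5/2)) \<partial>lborel) * indicator {0..T} t"
        using sub by (auto simp: indicator_def)
    qed
    then show "(\<integral>\<^sup>+t\<in>{\<alpha>..\<beta> + \<delta>}. (\<integral>\<^sup>+s\<in>{\<alpha>..\<beta> + \<delta>}. ennreal ((norm (h t - h s))\<^sup>2 / \<bar>t - s\<bar> powr (5/2)) \<partial>lborel) \<partial>lborel) < \<infinity>"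
      using fin by (rule le_less_trans)
  next
    fix a b assume ab: "\<alpha> \<le> a" "a < b" "b \<le> \<beta> + \<delta>"
    let ?G = "\<lambda>s. (norm (h s - h b))\<^sup>2 + (norm (h s - h a))\<^sup>2"
    let ?R = "\<lambda>s. \<rho> s * ((norm (h s - h a))\<^sup>2 - (norm (h s - h b))\<^sup>2) / 2"
    let ?g = "\<lambda>s. of_real ((norm (U s 0))\<^sup>2) * U s 0"
    have cst: "continuous_on A (\<lambda>s. h s)" "continuous_on A (\<lambda>s. \<rho> s)" for A by (intro ch c\<rho> continuous_intros)+
    have cK: "continuous_on A (\<lambda>s. K s t)" for A t by (intro continuous_on_param2[OF K] continuous_intros)
    have cg: "continuous_on {a..b} ?g" unfolding h_def[symmetric] by (intro continuous_intros cst)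
    \<comment> \<open>Polarization: once the increment of \<open>\<rho> s * \<rho> t / 2\<close> is
      subtracted, only squares of differences of \<open>h\<close> remain.\<close>
    have polar: "Re (?g s * cnj (h b - h a)) - \<rho> s * (\<rho> b - \<rho> a) / 2 = ?R s" for s
    proof -
      have *: "(norm (h s - z))\<^sup>2 = \<rho> s + (norm z)\<^sup>2 - 2 * Re (h s * cnj z)" for z
        unfolding \<rho>_def cmod_power2 by (simp add: power2_eq_square algebra_simps)
      have "Re (?g s * cnj (h b - h a)) = \<rho> s * (Re (h s * cnj (h b)) - Re (h s * cnj (h a)))"
        unfolding \<rho>_def h_def by (simp add: algebra_simps)
      moreover have "?R s = \<rho> s * ((\<rho> s + \<rho> a - 2 * Re (h s * cnj (h a))) - (\<rho> s + \<rho> b - 2 * Re (h s * cnj (h b)))) / 2"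
        unfolding * \<rho>_def[of a] \<rho>_def[of b] ..
      moreover have "x * ((x + p - 2 * y) - (x + q - 2 * z)) / 2 = x * (z - y) - x * (q - p) / 2" for x p q y z :: real
        by (simp add: field_simps)
      ultimately show ?thesis by (simp only:)
    qed
    have "integral {a..b} (\<lambda>s. Q s b - Q s a) = integral {a..b} (\<lambda>s. (K s b - K s a) - \<rho> s * (\<rho> b - \<rho> a) / 2)"
      by (rule integral_cong) (simp add: Q_def field_simps)
    also have "\<dots> = integral {a..b} (\<lambda>s. K s b - K s a) - integral {a..b} (\<lambda>s. \<rho> s * (\<rho> b - \<rho> a) / 2)"
      by (intro integral_diff integrable_continuous_real continuous_intros cK cst) auto
    also have "integral {a..b} (\<lambda>s. K s b - K s a) = Re (integral {a..b} ?g * cnj (h b - h a))"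
      unfolding K_def h_def by (rule energy_increment[OF U sol uU]) (use ab ts \<delta> in auto)
    also have "integral {a..b} ?g * cnj (h b - h a) = integral {a..b} (\<lambda>s. ?g s * cnj (h b - h a))"
      by (rule integral_mult_left[symmetric])
    also have "Re (integral {a..b} (\<lambda>s. ?g s * cnj (h b - h a))) = integral {a..b} (\<lambda>s. Re (?g s * cnj (h b - h a)))"
      using integral_linear[OF integrable_continuous_real[OF continuous_on_mult_right[OF cg]] bounded_linear_Re, of "cnj (h b - h a)"]
      by (simp add: o_def)
    also have "integral {a..b} (\<lambda>s. Re (?g s * cnj (h b - h a))) - integral {a..b} (\<lambda>s. \<rho> s * (\<rho> b - \<rho> a) / 2)
       = integral {a..b} (\<lambda>s. Re (?g s * cnj (h b - h a)) - \<rho> s * (\<rho> b - \<rho> a) / 2)"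
      by (intro integral_diff[symmetric] integrable_continuous_real continuous_intros cst cg[unfolded h_def[symmetric]] curve_point_continuous[OF U, THEN continuous_on_subset]) auto
    also have "\<dots> = integral {a..b} ?R" by (simp only: polar)
    finally have "\<bar>integral {a..b} (\<lambda>s. Q s b - Q s a)\<bar> = norm (integral {a..b} ?R)" by simp
    also have "\<dots> \<le> integral {a..b} (\<lambda>s. M * ?G s)"
    proof (rule Henstock_Kurzweil_Integration.integral_norm_bound_integral)
      show "?R integrable_on {a..b}" by (intro integrable_continuous_real continuous_intros cst) auto
      show "(\<lambda>s. M * ?G s) integrable_on {a..b}" by (intro integrable_continuous_real continuous_intros cst)
      fix s assume s: "s \<in> {a..b}"
      have "norm (?R s) = \<rho> s * (\<bar>(norm (h s - h a))\<^sup>2 - (norm (h s - h b))\<^sup>2\<bar> / 2)"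
        using \<rho>0[of s] by (simp add: abs_mult)
      also have "\<dots> \<le> M * ?G s"
        by (intro mult_mono M M0) (use s ab in \<open>auto simp: abs_le_iff\<close>)
      finally show "norm (?R s) \<le> M * ?G s" .
    qed
    also have "\<dots> = M * integral {a..b} ?G" by simp
    finally show "\<bar>integral {a..b} (\<lambda>s. Q s b - Q s a)\<bar> \<le> M * integral {a..b} ?G" .
  qed (use M0 in auto)
  moreover have "Q t t = (L2_norm (weak_deriv (u t)))\<^sup>2 - (norm (u t 0)) ^ 4 / 2" if "t \<in> {\<alpha>, \<beta>}" for t
  proof -
    have "u t = U t" using that ts by (intro uU) auto
    then show ?thesis by (simp add: Q_def K_def L2_inner_self \<rho>_def h_def power2_eq_square power4_eq_xxxx)
  qed
  ultimately show ?thesis by simp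
qed

subsection \<open>Mass concentration\<close>

text \<open>By evenness, twice the half-line integral of 2 exp(-2x), which is 1.\<close>

lemma L2_norm_ground_state: "(L2_norm \<phi>\<^sub>0)\<^sup>2 = 2"
proof -
  have "(\<integral>\<^sup>+x. ennreal (2 * exp (- 2 * x)) * indicator {0..} x \<partial>lborel) = ennreal (0 - (- exp (- 2 * 0)))"
  proof (rule nn_integral_FTC_atLeast)
    show "((\<lambda>x::real. - exp (- 2 * x)) \<longlongrightarrow> 0) at_top" by real_asymp
  qed (auto intro!: derivative_eq_intros)
  moreover have "(\<integral>\<^sup>+x. ennreal (indicator {0..} x *\<^sub>R (2 * exp (- 2 * \<bar>x\<bar>))) \<partial>lborel) =
      (\<integral>\<^sup>+x. ennreal (2 * exp (- 2 * x)) * indicator {0..} x \<partial>lborel)"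
    by (intro nn_integral_cong) (auto simp: indicator_def)
  ultimately have "has_bochner_integral lborel (\<lambda>x. indicator {0..} x *\<^sub>R (2 * exp (- 2 * \<bar>x\<bar>))) (1 :: real)"
    by (intro has_bochner_integral_nn_integral) (auto simp: indicator_def)
  then have "has_bochner_integral lborel (\<lambda>x. 2 * exp (- 2 * \<bar>x\<bar>)) (2 *\<^sub>R (1 :: real))"
    by (rule has_bochner_integral_even_function) simp
  moreover have "(norm (\<phi>\<^sub>0 x))\<^sup>2 = 2 * exp (- 2 * \<bar>x\<bar>)" for x
    by (simp add: \<phi>\<^sub>0_def norm_mult power_mult_distrib flip: exp_double)
  ultimately show ?thesis unfolding L2_norm_power2 by (simp add: has_bochner_integral_iff)
qed

text \<open>Any two positive times below \<open>Tstar\<close> lie inside some [0,T] with T < Tstar,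
  so each can be compared with the midpoint. The constant \<open>E\<close> is four times the
  energy.\<close>

lemma blow_up_boundary_value:
  assumes "blows_up_at Tstar \<psi>"
  obtains E where "\<And>t. 0 < t \<Longrightarrow> t < Tstar \<Longrightarrow> (norm (\<psi> t 0)) ^ 4 = 2 * (L2_norm (weak_deriv (\<psi> t)))\<^sup>2 - E"
proof -
  have T: "0 < Tstar" and sol: "\<And>T. 0 < T \<Longrightarrow> T < Tstar \<Longrightarrow> H1_solution T \<psi>"
    using assms by (auto simp: blows_up_at_def maximal_H1_solution_def)
  define e where "e t = (L2_norm (weak_deriv (\<psi> t)))\<^sup>2 - (norm (\<psi> t 0)) ^ 4 / 2" for t
  have eq: "e s = e t" if st: "0 < s" "s < t" "t < Tstar" for s t
  proof -
    obtain T where "t < T" "T < Tstar" using dense[OF st(3)] by blast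
    then show ?thesis unfolding e_def using st by (intro H1_solution_energy_conserved[OF sol]) auto
  qed
  have "e t = e (Tstar / 2)" if "0 < t" "t < Tstar" for t
  proof (cases t "Tstar / 2" rule: linorder_cases)
    case less
    then show ?thesis using that T by (intro eq) auto
  next
    case greater
    then show ?thesis using that T by (intro eq[symmetric]) auto
  qed (simp only:)
  then show thesis by (intro that[of "2 * e (Tstar / 2)"]) (simp add: e_def field_simps)
qed

theorem theorem1p6:
  fixes \<psi> :: "real \<Rightarrow> real \<Rightarrow> complex" and \<mu> :: "real \<Rightarrow> real" and Tstar :: real
  assumes "blows_up_at Tstar \<psi>"
    and "filterlim \<mu> at_top (at_left Tstar)"
  shows "Liminf (at_left Tstar)
           (\<lambda>t. ereal (LINT x:{x. \<bar>x\<bar> \<le> \<mu> t * inverse (L2_norm (weak_deriv (\<psi> t)))}|lborel.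
                         (norm (\<psi> t x))\<^sup>2))
         \<ge> ereal ((L2_norm \<phi>\<^sub>0)\<^sup>2)"
proof -
  define L where "L t = L2_norm (weak_deriv (\<psi> t))" for t
  define m where "m t = (LINT x:{x. \<bar>x\<bar> \<le> \<mu> t * inverse (L t)}|lborel. (norm (\<psi> t x))\<^sup>2)" for t
  have Llim: "filterlim L at_top (at_left Tstar)" and T: "0 < Tstar"
    using assms(1) by (auto simp: blows_up_at_def maximal_H1_solution_def L_def[abs_def])
  have H: "H1 (\<psi> t)" if "0 < t" "t < Tstar" for t
  proof -
    have "H1_solution t \<psi>" using that assms(1) by (simp add: blows_up_at_def maximal_H1_solution_def)
    then show "H1 (\<psi> t)" using \<open>0 < t\<close> by (simp add: H1_solution_def continuous_into_H1_def)
  qed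
  obtain E where E: "\<And>t. 0 < t \<Longrightarrow> t < Tstar \<Longrightarrow> (norm (\<psi> t 0)) ^ 4 = 2 * (L t)\<^sup>2 - E"
    using blow_up_boundary_value[OF assms(1)] unfolding L_def by blast
  \<comment> \<open>By contradiction for each r < 2: m(t) <= r would bound |psi(0,t)|^4 by about r
    L^2, while energy conservation makes it 2 L^2 - E.\<close>
  have key: "\<forall>\<^sub>F t in at_left Tstar. r < m t" if r: "0 \<le> r" "r < 2" for r
  proof -
    \<comment> \<open>The bound to be refuted, divided by L^2 and with the energy moved to one side:
      its limit r is below 2.\<close>
    have "((\<lambda>t. (sqrt r + r / 2 * inverse (\<mu> t))\<^sup>2 + E * (inverse (L t))\<^sup>2) \<longlongrightarrow> (sqrt r + r / 2 * 0)\<^sup>2 + E * 0\<^sup>2) (at_left Tstar)"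
      by (intro tendsto_intros filterlim_compose[OF tendsto_inverse_0_at_top] tendsto_inverse_0_at_top assms(2) Llim)
    then have "((\<lambda>t. (sqrt r + r / 2 * inverse (\<mu> t))\<^sup>2 + E * (inverse (L t))\<^sup>2) \<longlongrightarrow> r) (at_left Tstar)"
      using r by simp
    then have "\<forall>\<^sub>F t in at_left Tstar. (sqrt r + r / 2 * inverse (\<mu> t))\<^sup>2 + E * (inverse (L t))\<^sup>2 < 2"
      using r(2) by (rule order_tendstoD(2))
    moreover have "\<forall>\<^sub>F t in at_left Tstar. 0 < t \<and> t < Tstar"
      unfolding eventually_at_left_field using T by auto
    \<comment> \<open>Positivity makes \<open>inverse\<close> a genuine reciprocal and the radius
      positive.\<close>
    moreover have "\<forall>\<^sub>F t in at_left Tstar. 0 < L t" "\<forall>\<^sub>F t in at_left Tstar. 0 < \<mu> t"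
      using Llim assms(2) by (auto simp: filterlim_at_top_dense)
    ultimately show ?thesis
    proof eventually_elim
      case (elim t)
      define R where "R = \<mu> t * inverse (L t)"
      have R: "R > 0" using elim by (simp add: R_def)
      have m: "m t = (LINT x:{-R..R}|lborel. (norm (\<psi> t x))\<^sup>2)"
        unfolding m_def R_def[symmetric] by (intro arg_cong[where f="\<lambda>A. set_lebesgue_integral lborel A _"]) auto
      have m0: "m t \<ge> 0" unfolding m set_lebesgue_integral_def by simp
      show "r < m t"
      proof (rule ccontr)
        assume "\<not> r < m t"
        then have mr: "m t \<le> r" by simp
        have "(norm (\<psi> t 0))\<^sup>2 \<le> m t / (2 * R) + sqrt (m t) * L t"
          using H1_point_bound[OF H R, of t] elim unfolding m L_def by simp
        also have "\<dots> \<le> r / (2 * R) + sqrt r * L t"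
          using mr R elim by (intro add_mono divide_right_mono mult_right_mono) auto
        \<comment> \<open>The radius was chosen so that 1/(2R) = L/(2 \<mu>), a vanishing fraction
          of L.\<close>
        also have "\<dots> = L t * (sqrt r + r / 2 * inverse (\<mu> t))"
          using elim by (simp add: R_def field_simps)
        finally have "((norm (\<psi> t 0))\<^sup>2)\<^sup>2 \<le> (L t * (sqrt r + r / 2 * inverse (\<mu> t)))\<^sup>2"
          by (intro power_mono) auto
        then have "2 * (L t)\<^sup>2 - E \<le> (L t)\<^sup>2 * (sqrt r + r / 2 * inverse (\<mu> t))\<^sup>2"
          using E[of t] elim by (simp add: power_mult_distrib flip: power_mult)
        moreover have "(L t)\<^sup>2 * ((sqrt r + r / 2 * inverse (\<mu> t))\<^sup>2 + E * (inverse (L t))\<^sup>2) < (L t)\<^sup>2 * 2"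
          using elim by (intro mult_strict_left_mono) auto
        moreover have "(L t)\<^sup>2 * ((sqrt r + r / 2 * inverse (\<mu> t))\<^sup>2 + E * (inverse (L t))\<^sup>2) =
            (L t)\<^sup>2 * (sqrt r + r / 2 * inverse (\<mu> t))\<^sup>2 + E"
          using elim by (simp add: distrib_left power_inverse)
        ultimately show False by linarith
      qed
    qed
  qed
  have "ereal 2 \<le> Liminf (at_left Tstar) (\<lambda>t. ereal (m t))"
    unfolding le_Liminf_iff
  proof (intro allI impI)
    fix y assume y: "y < ereal 2"
    \<comment> \<open>\<open>key\<close> asks for r >= 0, so negative levels and minus infinity are
      raised to 0.\<close>
    obtain r where r: "y \<le> ereal r" "0 \<le> r" "r < 2"
    proof (cases y)
      case (real s)
      then show thesis using y by (intro that[of "max 0 s"]) auto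
    next
      case MInf
      then show thesis by (intro that[of 0]) auto
    qed (use y in auto)
    from key[OF r(2,3)] show "\<forall>\<^sub>F t in at_left Tstar. y < ereal (m t)"
    proof eventually_elim
      case (elim t)
      then show ?case using r(1) by (meson ereal_less_eq(3) le_less_trans less_ereal.simps(1))
    qed
  qed
  then show ?thesis by (simp add: L2_norm_ground_state m_def L_def)
qed

end
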